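(* Let $K, L \subset \mathbb{R}^n$ be convex bodies, and suppose that $K, L$ are in maximal intersection position and that $\mathcal{H}^{n-1}(\partial K \cap \partial L) = 0$. For $x \in \partial L$, let $\hat n_L(x)$ be the (outer) unit normal to $L$ at $x$, which is defined $\mathcal{H}^{n-1}$-almost everywhere on $\partial L$. Then $$\int_{K\cap\partial L} \hat n_L(x)\,d\mathcal{H}^{n-1}(x) = 0,$$ and the matrix $$\int_{K\cap\partial L} x\otimes \hat n_L(x)\,d\mathcal{H}^{n-1}(x)$$ is a scalar multiple of $I_n$. The same formulae hold when interchanging the roles of $K$ and $L$.
   Context: A convex body is a compact convex set with nonempty interior. $K, L$ are in maximal intersection position if for every $A \in SL_n(\mathbb{R})$ and $z \in \mathbb{R}^n$, setting $L' = AL+z$, one has $\operatorname{vol}(K\cap L') \le \operatorname{vol}(K\cap L)$. $\mathcal{H}^{n-1}$ is the $(n-1)$-dimensional Hausdorff measure (also written $\operatorname{vol}_{n-1}$). $x\otimes y$ denotes the matrix $xy^T$. *)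

theory Defs
  imports "HOL-Analysis.Analysis"
begin

section \<open>Hausdorff measure\<close>

text \<open>
  The normalisation is the one for which the \<open>n\<close>-dimensional Hausdorff measure on
  \<open>\<real>\<^sup>n\<close> is Lebesgue measure. The empty set has to be treated separately because
  \<open>0 ^ 0 = 1\<close>; with this convention the \<open>0\<close>-dimensional measure is counting measure.
\<close>

definition hausdorff_gauge :: "nat \<Rightarrow> 'a::metric_space set \<Rightarrow> ennreal" where
  "hausdorff_gauge d C =
     (if C = {} then 0 else ennreal (unit_ball_vol (real d) * (diameter C / 2) ^ d))"

text \<open>Boundedness is required since \<^const>\<open>diameter\<close> is only meaningful for bounded sets.\<close>

definition hausdorff_covers :: "real \<Rightarrow> 'a::metric_space set \<Rightarrow> (nat \<Rightarrow> 'a set) set" where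
  "hausdorff_covers \<delta> A =
     {C. A \<subseteq> (\<Union>i. C i) \<and> (\<forall>i. bounded (C i) \<and> diameter (C i) \<le> \<delta>)}"

definition hausdorff_pre :: "nat \<Rightarrow> real \<Rightarrow> 'a::metric_space set \<Rightarrow> ennreal" where
  "hausdorff_pre d \<delta> A = (INF C\<in>hausdorff_covers \<delta> A. \<Sum>i. hausdorff_gauge d (C i))"

definition hausdorff_outer :: "nat \<Rightarrow> 'a::metric_space set \<Rightarrow> ennreal" where
  "hausdorff_outer d A = (SUP \<delta>\<in>{0<..}. hausdorff_pre d \<delta> A)"

definition hausdorff_measure :: "nat \<Rightarrow> 'a::metric_space measure" where
  "hausdorff_measure d = measure_of UNIV (sets borel) (hausdorff_outer d)"

lemma sets_hausdorff_measure [simp, measurable_cong]: "sets (hausdorff_measure d) = sets borel"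
  unfolding hausdorff_measure_def using sets.sigma_sets_eq[of borel]
  by (simp add: sets.space_closed[of borel, simplified])

lemma space_hausdorff_measure [simp]: "space (hausdorff_measure d) = UNIV"
  unfolding hausdorff_measure_def by simp

text \<open>
  Since \<^const>\<open>measure_of\<close> silently returns the null measure when its argument is not
  countably additive, we check with Caratheodory's criterion that it is not degenerate here.
\<close>

lemma hausdorff_gauge_empty [simp]: "hausdorff_gauge d {} = 0"
  by (simp add: hausdorff_gauge_def)

lemma hausdorff_pre_mono: "A \<subseteq> B \<Longrightarrow> hausdorff_pre d \<delta> A \<le> hausdorff_pre d \<delta> B"
  unfolding hausdorff_pre_def hausdorff_covers_def by (rule INF_superset_mono) auto

lemma hausdorff_pre_antimono: "\<delta> \<le> \<epsilon> \<Longrightarrow> hausdorff_pre d \<epsilon> A \<le> hausdorff_pre d \<delta> A"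
  unfolding hausdorff_pre_def hausdorff_covers_def
  by (rule INF_superset_mono) (auto intro: order_trans)

lemma hausdorff_outer_mono: "A \<subseteq> B \<Longrightarrow> hausdorff_outer d A \<le> hausdorff_outer d B"
  unfolding hausdorff_outer_def by (rule SUP_mono) (use hausdorff_pre_mono in blast)

lemma hausdorff_pre_le_outer: "0 < \<delta> \<Longrightarrow> hausdorff_pre d \<delta> A \<le> hausdorff_outer d A"
  unfolding hausdorff_outer_def by (rule SUP_upper) simp

lemma hausdorff_pre_le_cover:
  "C \<in> hausdorff_covers \<delta> A \<Longrightarrow> hausdorff_pre d \<delta> A \<le> (\<Sum>i. hausdorff_gauge d (C i))"
  unfolding hausdorff_pre_def by (rule INF_lower)

lemma hausdorff_outer_empty [simp]: "hausdorff_outer d {} = 0"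
proof -
  have "hausdorff_pre d \<delta> ({} :: 'a set) = 0" if "0 < \<delta>" for \<delta>
    using hausdorff_pre_le_cover[of "\<lambda>_. {}" \<delta> "{} :: 'a set" d] that
    by (simp add: hausdorff_covers_def)
  then show ?thesis
    by (simp add: hausdorff_outer_def)
qed

lemma hausdorff_pre_UN_le:
  fixes A :: "nat \<Rightarrow> 'a::metric_space set"
  shows "hausdorff_pre d \<delta> (\<Union>i. A i) \<le> (\<Sum>i. hausdorff_pre d \<delta> (A i))"
proof (cases "(\<Sum>i. hausdorff_pre d \<delta> (A i)) = \<infinity>")
  case False
  then have fin: "hausdorff_pre d \<delta> (A i) \<noteq> \<infinity>" for i
    using ennreal_suminf_lessD[of "\<lambda>i. hausdorff_pre d \<delta> (A i)" \<infinity>] by (auto simp: less_top)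
  show ?thesis
  proof (rule ennreal_le_epsilon)
    fix e :: real assume e: "0 < e"
    have "\<exists>C\<in>hausdorff_covers \<delta> (A i). (\<Sum>j. hausdorff_gauge d (C j))
            < hausdorff_pre d \<delta> (A i) + ennreal (e * (1/2) ^ Suc i)" for i
    proof -
      have "hausdorff_pre d \<delta> (A i) < hausdorff_pre d \<delta> (A i) + ennreal (e * (1/2) ^ Suc i)"
        using fin[of i] e
          ennreal_add_left_cancel_less[of "hausdorff_pre d \<delta> (A i)" 0 "ennreal (e * (1/2) ^ Suc i)"]
        by simp
      then show ?thesis
        unfolding hausdorff_pre_def by (simp add: INF_less_iff)
    qed
    then obtain C where C: "\<And>i. C i \<in> hausdorff_covers \<delta> (A i)"
      and le: "\<And>i. (\<Sum>j. hausdorff_gauge d (C i j))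
            < hausdorff_pre d \<delta> (A i) + ennreal (e * (1/2) ^ Suc i)"
      by metis
    define D where "D = (\<lambda>k. case prod_decode k of (i, j) \<Rightarrow> C i j)"
    have "D \<in> hausdorff_covers \<delta> (\<Union>i. A i)"
    proof -
      have "x \<in> (\<Union>k. D k)" if "x \<in> A i" for x i
      proof -
        obtain j where "x \<in> C i j"
          using C[of i] \<open>x \<in> A i\<close> unfolding hausdorff_covers_def by blast
        then have "x \<in> D (prod_encode (i, j))"
          by (simp add: D_def)
        then show ?thesis by blast
      qed
      moreover have "bounded (D k) \<and> diameter (D k) \<le> \<delta>" for k
        using C by (auto simp: D_def hausdorff_covers_def split: prod.split)
      ultimately show ?thesis
        unfolding hausdorff_covers_def by blast
    qed
    then have "hausdorff_pre d \<delta> (\<Union>i. A i) \<le> (\<Sum>k. hausdorff_gauge d (D k))"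
      by (rule hausdorff_pre_le_cover)
    also have "\<dots> = (\<Sum>i. \<Sum>j. hausdorff_gauge d (C i j))"
    proof -
      have "(\<Sum>k. case_prod (\<lambda>i j. hausdorff_gauge d (C i j)) (prod_decode k))
          = (\<Sum>i. \<Sum>j. hausdorff_gauge d (C i j))"
        using suminf_ennreal_2dimen[of "\<lambda>i. \<Sum>j. hausdorff_gauge d (C i j)"
            "\<lambda>(i, j). hausdorff_gauge d (C i j)"] by (simp add: comp_def)
      then show ?thesis
        by (simp add: D_def split_beta)
    qed
    also have "\<dots> \<le> (\<Sum>i. hausdorff_pre d \<delta> (A i) + ennreal (e * (1/2) ^ Suc i))"
      by (intro suminf_le less_imp_le[OF le]) auto
    also have "\<dots> = (\<Sum>i. hausdorff_pre d \<delta> (A i)) + (\<Sum>i. ennreal (e * (1/2) ^ Suc i))"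
      by (rule suminf_add[symmetric]) auto
    also have "(\<Sum>i. ennreal (e * (1/2) ^ Suc i)) = ennreal e"
    proof -
      have "(\<lambda>i. e * (1/2) ^ Suc i) sums (e * 1)"
        by (intro sums_mult power_half_series)
      then show ?thesis
        using e by (intro suminf_ennreal_eq) auto
    qed
    finally show "hausdorff_pre d \<delta> (\<Union>i. A i) \<le> (\<Sum>i. hausdorff_pre d \<delta> (A i)) + ennreal e" .
  qed
qed simp

lemma hausdorff_outer_UN_le:
  fixes A :: "nat \<Rightarrow> 'a::metric_space set"
  shows "hausdorff_outer d (\<Union>i. A i) \<le> (\<Sum>i. hausdorff_outer d (A i))"
  unfolding hausdorff_outer_def[of d "\<Union>i. A i"]
proof (rule SUP_least)
  fix \<delta> :: real assume "\<delta> \<in> {0<..}"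
  then have "(\<Sum>i. hausdorff_pre d \<delta> (A i)) \<le> (\<Sum>i. hausdorff_outer d (A i))"
    by (intro suminf_le) (auto intro: hausdorff_pre_le_outer)
  then show "hausdorff_pre d \<delta> (\<Union>i. A i) \<le> (\<Sum>i. hausdorff_outer d (A i))"
    using hausdorff_pre_UN_le order_trans by blast
qed

lemma hausdorff_outer_Un_le:
  "hausdorff_outer d (A \<union> B) \<le> hausdorff_outer d A + hausdorff_outer d B"
proof -
  have "hausdorff_outer d (\<Union>i. binaryset A B i) \<le> (\<Sum>i. hausdorff_outer d (binaryset A B i))"
    by (rule hausdorff_outer_UN_le)
  then show ?thesis
    by (simp add: UN_binaryset_eq suminf_binaryset_eq)
qed

lemma hausdorff_outer_separated:
  fixes A B :: "'a::metric_space set"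
  assumes "0 < e" and sep: "\<And>x y. x \<in> A \<Longrightarrow> y \<in> B \<Longrightarrow> e \<le> dist x y"
  shows "hausdorff_outer d A + hausdorff_outer d B \<le> hausdorff_outer d (A \<union> B)"
proof -
  have small: "hausdorff_pre d \<delta> A + hausdorff_pre d \<delta> B \<le> hausdorff_pre d \<delta> (A \<union> B)"
    if "0 < \<delta>" "\<delta> < e" for \<delta>
    unfolding hausdorff_pre_def[of d \<delta> "A \<union> B"]
  proof (rule INF_greatest)
    fix C assume C: "C \<in> hausdorff_covers \<delta> (A \<union> B)"
    define S where "S = (\<lambda>X i. if C i \<inter> X = {} then {} else C i)"
    have S: "S X \<in> hausdorff_covers \<delta> X" if "X \<subseteq> A \<union> B" for X
    proof -
      have "x \<in> (\<Union>i. S X i)" if "x \<in> X" for x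
      proof -
        obtain i where "x \<in> C i"
          using C \<open>x \<in> X\<close> \<open>X \<subseteq> A \<union> B\<close> unfolding hausdorff_covers_def by blast
        then have "x \<in> S X i"
          using \<open>x \<in> X\<close> by (auto simp: S_def)
        then show ?thesis by blast
      qed
      moreover have "bounded (S X i) \<and> diameter (S X i) \<le> \<delta>" for i
        using C \<open>0 < \<delta>\<close> by (auto simp: S_def hausdorff_covers_def)
      ultimately show ?thesis
        unfolding hausdorff_covers_def by blast
    qed
    have "hausdorff_pre d \<delta> A + hausdorff_pre d \<delta> B
        \<le> (\<Sum>i. hausdorff_gauge d (S A i)) + (\<Sum>i. hausdorff_gauge d (S B i))"
      by (intro add_mono hausdorff_pre_le_cover S) auto
    also have "\<dots> = (\<Sum>i. hausdorff_gauge d (S A i) + hausdorff_gauge d (S B i))"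
      by (rule suminf_add) auto
    also have "\<dots> \<le> (\<Sum>i. hausdorff_gauge d (C i))"
    proof (intro suminf_le)
      fix i
      have "C i \<inter> A = {} \<or> C i \<inter> B = {}"
      proof (rule ccontr)
        assume "\<not> ?thesis"
        then obtain x y where xy: "x \<in> C i" "x \<in> A" "y \<in> C i" "y \<in> B" by blast
        have "bounded (C i)" "diameter (C i) \<le> \<delta>"
          using C by (auto simp: hausdorff_covers_def)
        then have "dist x y \<le> \<delta>"
          using diameter_bounded_bound[of "C i" x y] xy by auto
        then show False
          using sep[of x y] xy \<open>\<delta> < e\<close> by auto
      qed
      then show "hausdorff_gauge d (S A i) + hausdorff_gauge d (S B i) \<le> hausdorff_gauge d (C i)"
        by (auto simp: S_def)
    qed auto
    finally show "hausdorff_pre d \<delta> A + hausdorff_pre d \<delta> B \<le> (\<Sum>i. hausdorff_gauge d (C i))" .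
  qed
  have "hausdorff_outer d A + hausdorff_outer d B
      = (SUP \<delta>\<in>{0<..}. hausdorff_pre d \<delta> A + hausdorff_pre d \<delta> B)"
    unfolding hausdorff_outer_def
  proof (rule SUP_add_directed_ennreal[symmetric])
    fix \<delta> \<epsilon> :: real assume "\<delta> \<in> {0<..}" "\<epsilon> \<in> {0<..}"
    then show "\<exists>k\<in>{0<..}. hausdorff_pre d \<delta> A + hausdorff_pre d \<epsilon> B
        \<le> hausdorff_pre d k A + hausdorff_pre d k B"
      by (intro bexI[of _ "min \<delta> \<epsilon>"] add_mono hausdorff_pre_antimono) auto
  qed
  also have "\<dots> \<le> hausdorff_outer d (A \<union> B)"
  proof (rule SUP_least)
    fix \<delta> :: real assume "\<delta> \<in> {0<..}"
    define \<epsilon> where "\<epsilon> = min \<delta> (e / 2)"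
    have \<epsilon>: "0 < \<epsilon>" "\<epsilon> < e" "\<epsilon> \<le> \<delta>"
      using \<open>\<delta> \<in> {0<..}\<close> \<open>0 < e\<close> by (auto simp: \<epsilon>_def)
    have "hausdorff_pre d \<delta> A + hausdorff_pre d \<delta> B \<le> hausdorff_pre d \<epsilon> A + hausdorff_pre d \<epsilon> B"
      by (intro add_mono hausdorff_pre_antimono \<epsilon>)
    also have "\<dots> \<le> hausdorff_pre d \<epsilon> (A \<union> B)"
      by (intro small \<epsilon>)
    also have "\<dots> \<le> hausdorff_outer d (A \<union> B)"
      by (intro hausdorff_pre_le_outer \<epsilon>)
    finally show "hausdorff_pre d \<delta> A + hausdorff_pre d \<delta> B \<le> hausdorff_outer d (A \<union> B)" .
  qed
  finally show ?thesis .
qed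

lemma hausdorff_outer_closed_split:
  fixes C X :: "'a::metric_space set"
  assumes "closed C"
  shows "hausdorff_outer d (C \<inter> X) + hausdorff_outer d (X - C) \<le> hausdorff_outer d X"
proof (cases "C = {} \<or> hausdorff_outer d X = \<infinity>")
  case True
  then show ?thesis by auto
next
  case False
  then have ne: "C \<noteq> {}" and fin: "hausdorff_outer d X < \<infinity>"
    by (auto simp: less_top)
  define a where "a = (\<lambda>k::nat. 1 / real (Suc k))"
  have a_pos: "0 < a k" for k
    by (simp add: a_def)
  have a_anti: "a k \<le> a j" if "j \<le> k" for j k
    using that by (simp add: a_def frac_le)
  have a_strict: "a (Suc k) < a k" for k
    by (simp add: a_def frac_less2)
  define E where "E = (\<lambda>k. {x\<in>X. a k \<le> infdist x C})"
  define D where "D = (\<lambda>k. {x\<in>X. a (Suc k) \<le> infdist x C \<and> infdist x C < a k})"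
  have inf_dist: "infdist x C - infdist y C \<le> dist x y" for x y
    using infdist_triangle[of x C y] by (simp add: algebra_simps)
  have step: "(\<Sum>j<m. hausdorff_outer d (D (2 * j + r))) \<le> hausdorff_outer d (\<Union>j<m. D (2 * j + r))"
    for m r
  proof (induction m)
    case (Suc m)
    let ?U = "\<Union>j<m. D (2 * j + r)"
    have "(\<Sum>j<Suc m. hausdorff_outer d (D (2 * j + r)))
        \<le> hausdorff_outer d ?U + hausdorff_outer d (D (2 * m + r))"
      using Suc by (simp add: add_right_mono)
    also have "\<dots> \<le> hausdorff_outer d (?U \<union> D (2 * m + r))"
    proof (cases m)
      case (Suc m')
      show ?thesis
      proof (rule hausdorff_outer_separated)
        show "0 < a (2 * m' + 1 + r) - a (2 * m + r)"
          using a_strict[of "2 * m' + 1 + r"] Suc by simp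
        fix x y assume "x \<in> ?U" "y \<in> D (2 * m + r)"
        then obtain j where j: "j < m" "x \<in> D (2 * j + r)" by blast
        have "a (2 * m' + 1 + r) \<le> a (Suc (2 * j + r))"
          using j Suc by (intro a_anti) auto
        also have "\<dots> \<le> infdist x C"
          using j by (auto simp: D_def)
        finally show "a (2 * m' + 1 + r) - a (2 * m + r) \<le> dist x y"
          using \<open>y \<in> D (2 * m + r)\<close> inf_dist[of x y] by (auto simp: D_def)
      qed
    qed simp
    also have "?U \<union> D (2 * m + r) = (\<Union>j<Suc m. D (2 * j + r))"
      by (auto simp: less_Suc_eq)
    finally show ?case .
  qed simp
  have half: "(\<Sum>j. hausdorff_outer d (D (2 * j + r))) \<le> hausdorff_outer d X" for r
  proof (rule suminf_le_const)
    show "(\<Sum>j<m. hausdorff_outer d (D (2 * j + r))) \<le> hausdorff_outer d X" for m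
      by (rule order_trans[OF step hausdorff_outer_mono]) (auto simp: D_def)
  qed auto
  have "(\<Sum>k<2*m. hausdorff_outer d (D k)) =
      (\<Sum>j<m. hausdorff_outer d (D (2 * j + 0))) + (\<Sum>j<m. hausdorff_outer d (D (2 * j + 1)))" for m
    by (induction m) (auto simp: algebra_simps)
  moreover have "(\<Sum>j<m. hausdorff_outer d (D (2 * j + r))) \<le> hausdorff_outer d X" for m r
    using sum_le_suminf[of "\<lambda>j. hausdorff_outer d (D (2 * j + r))" "{..<m}"] half[of r]
    by (auto intro: order_trans)
  ultimately have "(\<Sum>k<2*m. hausdorff_outer d (D k)) \<le> hausdorff_outer d X + hausdorff_outer d X" for m
    by (simp only: add_mono)
  then have part: "(\<Sum>k<m. hausdorff_outer d (D k)) \<le> hausdorff_outer d X + hausdorff_outer d X" for m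
    by (intro order_trans[OF sum_mono2[of "{..<2*m}" "{..<m}"]]) auto
  let ?T = "\<Sum>k. hausdorff_outer d (D k)"
  have "?T \<le> hausdorff_outer d X + hausdorff_outer d X"
    by (rule suminf_le_const) (use part in auto)
  also have "\<dots> < \<infinity>"
    using fin by simp
  finally have tot: "?T \<noteq> \<infinity>"
    by auto
  have main: "hausdorff_outer d (C \<inter> X) + hausdorff_outer d (X - C) + (\<Sum>j<k. hausdorff_outer d (D j))
      \<le> hausdorff_outer d X + ?T" for k
  proof -
    have cover: "X - C \<subseteq> E k \<union> (\<Union>j. D (j + k))"
    proof
      fix x assume x: "x \<in> X - C"
      then have "0 < infdist x C"
        using \<open>closed C\<close> ne in_closed_iff_infdist_zero[of C x] infdist_nonneg[of x C] by simp
      then have "\<exists>n. a n < infdist x C"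
        unfolding a_def inverse_eq_divide[symmetric] by (rule reals_Archimedean)
      then obtain n where n: "a n < infdist x C" ..
      define i where "i = (LEAST i. a i \<le> infdist x C)"
      have i: "a i \<le> infdist x C"
        unfolding i_def by (rule LeastI[of _ n]) (use n in simp)
      show "x \<in> E k \<union> (\<Union>j. D (j + k))"
      proof (cases "i \<le> k")
        case True
        then have "x \<in> E k"
          using x i a_anti[of i k] by (auto simp: E_def)
        then show ?thesis by blast
      next
        case False
        then obtain i' where i': "i = Suc i'" "k \<le> i'"
          by (cases i) auto
        have "\<not> a i' \<le> infdist x C"
          using not_less_Least[of i' "\<lambda>i. a i \<le> infdist x C"] i' by (simp add: i_def)
        then have "x \<in> D ((i' - k) + k)"
          using x i i' by (auto simp: D_def)
        then show ?thesis by blast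
      qed
    qed
    have "hausdorff_outer d (X - C) \<le> hausdorff_outer d (E k \<union> (\<Union>j. D (j + k)))"
      by (rule hausdorff_outer_mono[OF cover])
    also have "\<dots> \<le> hausdorff_outer d (E k) + hausdorff_outer d (\<Union>j. D (j + k))"
      by (rule hausdorff_outer_Un_le)
    also have "\<dots> \<le> hausdorff_outer d (E k) + (\<Sum>j. hausdorff_outer d (D (j + k)))"
      by (intro add_left_mono hausdorff_outer_UN_le)
    finally have "hausdorff_outer d (X - C) + (\<Sum>j<k. hausdorff_outer d (D j)) \<le>
        hausdorff_outer d (E k) + ((\<Sum>j. hausdorff_outer d (D (j + k))) + (\<Sum>j<k. hausdorff_outer d (D j)))"
      by (metis add.assoc add_right_mono)
    also have "(\<Sum>j. hausdorff_outer d (D (j + k))) + (\<Sum>j<k. hausdorff_outer d (D j)) = ?T"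
      by (rule suminf_offset[symmetric]) auto
    finally have 1: "hausdorff_outer d (X - C) + (\<Sum>j<k. hausdorff_outer d (D j)) \<le> hausdorff_outer d (E k) + ?T" .
    have "hausdorff_outer d (C \<inter> X) + hausdorff_outer d (E k) \<le> hausdorff_outer d (C \<inter> X \<union> E k)"
    proof (rule hausdorff_outer_separated[OF a_pos[of k]])
      fix x y assume "x \<in> C \<inter> X" "y \<in> E k"
      then show "a k \<le> dist x y"
        using infdist_le[of x C y] by (auto simp: E_def dist_commute)
    qed
    also have "\<dots> \<le> hausdorff_outer d X"
      by (rule hausdorff_outer_mono) (auto simp: E_def)
    finally have 2: "hausdorff_outer d (C \<inter> X) + hausdorff_outer d (E k) \<le> hausdorff_outer d X" .
    show ?thesis
      using order_trans[OF add_left_mono[OF 1, of "hausdorff_outer d (C \<inter> X)"]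
          add_right_mono[OF 2, of ?T, unfolded add.assoc]]
      unfolding add.assoc .
  qed
  have "(\<lambda>k. hausdorff_outer d (C \<inter> X) + hausdorff_outer d (X - C) + (\<Sum>j<k. hausdorff_outer d (D j)))
      \<longlonglongrightarrow> hausdorff_outer d (C \<inter> X) + hausdorff_outer d (X - C) + ?T"
    by (intro tendsto_add tendsto_const summable_LIMSEQ) auto
  then have "hausdorff_outer d (C \<inter> X) + hausdorff_outer d (X - C) + ?T \<le> hausdorff_outer d X + ?T"
    by (rule LIMSEQ_le_const2) (use main in auto)
  then show ?thesis
    using tot ennreal_add_left_cancel_le[of ?T] by (simp add: add.commute)
qed

lemma emeasure_hausdorff_measure:
  fixes A :: "'a::metric_space set"
  assumes "A \<in> sets borel"
  shows "emeasure (hausdorff_measure d) A = hausdorff_outer d A"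
proof -
  let ?\<Lambda> = "lambda_system UNIV (Pow UNIV) (hausdorff_outer d :: 'a set \<Rightarrow> ennreal)"
  interpret P: sigma_algebra "UNIV :: 'a set" "Pow UNIV"
    by (rule sigma_algebra_Pow)
  have "outer_measure_space (Pow UNIV) (hausdorff_outer d :: 'a set \<Rightarrow> ennreal)"
    unfolding outer_measure_space_def positive_def increasing_def countably_subadditive_def
    by (auto intro: hausdorff_outer_mono hausdorff_outer_UN_le)
  then have ms: "measure_space UNIV ?\<Lambda> (hausdorff_outer d)"
    by (rule P.caratheodory_lemma)
  then interpret L: sigma_algebra "UNIV :: 'a set" ?\<Lambda>
    by (simp add: measure_space_def)
  have "C \<in> ?\<Lambda>" if "closed C" for C
  proof -
    have "hausdorff_outer d (C \<inter> X) + hausdorff_outer d ((UNIV - C) \<inter> X) = hausdorff_outer d X" for X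
    proof (rule antisym)
      have "(UNIV - C) \<inter> X = X - C" by auto
      then show "hausdorff_outer d (C \<inter> X) + hausdorff_outer d ((UNIV - C) \<inter> X) \<le> hausdorff_outer d X"
        using hausdorff_outer_closed_split[OF that, of d X] by simp
      have "C \<inter> X \<union> (UNIV - C) \<inter> X = X" by auto
      then show "hausdorff_outer d X \<le> hausdorff_outer d (C \<inter> X) + hausdorff_outer d ((UNIV - C) \<inter> X)"
        using hausdorff_outer_Un_le[of d "C \<inter> X" "(UNIV - C) \<inter> X"] by simp
    qed
    then show ?thesis
      by (simp add: lambda_system_def)
  qed
  then have "sigma_sets UNIV (Collect closed) \<subseteq> ?\<Lambda>"
    by (intro L.sigma_sets_subset) auto
  then have "sets (borel :: 'a measure) \<subseteq> ?\<Lambda>"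
    by (simp add: borel_eq_closed)
  moreover have "sigma_algebra UNIV (sets (borel :: 'a measure))"
    using sets.sigma_algebra_axioms[of borel] by simp
  ultimately have "measure_space UNIV (sets borel) (hausdorff_outer d :: 'a set \<Rightarrow> ennreal)"
    using measure_down[OF ms] by blast
  then show ?thesis
    unfolding hausdorff_measure_def measure_space_def
    by (intro emeasure_measure_of_sigma assms) auto
qed

section \<open>Convex bodies\<close>

definition convex_body :: "'a::euclidean_space set \<Rightarrow> bool" where
  "convex_body K \<longleftrightarrow> convex K \<and> compact K \<and> interior K \<noteq> {}"

definition maximal_intersection_position :: "(real^'n) set \<Rightarrow> (real^'n) set \<Rightarrow> bool" where
  "maximal_intersection_position K L \<longleftrightarrow>
     (\<forall>(A :: real^'n^'n) z. det A = 1 \<longrightarrow>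
        measure lborel (K \<inter> (\<lambda>x. A *v x + z) ` L) \<le> measure lborel (K \<inter> L))"

definition outer_unit_normals :: "'a::euclidean_space set \<Rightarrow> 'a \<Rightarrow> 'a set" where
  "outer_unit_normals L x = {u. norm u = 1 \<and> (\<forall>y\<in>L. u \<bullet> (y - x) \<le> 0)}"

text \<open>
  The outer unit normal, set to \<open>0\<close> (which is not a unit vector) at the points at which it is
  not defined. A bare \<open>THE\<close> would take unknown values there, and the function could
  fail to be Borel measurable.
\<close>

definition outer_unit_normal :: "'a::euclidean_space set \<Rightarrow> 'a \<Rightarrow> 'a" where
  "outer_unit_normal L x =
     (if \<exists>!u. u \<in> outer_unit_normals L x then THE u. u \<in> outer_unit_normals L x else 0)"

definition outer_prod :: "real^'n \<Rightarrow> real^'n \<Rightarrow> real^'n^'n" where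
  "outer_prod x y = (\<chi> i j. x $ i * y $ j)"

abbreviation surface_measure :: "(real^'n) measure" where
  "surface_measure \<equiv> hausdorff_measure (CARD('n) - 1)"

end

theory Submission
  imports Defs
begin

text \<open>
  The group generated by translations and shears \<open>x + (b \<bullet> x + s) *\<^sub>R u\<close> with \<open>b\<close> orthogonal to
  the unit vector \<open>u\<close> is large enough: if the first variation of the volume vanishes along these maps,
  then the matrix maps every \<open>u\<close> to a multiple of itself. Such a map slides every line in direction
  \<open>u\<close> along itself, so by Fubini the volume of \<open>K \<inter> L'\<close> is an integral of lengths of overlapping
  intervals, whose derivative only involves the end points of the sections of \<open>L\<close>; the sections
  on which it fails to exist pass through \<open>frontier K \<inter> frontier L\<close> and are negligible.

  Writing \<open>top_measure L u\<close> for the image of Lebesgue measure on \<open>hyp u\<close> under the map to the upper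
  end point of the section in direction \<open>u\<close>, it remains to show that, up to a constant,
  \<open>top_measure L u - top_measure L (- u)\<close> has density \<open>n \<bullet> u\<close> with respect to surface measure. By the
  divergence theorem the difference is linear in \<open>u\<close>, so it is given by a vector measure \<open>flux\<close>.
  Projections do not increase Hausdorff measure, so \<open>flux\<close> is bounded by surface measure; and
  where the normals are close to \<open>u\<close>, the projection along \<open>u\<close> is almost isometric (monotonicity
  of the normals suffices, no differentiability is needed), so the \<open>u\<close>-component of \<open>flux\<close> almost
  attains this bound. Hence \<open>flux\<close> is close to \<open>u\<close> times surface measure there. Comparing two
  directions also shows that points with two normals form a null set.
\<close>

section \<open>Lebesgue measure along parallel lines\<close>

text \<open>Both conclusions are homogeneous in the surface measure, so everything is done up to one
  constant \<open>c\<close>: on hyperplanes \<open>hausdorff_outer\<close> is \<open>c\<close> times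
  the Lebesgue measure of a cylinder of unit thickness. Translation invariance gives such a constant
  for each direction, rotations make it the same for all directions, and comparisons with cubes show
  that it is finite and positive. Its independence of \<open>u\<close> is essential, since bounds in
  different directions are combined against a single surface measure.

  The hypothesis on the common frontier turns a maximum into an equation. If an end of a section of
  \<open>K\<close> meets an end of a section of \<open>L\<close>, the overlap can have different
  one-sided derivatives, and maximality would give inequalities only. Away from such lines the
  derivative is linear in the speed of the shear, so the speeds given by \<open>(b, s)\<close> and
  \<open>(- b, - s)\<close> give opposite inequalities.

  Linearity in \<open>u\<close> is an identity between signed measures. It is tested on polynomials,
  whose derivatives are linear in the direction, and carried to Borel sets by approximation.\<close>

text \<open>The slab has width \<open>1\<close>: restricting a function that is constant along \<open>u\<close> to it makes the
  Lebesgue integral over the whole space stand for the one over the hyperplane orthogonal to \<open>u\<close>.\<close>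

definition slab :: "'a::euclidean_space \<Rightarrow> 'a set" where
  "slab u = {x. \<bar>u \<bullet> x\<bar> < 1/2}"

lemma slab_borel [measurable]: "slab u \<in> sets borel"
proof -
  have "open (slab u)"
    unfolding slab_def by (intro open_Collect_less continuous_intros)
  then show ?thesis by simp
qed

lemma nn_integral_lborel_shift:
  fixes c :: "'a::euclidean_space"
  assumes [measurable]: "f \<in> borel_measurable borel"
  shows "(\<integral>\<^sup>+x. f (c + x) \<partial>lborel) = (\<integral>\<^sup>+x. f x \<partial>lborel)"
proof -
  have "(\<integral>\<^sup>+x. f x \<partial>lborel) = (\<integral>\<^sup>+x. f x \<partial>distr lborel borel ((+) c))"
    by (simp add: lborel_distr_plus)
  also have "\<dots> = (\<integral>\<^sup>+x. f (c + x) \<partial>lborel)"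
    by (subst nn_integral_distr) auto
  finally show ?thesis by simp
qed

text \<open>A form of Fubini without coordinates. After exchanging the integrals and translating by
  \<open>s *\<^sub>R u\<close>, each point sees an interval of parameters \<open>s\<close> of length
  1, because the slab has width 1.\<close>

lemma nn_integral_lborel_lines:
  fixes u :: "'a::euclidean_space"
  assumes [measurable]: "f \<in> borel_measurable borel" and u: "norm u = 1"
  shows "(\<integral>\<^sup>+x. f x \<partial>lborel) =
    (\<integral>\<^sup>+x. indicator (slab u) x * (\<integral>\<^sup>+s. f (x + s *\<^sub>R u) \<partial>lborel) \<partial>lborel)"
proof -
  have uu: "u \<bullet> u = 1" using u by (simp add: dot_square_norm)
  have "(\<integral>\<^sup>+x. indicator (slab u) x * (\<integral>\<^sup>+s. f (x + s *\<^sub>R u) \<partial>lborel) \<partial>lborel)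
      = (\<integral>\<^sup>+x. (\<integral>\<^sup>+s. indicator (slab u) x * f (x + s *\<^sub>R u) \<partial>lborel) \<partial>lborel)"
    by (intro nn_integral_cong nn_integral_cmult[symmetric]) simp
  also have "\<dots> = (\<integral>\<^sup>+s. (\<integral>\<^sup>+x. indicator (slab u) x * f (x + s *\<^sub>R u) \<partial>lborel) \<partial>lborel)"
    by (rule lborel_pair.Fubini'[symmetric]) simp
  also have "\<dots> = (\<integral>\<^sup>+s. (\<integral>\<^sup>+x. indicator (slab u) (x - s *\<^sub>R u) * f x \<partial>lborel) \<partial>lborel)"
  proof (rule nn_integral_cong)
    fix s :: real
    show "(\<integral>\<^sup>+x. indicator (slab u) x * f (x + s *\<^sub>R u) \<partial>lborel)
        = (\<integral>\<^sup>+x. indicator (slab u) (x - s *\<^sub>R u) * f x \<partial>lborel)"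
      using nn_integral_lborel_shift[of "\<lambda>x. indicator (slab u) (x - s *\<^sub>R u) * f x" "s *\<^sub>R u"]
      by (simp add: add.commute)
  qed
  also have "\<dots> = (\<integral>\<^sup>+x. (\<integral>\<^sup>+s. indicator (slab u) (x - s *\<^sub>R u) * f x \<partial>lborel) \<partial>lborel)"
    by (rule lborel_pair.Fubini') simp
  also have "\<dots> = (\<integral>\<^sup>+x. f x \<partial>lborel)"
  proof (rule nn_integral_cong)
    fix x :: 'a
    have "(\<integral>\<^sup>+s. indicator (slab u) (x - s *\<^sub>R u) * f x \<partial>lborel)
        = (\<integral>\<^sup>+s. indicator {u \<bullet> x - 1/2 <..< u \<bullet> x + 1/2} s * f x \<partial>lborel)"
      by (intro nn_integral_cong arg_cong2[where f="(*)"] refl)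
         (auto simp: indicator_def slab_def inner_diff_right uu abs_if)
    also have "\<dots> = f x"
      by (subst nn_integral_multc) auto
    finally show "(\<integral>\<^sup>+s. indicator (slab u) (x - s *\<^sub>R u) * f x \<partial>lborel) = f x" .
  qed
  finally show ?thesis ..
qed

text \<open>Integrating \<open>f x * g (y - x)\<close> against both measures in either order shows that the
  two measures are proportional.\<close>

lemma translation_invariant_lborel:
  fixes M :: "'a::euclidean_space measure"
  assumes "sigma_finite_measure M" and sets: "sets M = sets borel"
    and inv: "\<And>z. distr M borel ((+) z) = M"
    and A: "A \<in> sets borel"
  shows "emeasure M A * emeasure lborel (cball (0::'a) 1) = emeasure M (cball 0 1) * emeasure lborel A"
proof -
  interpret M: sigma_finite_measure M by fact
  interpret pair_sigma_finite M "lborel :: 'a measure" ..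
  note [measurable_cong] = sets
  note [measurable] = A
  have [measurable]: "cball (0::'a) 1 \<in> sets borel" by simp
  let ?f = "indicator A :: 'a \<Rightarrow> ennreal" and ?g = "indicator (cball 0 1) :: 'a \<Rightarrow> ennreal"
  have shiftM: "(\<integral>\<^sup>+x. h (z + x) \<partial>M) = (\<integral>\<^sup>+x. h x \<partial>M)"
    if [measurable]: "h \<in> borel_measurable borel" for h :: "'a \<Rightarrow> ennreal" and z
  proof -
    have "(\<integral>\<^sup>+x. h x \<partial>M) = (\<integral>\<^sup>+x. h x \<partial>distr M borel ((+) z))"
      by (simp add: inv)
    also have "\<dots> = (\<integral>\<^sup>+x. h (z + x) \<partial>M)"
      by (subst nn_integral_distr) auto
    finally show ?thesis by simp
  qed
  have "emeasure M A * emeasure lborel (cball (0::'a) 1) = (\<integral>\<^sup>+x. ?f x * (\<integral>\<^sup>+y. ?g y \<partial>lborel) \<partial>M)"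
    using sets by (subst nn_integral_multc) (auto simp: A)
  also have "\<dots> = (\<integral>\<^sup>+x. (\<integral>\<^sup>+y. ?f x * ?g (- x + y) \<partial>lborel) \<partial>M)"
  proof (rule nn_integral_cong)
    fix x :: 'a
    have "(\<integral>\<^sup>+y. ?f x * ?g (- x + y) \<partial>lborel) = ?f x * (\<integral>\<^sup>+y. ?g (- x + y) \<partial>lborel)"
      by (rule nn_integral_cmult) measurable
    also have "(\<integral>\<^sup>+y. ?g (- x + y) \<partial>lborel) = (\<integral>\<^sup>+y. ?g y \<partial>lborel)"
      by (rule nn_integral_lborel_shift) measurable
    finally show "?f x * (\<integral>\<^sup>+y. ?g y \<partial>lborel) = (\<integral>\<^sup>+y. ?f x * ?g (- x + y) \<partial>lborel)" ..
  qed
  also have "\<dots> = (\<integral>\<^sup>+y. (\<integral>\<^sup>+x. ?f x * ?g (- x + y) \<partial>M) \<partial>lborel)"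
    by (rule Fubini'[symmetric]) simp
  also have "\<dots> = (\<integral>\<^sup>+y. (\<integral>\<^sup>+x. ?f (y + x) * ?g (- x) \<partial>M) \<partial>lborel)"
  proof (rule nn_integral_cong)
    fix y :: 'a
    show "(\<integral>\<^sup>+x. ?f x * ?g (- x + y) \<partial>M) = (\<integral>\<^sup>+x. ?f (y + x) * ?g (- x) \<partial>M)"
      using shiftM[of "\<lambda>x. ?f x * ?g (- x + y)" y] by simp
  qed
  also have "\<dots> = (\<integral>\<^sup>+x. (\<integral>\<^sup>+y. ?f (y + x) * ?g (- x) \<partial>lborel) \<partial>M)"
    by (rule Fubini') simp
  also have "\<dots> = (\<integral>\<^sup>+x. emeasure lborel A * ?g x \<partial>M)"
  proof (rule nn_integral_cong)
    fix x :: 'a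
    have "(\<integral>\<^sup>+y. ?f (y + x) * ?g (- x) \<partial>lborel) = (\<integral>\<^sup>+y. ?f (x + y) \<partial>lborel) * ?g (- x)"
      by (subst nn_integral_multc) (auto simp: add.commute)
    also have "\<dots> = emeasure lborel A * ?g x"
      by (subst nn_integral_lborel_shift) (auto simp: A indicator_def)
    finally show "(\<integral>\<^sup>+y. ?f (y + x) * ?g (- x) \<partial>lborel) = emeasure lborel A * ?g x" .
  qed
  also have "\<dots> = emeasure M (cball 0 1) * emeasure lborel A"
    by (subst nn_integral_cmult) (auto simp: sets mult.commute)
  finally show ?thesis .
qed

section \<open>Hausdorff measure and Lipschitz maps\<close>

lemma hausdorff_gauge_lipschitz_image:
  fixes f :: "'a::metric_space \<Rightarrow> 'b::metric_space"
  assumes B: "0 < B" and lip: "\<And>x y. x \<in> C \<Longrightarrow> y \<in> C \<Longrightarrow> dist (f x) (f y) \<le> B * dist x y"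
    and "bounded C"
  shows "bounded (f ` C)" "diameter (f ` C) \<le> B * diameter C"
    "hausdorff_gauge d (f ` C) \<le> ennreal (B ^ d) * hausdorff_gauge d C"
proof -
  have le: "dist (f x) (f y) \<le> B * diameter C" if "x \<in> C" "y \<in> C" for x y
    using lip[OF that] diameter_bounded_bound[OF \<open>bounded C\<close> that] B
    by (meson mult_left_mono order_trans less_imp_le)
  show bd: "bounded (f ` C)"
    unfolding bounded_def
  proof (cases "C = {}")
    case False
    then obtain a where "a \<in> C" by auto
    then show "\<exists>x e. \<forall>y\<in>f ` C. dist x y \<le> e"
      using le by (intro exI[of _ "f a"] exI[of _ "B * diameter C"]) auto
  qed auto
  show diam: "diameter (f ` C) \<le> B * diameter C"
  proof (cases "C = {}")
    case False
    then show ?thesis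
      unfolding diameter_def[of "f ` C"] by (auto intro!: cSUP_least le)
  qed simp
  show "hausdorff_gauge d (f ` C) \<le> ennreal (B ^ d) * hausdorff_gauge d C"
  proof (cases "C = {}")
    case False
    have "diameter (f ` C) / 2 \<le> B * (diameter C / 2)"
      using diam by simp
    then have "(diameter (f ` C) / 2) ^ d \<le> (B * (diameter C / 2)) ^ d"
      using diameter_ge_0[OF bd] by (intro power_mono) auto
    then have "unit_ball_vol (real d) * (diameter (f ` C) / 2) ^ d
        \<le> B ^ d * (unit_ball_vol (real d) * (diameter C / 2) ^ d)"
      by (metis mult.left_commute mult_left_mono power_mult_distrib unit_ball_vol_nonneg of_nat_0_le_iff)
    then show ?thesis
      using False B diameter_ge_0[OF \<open>bounded C\<close>]
      by (simp add: hausdorff_gauge_def ennreal_mult[symmetric] ennreal_leI)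
  qed simp
qed

lemma hausdorff_outer_lipschitz_image:
  fixes f :: "'a::metric_space \<Rightarrow> 'b::metric_space"
  assumes B: "0 < B" and lip: "\<And>x y. x \<in> S \<Longrightarrow> y \<in> S \<Longrightarrow> dist (f x) (f y) \<le> B * dist x y"
  shows "hausdorff_outer d (f ` S) \<le> ennreal (B ^ d) * hausdorff_outer d S"
  unfolding hausdorff_outer_def[of d "f ` S"]
proof (rule SUP_least)
  fix \<delta> :: real assume "\<delta> \<in> {0<..}"
  then have \<delta>: "0 < \<delta> / B" using B by simp
  have inv: "ennreal (B ^ d) * (ennreal (1 / B ^ d) * x) = x" for x
    using B by (simp add: mult.assoc[symmetric] ennreal_mult[symmetric])
  \<comment> \<open>The map stretches diameters by at most \<open>B\<close>, so a cover at scale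
    \<open>\<delta> / B\<close> becomes one at scale \<open>\<delta>\<close>.\<close>
  have "ennreal (1 / B ^ d) * hausdorff_pre d \<delta> (f ` S) \<le> hausdorff_pre d (\<delta> / B) S"
    unfolding hausdorff_pre_def[of d "\<delta> / B"]
  proof (rule INF_greatest)
    fix C assume C: "C \<in> hausdorff_covers (\<delta> / B) S"
    \<comment> \<open>The Lipschitz bound holds on \<open>S\<close> alone, so each covering set is
      cut down to \<open>S\<close> before it is mapped.\<close>
    have CS: "bounded (C i \<inter> S)" "diameter (C i \<inter> S) \<le> \<delta> / B"
      "hausdorff_gauge d (C i \<inter> S) \<le> hausdorff_gauge d (C i)" for i
    proof -
      have b: "bounded (C i)" and dm: "diameter (C i) \<le> \<delta> / B"
        using C by (auto simp: hausdorff_covers_def)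
      show bb: "bounded (C i \<inter> S)" using b by (rule bounded_subset) auto
      have le: "diameter (C i \<inter> S) \<le> diameter (C i)"
        by (rule diameter_subset[OF _ b]) auto
      then show "diameter (C i \<inter> S) \<le> \<delta> / B" using dm by simp
      show "hausdorff_gauge d (C i \<inter> S) \<le> hausdorff_gauge d (C i)"
        using le diameter_ge_0[OF bb]
        by (auto simp: hausdorff_gauge_def intro!: ennreal_leI mult_left_mono power_mono)
    qed
    have img: "bounded (f ` (C i \<inter> S))" "diameter (f ` (C i \<inter> S)) \<le> B * diameter (C i \<inter> S)"
      "hausdorff_gauge d (f ` (C i \<inter> S)) \<le> ennreal (B ^ d) * hausdorff_gauge d (C i \<inter> S)" for i
      by (rule hausdorff_gauge_lipschitz_image[OF B _ CS(1)]; use lip in simp)+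
    have "diameter (f ` (C i \<inter> S)) \<le> \<delta>" for i
      using order_trans[OF img(2)[of i] mult_left_mono[OF CS(2)[of i], of B]] B by simp
    then have "(\<lambda>i. f ` (C i \<inter> S)) \<in> hausdorff_covers \<delta> (f ` S)"
      using C img(1) unfolding hausdorff_covers_def by blast
    then have "hausdorff_pre d \<delta> (f ` S) \<le> (\<Sum>i. hausdorff_gauge d (f ` (C i \<inter> S)))"
      by (rule hausdorff_pre_le_cover)
    also have "\<dots> \<le> (\<Sum>i. ennreal (B ^ d) * hausdorff_gauge d (C i))"
      by (intro suminf_le order_trans[OF img(3)] mult_left_mono CS(3)) auto
    finally have "ennreal (1 / B ^ d) * hausdorff_pre d \<delta> (f ` S)
        \<le> ennreal (1 / B ^ d) * (ennreal (B ^ d) * (\<Sum>i. hausdorff_gauge d (C i)))"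
      by (intro mult_left_mono) auto
    then show "ennreal (1 / B ^ d) * hausdorff_pre d \<delta> (f ` S) \<le> (\<Sum>i. hausdorff_gauge d (C i))"
      using inv by (simp add: mult.left_commute)
  qed
  also have "\<dots> \<le> hausdorff_outer d S"
    by (rule hausdorff_pre_le_outer[OF \<delta>])
  finally have "ennreal (B ^ d) * (ennreal (1 / B ^ d) * hausdorff_pre d \<delta> (f ` S))
      \<le> ennreal (B ^ d) * hausdorff_outer d S"
    by (rule mult_left_mono) simp
  then show "hausdorff_pre d \<delta> (f ` S) \<le> ennreal (B ^ d) * hausdorff_outer d S"
    by (simp add: inv)
qed

lemma hausdorff_outer_isometry_image:
  fixes f :: "'a::metric_space \<Rightarrow> 'b::metric_space"
  assumes iso: "\<And>x y. x \<in> S \<Longrightarrow> y \<in> S \<Longrightarrow> dist (f x) (f y) = dist x y"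
  shows "hausdorff_outer d (f ` S) = hausdorff_outer d S"
proof (rule antisym)
  show "hausdorff_outer d (f ` S) \<le> hausdorff_outer d S"
    using hausdorff_outer_lipschitz_image[of 1 S f d] iso by simp
  have inj: "inj_on f S"
    by (rule inj_onI) (metis iso dist_eq_0_iff)
  have "hausdorff_outer d (inv_into S f ` f ` S) \<le> hausdorff_outer d (f ` S)"
    using hausdorff_outer_lipschitz_image[of 1 "f ` S" "inv_into S f" d] iso inj by fastforce
  also have "inv_into S f ` f ` S = S"
    using inj by simp
  finally show "hausdorff_outer d S \<le> hausdorff_outer d (f ` S)" .
qed

text \<open>Covers are sequences by definition. The finite family is enumerated and padded with
  empty sets, whose gauge and diameter are 0; the padding is admissible because
  \<open>0 \<le> \<delta>\<close>.\<close>

lemma hausdorff_pre_le_finite_cover: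
  assumes "finite I" and S: "S \<subseteq> (\<Union>i\<in>I. C i)"
    and C: "\<And>i. i \<in> I \<Longrightarrow> bounded (C i)" "\<And>i. i \<in> I \<Longrightarrow> diameter (C i) \<le> \<delta>" and "0 \<le> \<delta>"
  shows "hausdorff_pre d \<delta> S \<le> (\<Sum>i\<in>I. hausdorff_gauge d (C i))"
proof -
  obtain e where e: "bij_betw e {0..<card I} I"
    using ex_bij_betw_nat_finite[OF \<open>finite I\<close>] by blast
  define D where "D = (\<lambda>m. if m < card I then C (e m) else {})"
  have eI: "e m \<in> I" if "m < card I" for m
    using e that by (auto simp: bij_betw_def)
  have "x \<in> (\<Union>m. D m)" if x: "x \<in> S" for x
  proof -
    obtain i where "i \<in> I" "x \<in> C i" using subsetD[OF S x] by blast
    then obtain m where "m < card I" "i = e m"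
      using bij_betw_imp_surj_on[OF e] by (metis atLeastLessThan_iff imageE)
    then have "x \<in> D m" using \<open>x \<in> C i\<close> by (simp add: D_def)
    then show ?thesis by blast
  qed
  then have "D \<in> hausdorff_covers \<delta> S"
    using C eI \<open>0 \<le> \<delta>\<close> by (auto simp: hausdorff_covers_def D_def)
  then have "hausdorff_pre d \<delta> S \<le> (\<Sum>m. hausdorff_gauge d (D m))"
    by (rule hausdorff_pre_le_cover)
  also have "\<dots> = (\<Sum>m\<in>{0..<card I}. hausdorff_gauge d (D m))"
    by (rule suminf_finite) (auto simp: D_def)
  also have "\<dots> = (\<Sum>m\<in>{0..<card I}. hausdorff_gauge d (C (e m)))"
    by (rule sum.cong) (auto simp: D_def)
  also have "\<dots> = (\<Sum>i\<in>I. hausdorff_gauge d (C i))"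
    by (rule sum.reindex_bij_betw[OF e])
  finally show ?thesis .
qed

section \<open>Hyperplanes, orthogonal projection, and coordinate hyperplanes\<close>

definition hyp :: "'a::euclidean_space \<Rightarrow> 'a set" where
  "hyp u = {x. u \<bullet> x = 0}"

definition proj :: "'a::euclidean_space \<Rightarrow> 'a \<Rightarrow> 'a" where
  "proj u x = x - (u \<bullet> x) *\<^sub>R u"

lemma hyp_closed: "closed (hyp u)"
  unfolding hyp_def by (rule closed_hyperplane)

lemma hyp_borel [measurable]: "hyp u \<in> sets borel"
  by (rule borel_closed[OF hyp_closed])

lemma proj_measurable [measurable]: "proj u \<in> borel_measurable borel"
  unfolding proj_def by measurable

lemma proj_in_hyp: "norm u = 1 \<Longrightarrow> proj u x \<in> hyp u"
  by (simp add: proj_def hyp_def inner_diff_right dot_square_norm)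

lemma proj_hyp: "x \<in> hyp u \<Longrightarrow> proj u x = x"
  by (simp add: proj_def hyp_def)

lemma proj_add_scale: "norm u = 1 \<Longrightarrow> proj u (x + s *\<^sub>R u) = proj u x"
  by (simp add: proj_def inner_add_right dot_square_norm algebra_simps)

lemma proj_diff: "proj u (x - y) = proj u x - proj u y"
  by (simp add: proj_def inner_diff_right algebra_simps)

lemma norm_proj: 
  assumes "norm u = 1" shows "(norm (proj u x))\<^sup>2 = (norm x)\<^sup>2 - (u \<bullet> x)\<^sup>2"
proof -
  have "u \<bullet> u = 1" using assms by (simp add: dot_square_norm)
  then show ?thesis
    unfolding power2_norm_eq_inner proj_def
    by (simp add: inner_diff_left inner_diff_right inner_commute power2_eq_square)
qed

lemma norm_proj_le: "norm u = 1 \<Longrightarrow> norm (proj u x) \<le> norm x"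
  by (rule power2_le_imp_le) (auto simp: norm_proj)

text \<open>A grid of \<open>k ^ (n - 1)\<close> cubes of side \<open>2 * R / k\<close> covers the
  disc. The number of cubes cancels the power of the side length, so the total gauge is the same for
  all \<open>k\<close>, which bounds the premeasures uniformly in \<open>\<delta>\<close>. Diameters
  are estimated through the sum of the coordinates, hence the factor \<open>DIM('a)\<close>.\<close>

lemma hausdorff_outer_hyp_ball_Basis:
  fixes i :: "'a::euclidean_space"
  assumes i: "i \<in> Basis" and R: "0 < R"
  shows "hausdorff_outer (DIM('a) - 1) (hyp i \<inter> cball 0 R) < \<infinity>"
proof -
  let ?d = "DIM('a) - 1"
  define M where "M = unit_ball_vol (real ?d) * (real DIM('a) * R) ^ ?d"
  have "hausdorff_pre ?d \<delta> (hyp i \<inter> cball 0 R) \<le> ennreal M" if \<delta>: "0 < \<delta>" for \<delta>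
  proof -
    obtain k :: nat where k: "real DIM('a) * (2 * R) / \<delta> < real k"
      using reals_Archimedean2 by blast
    have kpos: "0 < real k"
      using k R \<delta> by (smt (verit) divide_nonneg_pos mult_nonneg_nonneg of_nat_0_le_iff)
    define h where "h = 2 * R / real k"
    have h: "0 < h" using R kpos by (simp add: h_def)
    have nh: "real DIM('a) * h \<le> \<delta>"
      using k kpos \<delta> by (simp add: h_def field_simps)
    define I where "I = PiE (Basis - {i}) (\<lambda>_. {..<k})"
    have I: "finite I" "card I = k ^ ?d"
      using i by (simp_all add: I_def finite_PiE card_PiE card_Diff_singleton)
    define C where "C = (\<lambda>g::'a \<Rightarrow> nat. {x. x \<bullet> i = 0 \<and>
        (\<forall>j\<in>Basis - {i}. real (g j) * h - R \<le> x \<bullet> j \<and> x \<bullet> j \<le> real (g j) * h + h - R)})"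
    have distC: "dist x y \<le> real DIM('a) * h" if "x \<in> C g" "y \<in> C g" for x y g
    proof -
      have "\<bar>(x - y) \<bullet> j\<bar> \<le> h" if "j \<in> Basis" for j
      proof (cases "j = i")
        case True then show ?thesis
          using \<open>x \<in> C g\<close> \<open>y \<in> C g\<close> h by (simp add: C_def inner_diff_left)
      next
        case False
        then have "real (g j) * h - R \<le> x \<bullet> j" "x \<bullet> j \<le> real (g j) * h + h - R"
          "real (g j) * h - R \<le> y \<bullet> j" "y \<bullet> j \<le> real (g j) * h + h - R"
          using \<open>x \<in> C g\<close> \<open>y \<in> C g\<close> \<open>j \<in> Basis\<close> by (auto simp: C_def)
        then show ?thesis unfolding inner_diff_left by linarith
      qed
      then have "(\<Sum>j\<in>Basis. \<bar>(x - y) \<bullet> j\<bar>) \<le> (\<Sum>j\<in>(Basis::'a set). h)"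
        by (rule sum_mono)
      then show ?thesis
        using norm_le_l1[of "x - y"] by (simp add: dist_norm)
    qed
    have bC: "bounded (C g)" for g
      using distC by (meson bounded_two_points)
    have dC: "diameter (C g) \<le> real DIM('a) * h" for g
      using distC h by (intro diameter_le) (auto simp: dist_norm)
    have cover: "hyp i \<inter> cball 0 R \<subseteq> (\<Union>g\<in>I. C g)"
    proof
      fix x assume x: "x \<in> hyp i \<inter> cball 0 R"
      have xj: "\<bar>x \<bullet> j\<bar> \<le> R" if "j \<in> Basis" for j
        using x Basis_le_norm[OF that, of x] by simp
      have "\<exists>m<k. real m * h - R \<le> x \<bullet> j \<and> x \<bullet> j \<le> real m * h + h - R" if "j \<in> Basis" for j
      \<comment> \<open>On the far face the floor would give the index \<open>k\<close>, one too
        many; such a coordinate is put into the last closed cell.\<close>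
      proof (cases "x \<bullet> j = R")
        case True
        have "real (k - 1) * h + h = 2 * R"
          using kpos by (simp add: h_def of_nat_diff field_simps)
        then show ?thesis
          using True kpos h by (intro exI[of _ "k - 1"]) auto
      next
        case False
        then have lt: "x \<bullet> j < R" and ge: "- R \<le> x \<bullet> j" using xj[OF that] by auto
        define m where "m = nat \<lfloor>(x \<bullet> j + R) / h\<rfloor>"
        have fl: "real m = of_int \<lfloor>(x \<bullet> j + R) / h\<rfloor>"
          using ge h by (simp add: m_def)
        have 1: "real m * h \<le> x \<bullet> j + R"
          using h by (simp add: fl) (metis floor_divide_lower mult.commute)
        have 2: "x \<bullet> j + R \<le> real m * h + h"
          using h floor_divide_upper[OF h, of "x \<bullet> j + R"] by (simp add: fl algebra_simps)
        have "real m * h < real k * h"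
          using 1 lt kpos by (simp add: h_def)
        then have "m < k" using h by simp
        then show ?thesis using 1 2 by (intro exI[of _ m]) auto
      qed
      then obtain m where m: "\<And>j. j \<in> Basis \<Longrightarrow> m j < k \<and> real (m j) * h - R \<le> x \<bullet> j \<and> x \<bullet> j \<le> real (m j) * h + h - R"
        by metis
      have "restrict m (Basis - {i}) \<in> I"
        using m by (auto simp: I_def)
      moreover have "x \<in> C (restrict m (Basis - {i}))"
        using m x by (auto simp: C_def hyp_def inner_commute)
      ultimately show "x \<in> (\<Union>g\<in>I. C g)" by blast
    qed
    have gC: "hausdorff_gauge ?d (C g) \<le> ennreal (unit_ball_vol (real ?d) * (real DIM('a) * h / 2) ^ ?d)" for g
      using dC[of g] diameter_ge_0[OF bC[of g]]
      by (auto simp: hausdorff_gauge_def intro!: ennreal_leI mult_left_mono power_mono)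
    have "hausdorff_pre ?d \<delta> (hyp i \<inter> cball 0 R) \<le> (\<Sum>g\<in>I. hausdorff_gauge ?d (C g))"
      using order_trans[OF dC nh] bC \<delta> by (intro hausdorff_pre_le_finite_cover I cover) auto
    also have "\<dots> \<le> (\<Sum>g\<in>I. ennreal (unit_ball_vol (real ?d) * (real DIM('a) * h / 2) ^ ?d))"
      by (intro sum_mono gC)
    also have "\<dots> = ennreal (real k ^ ?d * (unit_ball_vol (real ?d) * (real DIM('a) * h / 2) ^ ?d))"
      using h I by (simp add: ennreal_of_nat_eq_real_of_nat[symmetric] ennreal_mult ennreal_power[symmetric])
    also have "real k ^ ?d * (unit_ball_vol (real ?d) * (real DIM('a) * h / 2) ^ ?d) = M"
    proof -
      have "real k ^ ?d * (real DIM('a) * h / 2) ^ ?d = (real k * (real DIM('a) * h / 2)) ^ ?d"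
        by (simp only: power_mult_distrib)
      also have "real k * (real DIM('a) * h / 2) = real DIM('a) * R"
        using kpos by (simp add: h_def)
      finally show ?thesis by (simp add: M_def mult.left_commute)
    qed
    finally show ?thesis .
  qed
  then have "hausdorff_outer ?d (hyp i \<inter> cball 0 R) \<le> ennreal M"
    unfolding hausdorff_outer_def by (intro SUP_least) auto
  then show ?thesis
    using le_less_trans by fastforce
qed

text \<open>This excludes the value 0 for the constant relating the two measures. A covering set of
  diameter \<open>D\<close> lies in a cube of side \<open>2 * D\<close> around one of its points;
  the box over it has thickness 1 in direction \<open>i\<close>. Comparing
  \<open>(2 * D) ^ d\<close> with the gauge \<open>V * (D / 2) ^ d\<close>, where \<open>V\<close>
  is the volume of the unit ball, gives the factor \<open>4 ^ d / V\<close>.\<close>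

lemma emeasure_shadow_le_Basis:
  fixes i :: "'a::euclidean_space"
  assumes i: "i \<in> Basis"
  shows "emeasure lborel (slab i \<inter> proj i -` T)
    \<le> ennreal (4 ^ (DIM('a) - 1) / unit_ball_vol (real (DIM('a) - 1))) * hausdorff_outer (DIM('a) - 1) T"
proof -
  let ?d = "DIM('a) - 1"
  define K where "K = 4 ^ ?d / unit_ball_vol (real ?d)"
  have K: "0 < K" unfolding K_def by (intro divide_pos_pos unit_ball_vol_pos) auto
  have inv: "ennreal K * (ennreal (1 / K) * x) = x" for x
    using K by (simp add: mult.assoc[symmetric] ennreal_mult[symmetric])
  have "ennreal (1 / K) * emeasure lborel (slab i \<inter> proj i -` T) \<le> hausdorff_pre ?d 1 T"
    unfolding hausdorff_pre_def
  proof (rule INF_greatest)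
    fix C assume C: "C \<in> hausdorff_covers 1 T"
    define D where "D = (\<lambda>k. diameter (C k))"
    define p where "p = (\<lambda>k. SOME x. x \<in> C k)"
    have D0: "0 \<le> D k" for k
      using C by (auto simp: D_def hausdorff_covers_def intro!: diameter_ge_0)
    \<comment> \<open>An empty \<open>C k\<close> contains no centre \<open>p k\<close> and has
      gauge 0, so its box has to be empty as well.\<close>
    define box where "box = (\<lambda>k. if C k = {} then {} else
      cbox (\<Sum>j\<in>Basis. (if j = i then -1/2 else p k \<bullet> j - D k) *\<^sub>R j)
           (\<Sum>j\<in>Basis. (if j = i then 1/2 else p k \<bullet> j + D k) *\<^sub>R j))"
    have box_le: "emeasure lborel (box k) \<le> ennreal K * hausdorff_gauge ?d (C k)" for k
    proof (cases "C k = {}")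
      case False
      have "emeasure lborel (box k) = ennreal (\<Prod>j\<in>Basis. if j = i then 1 else 2 * D k)"
        using False D0[of k] unfolding box_def if_not_P[OF False]
        by (subst emeasure_lborel_cbox)
           (auto simp: inner_diff_left intro!: arg_cong[where f=ennreal] prod.cong split: if_splits)
      also have "(\<Prod>j\<in>Basis. if j = i then 1 else 2 * D k) = (2 * D k) ^ ?d"
        using i by (subst prod.remove[of _ i]) (auto simp: card_Diff_singleton)
      also have "\<dots> = (4 * (D k / 2)) ^ ?d"
        by simp
      also have "\<dots> = K * (unit_ball_vol (real ?d) * (D k / 2) ^ ?d)"
      proof -
        have "4 ^ ?d * x = 4 ^ ?d / V * (V * x)" if "0 < V" for x V :: real
          using that by simp
        from this[OF unit_ball_vol_pos[of "real ?d"]] show ?thesis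
          unfolding power_mult_distrib K_def by simp
      qed
      finally show ?thesis
        using False K D0[of k] unfolding hausdorff_gauge_def
        by (simp add: D_def ennreal_mult)
    qed (simp add: box_def)
    have "slab i \<inter> proj i -` T \<subseteq> (\<Union>k. box k)"
    proof
      fix x assume x: "x \<in> slab i \<inter> proj i -` T"
      then obtain k where k: "proj i x \<in> C k"
        using C by (auto simp: hausdorff_covers_def)
      have pk: "p k \<in> C k" unfolding p_def by (rule someI[of _ "proj i x"]) (rule k)
      have b: "bounded (C k)" using C by (auto simp: hausdorff_covers_def)
      have xj: "\<bar>x \<bullet> j - p k \<bullet> j\<bar> \<le> D k" if "j \<in> Basis" "j \<noteq> i" for j
      proof -
        have "\<bar>(proj i x - p k) \<bullet> j\<bar> \<le> D k"
          using Basis_le_norm[OF that(1), of "proj i x - p k"] diameter_bounded_bound[OF b k pk]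
          by (simp add: D_def dist_norm)
        moreover have "proj i x \<bullet> j = x \<bullet> j"
          using that i by (simp add: proj_def inner_diff_left inner_Basis)
        ultimately show ?thesis by (simp add: inner_diff_left)
      qed
      have "\<bar>x \<bullet> i\<bar> < 1/2" using x by (simp add: slab_def inner_commute)
      then have "(if j = i then -1/2 else p k \<bullet> j - D k) \<le> x \<bullet> j \<and>
          x \<bullet> j \<le> (if j = i then 1/2 else p k \<bullet> j + D k)" if "j \<in> Basis" for j
        using xj[OF that] by (cases "j = i") auto
      then have "x \<in> box k"
        using k by (auto simp: box_def mem_box simp del: if_split)
      then show "x \<in> (\<Union>k. box k)" by blast
    qed
    moreover have bm: "range box \<subseteq> sets lborel"
      by (auto simp: box_def)
    ultimately have "emeasure lborel (slab i \<inter> proj i -` T) \<le> emeasure lborel (\<Union>k. box k)"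
      by (intro emeasure_mono) auto
    also have "\<dots> \<le> (\<Sum>k. emeasure lborel (box k))"
      by (rule emeasure_subadditive_countably[OF bm])
    also have "\<dots> \<le> (\<Sum>k. ennreal K * hausdorff_gauge ?d (C k))"
      by (intro suminf_le box_le) auto
    finally have "ennreal (1 / K) * emeasure lborel (slab i \<inter> proj i -` T)
        \<le> ennreal (1 / K) * (ennreal K * (\<Sum>k. hausdorff_gauge ?d (C k)))"
      by (intro mult_left_mono) auto
    also have "\<dots> = (\<Sum>k. hausdorff_gauge ?d (C k))"
      using inv by (metis mult.left_commute)
    finally show "ennreal (1 / K) * emeasure lborel (slab i \<inter> proj i -` T) \<le> (\<Sum>k. hausdorff_gauge ?d (C k))" .
  qed
  also have "\<dots> \<le> hausdorff_outer ?d T"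
    by (rule hausdorff_pre_le_outer) simp
  finally have "ennreal K * (ennreal (1 / K) * emeasure lborel (slab i \<inter> proj i -` T))
      \<le> ennreal K * hausdorff_outer ?d T"
    by (rule mult_left_mono) simp
  then show ?thesis unfolding inv unfolding K_def .
qed

section \<open>Hausdorff measure on hyperplanes\<close>

text \<open>Written as a density so that the Borel sets of the whole space remain its measurable
  sets.\<close>

abbreviation hyp_hausdorff :: "'a::euclidean_space \<Rightarrow> 'a measure" where
  "hyp_hausdorff u \<equiv> density (hausdorff_measure (DIM('a) - 1)) (indicator (hyp u))"

lemma emeasure_hyp_hausdorff:
  fixes u :: "'a::euclidean_space"
  assumes [measurable]: "A \<in> sets borel"
  shows "emeasure (hyp_hausdorff u) A = hausdorff_outer (DIM('a) - 1) (A \<inter> hyp u)"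
proof -
  have "emeasure (hyp_hausdorff u) A = (\<integral>\<^sup>+x. indicator (hyp u) x * indicator A x \<partial>hausdorff_measure (DIM('a) - 1))"
    by (rule emeasure_density) simp_all
  also have "\<dots> = (\<integral>\<^sup>+x. indicator (A \<inter> hyp u) x \<partial>hausdorff_measure (DIM('a) - 1))"
    by (intro nn_integral_cong) (auto simp: indicator_def)
  also have "\<dots> = hausdorff_outer (DIM('a) - 1) (A \<inter> hyp u)"
    by (simp add: emeasure_hausdorff_measure)
  finally show ?thesis .
qed

lemma orthogonal_transformation_dist:
  assumes "orthogonal_transformation f"
  shows "dist (f x) (f y) = dist x y"
  using orthogonal_transformation_norm[OF assms, of "x - y"]
  by (simp add: dist_norm linear_diff[OF orthogonal_transformation_linear[OF assms]])

lemma hausdorff_outer_hyp_ball: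
  fixes u :: "real^'n"
  assumes u: "norm u = 1" and R: "0 < R"
  shows "hausdorff_outer (DIM(real^'n) - 1) (hyp u \<inter> cball 0 R) < \<infinity>"
proof -
  obtain i :: "real^'n" where i: "i \<in> Basis" using nonempty_Basis by blast
  then obtain f where f: "orthogonal_transformation f" "f i = u"
    using orthogonal_transformation_exists_1[of i u] u by auto
  have "hyp u \<inter> cball 0 R \<subseteq> f ` (hyp i \<inter> cball 0 R)"
  proof
    fix y assume y: "y \<in> hyp u \<inter> cball 0 R"
    obtain x where x: "y = f x"
      using orthogonal_transformation_surj[OF f(1)] by (metis surjD)
    have "i \<bullet> x = u \<bullet> y" using f x by (auto simp: orthogonal_transformation_def)
    moreover have "norm y = norm x" using f x by (simp add: orthogonal_transformation_norm)
    ultimately show "y \<in> f ` (hyp i \<inter> cball 0 R)" using x y by (auto simp: hyp_def)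
  qed
  then have "hausdorff_outer (DIM(real^'n) - 1) (hyp u \<inter> cball 0 R)
      \<le> hausdorff_outer (DIM(real^'n) - 1) (f ` (hyp i \<inter> cball 0 R))"
    by (rule hausdorff_outer_mono)
  also have "\<dots> = hausdorff_outer (DIM(real^'n) - 1) (hyp i \<inter> cball 0 R)"
    by (rule hausdorff_outer_isometry_image) (rule orthogonal_transformation_dist[OF f(1)])
  also have "\<dots> < \<infinity>" by (rule hausdorff_outer_hyp_ball_Basis[OF i R])
  finally show ?thesis .
qed

lemma sigma_finite_measure_if_finite_on_balls:
  fixes M :: "'a::euclidean_space measure"
  assumes M: "sets M = sets borel" and fin: "\<And>R. 0 < R \<Longrightarrow> emeasure M (cball 0 R) < \<infinity>"
  shows "sigma_finite_measure M"
proof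
  let ?A = "range (\<lambda>k. cball (0::'a) (real (Suc k)))"
  have "x \<in> \<Union>?A" for x :: 'a
  proof -
    obtain k where "norm x < real k" using reals_Archimedean2 by blast
    then have "x \<in> cball 0 (real (Suc k))" by simp
    then show ?thesis by blast
  qed
  then have "\<Union>?A = space M" using sets_eq_imp_space_eq[OF M] by auto
  moreover have "\<forall>a\<in>?A. emeasure M a \<noteq> \<infinity>"
    using fin by (auto simp: less_top)
  moreover have "?A \<subseteq> sets M" by (auto simp: M)
  ultimately show "\<exists>A. countable A \<and> A \<subseteq> sets M \<and> \<Union>A = space M \<and> (\<forall>a\<in>A. emeasure M a \<noteq> \<infinity>)"
    by (intro exI[of _ ?A]) (auto intro!: countable_image)
qed

lemma sigma_finite_hyp_hausdorff:
  fixes u :: "real^'n"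
  assumes u: "norm u = 1"
  shows "sigma_finite_measure (hyp_hausdorff u)"
proof (rule sigma_finite_measure_if_finite_on_balls)
  fix R :: real assume "0 < R"
  then show "emeasure (hyp_hausdorff u) (cball 0 R) < \<infinity>"
    using hausdorff_outer_hyp_ball[OF u] by (subst emeasure_hyp_hausdorff) (auto simp: Int_commute)
qed simp

lemma distr_hyp_hausdorff:
  fixes u v :: "'a::euclidean_space"
  assumes iso: "\<And>x y. dist (f x) (f y) = dist x y" and surj: "surj f"
    and hyp: "\<And>x. f x \<in> hyp v \<longleftrightarrow> x \<in> hyp u"
  shows "distr (hyp_hausdorff u) borel f = hyp_hausdorff v"
proof (rule measure_eqI)
  fix A assume "A \<in> sets (distr (hyp_hausdorff u) borel f)"
  then have A[measurable]: "A \<in> sets borel" by simp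
  have "continuous_on UNIV f"
    unfolding continuous_on_iff iso by blast
  then have f[measurable]: "f \<in> borel_measurable borel"
    by (rule borel_measurable_continuous_onI)
  have "f -` A \<in> sets borel" using measurable_sets[OF f A] by simp
  have "emeasure (distr (hyp_hausdorff u) borel f) A = emeasure (hyp_hausdorff u) (f -` A)"
    by (subst emeasure_distr) auto
  also have "\<dots> = hausdorff_outer (DIM('a) - 1) (f -` A \<inter> hyp u)"
    by (rule emeasure_hyp_hausdorff) fact
  also have "\<dots> = hausdorff_outer (DIM('a) - 1) (f ` (f -` A \<inter> hyp u))"
    by (rule hausdorff_outer_isometry_image[symmetric]) (rule iso)
  also have "f ` (f -` A \<inter> hyp u) = A \<inter> hyp v"
    using surj hyp by (force simp: surj_def)
  also have "hausdorff_outer (DIM('a) - 1) (A \<inter> hyp v) = emeasure (hyp_hausdorff v) A"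
    by (rule emeasure_hyp_hausdorff[symmetric]) fact
  finally show "emeasure (distr (hyp_hausdorff u) borel f) A = emeasure (hyp_hausdorff v) A" .
qed simp

text \<open>The product of Hausdorff measure on the hyperplane with length along \<open>u\<close>,
  transported to the whole space. It is translation invariant, hence a multiple of Lebesgue measure;
  this is how the two measures on hyperplanes become comparable.\<close>

definition hyp_product :: "real^'n \<Rightarrow> (real^'n) measure" where
  "hyp_product u = distr (hyp_hausdorff u \<Otimes>\<^sub>M lborel) borel (\<lambda>(y, s). y + s *\<^sub>R u)"

lemma sets_hyp_product [simp, measurable_cong]: "sets (hyp_product u) = sets borel"
  by (simp add: hyp_product_def)

text \<open>The common form of the two symmetries used: rotations taking \<open>u\<close> to
  \<open>v\<close>, with \<open>a = 0\<close>, and translations, which split into a translation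
  \<open>f\<close> inside the hyperplane and a shift by \<open>a\<close> along its normal.\<close>

lemma distr_hyp_product:
  fixes u v :: "real^'n"
  assumes u: "norm u = 1" and v: "norm v = 1"
    and f: "\<And>x y. dist (f x) (f y) = dist x y" "surj f" "\<And>x. f x \<in> hyp v \<longleftrightarrow> x \<in> hyp u"
    and g: "\<And>y s. g (y + s *\<^sub>R u) = f y + (a + s) *\<^sub>R v" and [measurable]: "g \<in> borel_measurable borel"
  shows "distr (hyp_product u) borel g = hyp_product v"
proof -
  have "continuous_on UNIV f"
    unfolding continuous_on_iff f(1) by blast
  then have [measurable]: "f \<in> borel_measurable borel"
    by (rule borel_measurable_continuous_onI)
  interpret v: sigma_finite_measure "hyp_hausdorff v" by (rule sigma_finite_hyp_hausdorff[OF v])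
  have "hyp_product v = distr (distr (hyp_hausdorff u) borel f \<Otimes>\<^sub>M distr lborel borel ((+) a)) borel (\<lambda>(y, s). y + s *\<^sub>R v)"
    unfolding hyp_product_def distr_hyp_hausdorff[OF f] lborel_distr_plus ..
  also have "distr (hyp_hausdorff u) borel f \<Otimes>\<^sub>M distr lborel borel ((+) a)
      = distr (hyp_hausdorff u \<Otimes>\<^sub>M lborel) (borel \<Otimes>\<^sub>M borel) (\<lambda>(y, s). (f y, a + s))"
    by (rule pair_measure_distr) (auto simp: lborel_distr_plus sigma_finite_lborel)
  also have "distr \<dots> borel (\<lambda>(y, s). y + s *\<^sub>R v)
      = distr (hyp_hausdorff u \<Otimes>\<^sub>M lborel) borel (\<lambda>(y, s). f y + (a + s) *\<^sub>R v)"
    by (subst distr_distr) (auto simp: comp_def split_beta intro!: distr_cong)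
  also have "\<dots> = distr (hyp_product u) borel g"
    unfolding hyp_product_def
    by (subst distr_distr) (auto simp: comp_def split_beta g intro!: distr_cong)
  finally show ?thesis ..
qed

lemma hyp_product_orthogonal:
  fixes u v :: "real^'n"
  assumes u: "norm u = 1" and f: "orthogonal_transformation f" "f u = v"
  shows "distr (hyp_product u) borel f = hyp_product v"
proof (rule distr_hyp_product[of _ _ f f 0])
  have lin: "linear f" by (rule orthogonal_transformation_linear[OF f(1)])
  show "norm u = 1" by fact
  show "norm v = 1" using f u orthogonal_transformation_norm by metis
  show "dist (f x) (f y) = dist x y" for x y
    by (rule orthogonal_transformation_dist[OF f(1)])
  show "surj f" using f by (intro orthogonal_transformation_surj)
  show "f x \<in> hyp v \<longleftrightarrow> x \<in> hyp u" for x
    using f by (auto simp: hyp_def orthogonal_transformation_def)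
  show "f (y + s *\<^sub>R u) = f y + (0 + s) *\<^sub>R v" for y s
    using f lin by (simp add: linear_add linear_scale)
  show "f \<in> borel_measurable borel"
    using lin by (intro borel_measurable_continuous_onI linear_continuous_on linear_conv_bounded_linear[THEN iffD1])
qed

lemma hyp_product_translation:
  fixes u z :: "real^'n"
  assumes u: "norm u = 1"
  shows "distr (hyp_product u) borel ((+) z) = hyp_product u"
proof (rule distr_hyp_product[of _ _ "(+) (proj u z)" _ "u \<bullet> z"])
  show "surj ((+) (proj u z))" by simp
  show "proj u z + x \<in> hyp u \<longleftrightarrow> x \<in> hyp u" for x
    using proj_in_hyp[OF u, of z] by (simp add: hyp_def inner_add_right)
  show "z + (y + s *\<^sub>R u) = proj u z + y + (u \<bullet> z + s) *\<^sub>R u" for y s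
    by (simp add: proj_def algebra_simps)
qed (use u in auto)

text \<open>The ball lies in the cylinder over the disc of radius \<open>R\<close> with height
  \<open>2 * R\<close>. Finiteness on balls gives the sigma-finiteness on which the uniqueness of
  invariant measures rests.\<close>

lemma hyp_product_cball_finite:
  fixes u :: "real^'n"
  assumes u: "norm u = 1" and R: "0 < R"
  shows "emeasure (hyp_product u) (cball 0 R) < \<infinity>"
proof -
  interpret u: sigma_finite_measure "hyp_hausdorff u" by (rule sigma_finite_hyp_hausdorff[OF u])
  have [measurable]: "cball (0::real^'n) R \<in> sets borel" by simp
  have "emeasure (hyp_product u) (cball 0 R) = (\<integral>\<^sup>+x. indicator (cball 0 R) x \<partial>hyp_product u)"
    by (subst nn_integral_indicator) auto
  also have "\<dots> = (\<integral>\<^sup>+p. indicator (cball 0 R) (fst p + snd p *\<^sub>R u) \<partial>(hyp_hausdorff u \<Otimes>\<^sub>M lborel))"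
    unfolding hyp_product_def by (subst nn_integral_distr) (auto simp: split_beta)
  also have "\<dots> = (\<integral>\<^sup>+y. \<integral>\<^sup>+s. indicator (cball 0 R) (y + s *\<^sub>R u) \<partial>lborel \<partial>hyp_hausdorff u)"
    by (subst lborel.nn_integral_fst[symmetric]) auto
  also have "\<dots> = (\<integral>\<^sup>+y. indicator (hyp u) y * (\<integral>\<^sup>+s. indicator (cball 0 R) (y + s *\<^sub>R u) \<partial>lborel) \<partial>hausdorff_measure (DIM(real^'n) - 1))"
    by (subst nn_integral_density) auto
  also have "\<dots> \<le> (\<integral>\<^sup>+y. indicator (hyp u) y * (\<integral>\<^sup>+s. indicator (cball 0 R) y * indicator {-R..R} s \<partial>lborel) \<partial>hausdorff_measure (DIM(real^'n) - 1))"
  proof (intro nn_integral_mono)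
    fix y :: "real^'n"
    have "indicator (cball 0 R) (y + s *\<^sub>R u) \<le> (indicator (cball 0 R) y * indicator {-R..R} s :: ennreal)"
      if "y \<in> hyp u" for s
    proof -
      have "y + s *\<^sub>R u \<in> cball 0 R \<Longrightarrow> y \<in> cball 0 R \<and> \<bar>s\<bar> \<le> R"
      proof -
        assume le: "y + s *\<^sub>R u \<in> cball 0 R"
        have "proj u (y + s *\<^sub>R u) = y" using that u by (simp add: proj_add_scale proj_hyp)
        then have "norm y \<le> norm (y + s *\<^sub>R u)" by (metis norm_proj_le u)
        moreover have "\<bar>u \<bullet> (y + s *\<^sub>R u)\<bar> \<le> norm (y + s *\<^sub>R u)"
          using Cauchy_Schwarz_ineq2[of u "y + s *\<^sub>R u"] u by simp
        moreover have "u \<bullet> (y + s *\<^sub>R u) = s"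
          using that u by (simp add: hyp_def inner_add_right dot_square_norm)
        ultimately show ?thesis using le by auto
      qed
      then show ?thesis by (auto simp: indicator_def abs_le_iff)
    qed
    then show "indicator (hyp u) y * (\<integral>\<^sup>+s. indicator (cball 0 R) (y + s *\<^sub>R u) \<partial>lborel)
       \<le> indicator (hyp u) y * (\<integral>\<^sup>+s. indicator (cball 0 R) y * indicator {-R..R} s \<partial>lborel)"
      by (cases "y \<in> hyp u") (auto intro!: nn_integral_mono)
  qed
  also have "\<dots> = (\<integral>\<^sup>+y. (indicator (hyp u \<inter> cball 0 R) y) * ennreal (2 * R) \<partial>hausdorff_measure (DIM(real^'n) - 1))"
    using R by (intro nn_integral_cong) (auto simp: nn_integral_cmult split: split_indicator)
  also have "\<dots> = hausdorff_outer (DIM(real^'n) - 1) (hyp u \<inter> cball 0 R) * ennreal (2 * R)"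
    by (subst nn_integral_multc) (auto simp: emeasure_hausdorff_measure)
  also have "\<dots> < \<infinity>"
    using hausdorff_outer_hyp_ball[OF u R] by (simp add: ennreal_mult_less_top)
  finally show ?thesis .
qed

lemma sigma_finite_hyp_product:
  fixes u :: "real^'n"
  assumes u: "norm u = 1"
  shows "sigma_finite_measure (hyp_product u)"
  by (rule sigma_finite_measure_if_finite_on_balls[OF sets_hyp_product hyp_product_cball_finite[OF u]])

lemma emeasure_hyp_product_cylinder:
  fixes u :: "real^'n"
  assumes u: "norm u = 1" and [measurable]: "T \<in> sets borel" and T: "T \<subseteq> hyp u"
  shows "emeasure (hyp_product u) (slab u \<inter> proj u -` T) = hausdorff_outer (DIM(real^'n) - 1) T"
proof -
  interpret u: sigma_finite_measure "hyp_hausdorff u" by (rule sigma_finite_hyp_hausdorff[OF u])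
  have [measurable]: "proj u -` T \<in> sets borel"
    using measurable_sets[OF proj_measurable, of T u] by simp
  let ?X = "slab u \<inter> proj u -` T"
  have X: "?X \<in> sets borel" by (intro sets.Int slab_borel) fact
  have "emeasure (hyp_product u) ?X = (\<integral>\<^sup>+x. indicator ?X x \<partial>hyp_product u)"
    using X by (subst nn_integral_indicator) auto
  also have "\<dots> = (\<integral>\<^sup>+p. indicator ?X (fst p + snd p *\<^sub>R u) \<partial>(hyp_hausdorff u \<Otimes>\<^sub>M lborel))"
    using X unfolding hyp_product_def by (subst nn_integral_distr) (auto simp: split_beta)
  also have "\<dots> = (\<integral>\<^sup>+y. \<integral>\<^sup>+s. indicator ?X (y + s *\<^sub>R u) \<partial>lborel \<partial>hyp_hausdorff u)"
    using X by (subst lborel.nn_integral_fst[symmetric]) auto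
  also have "\<dots> = (\<integral>\<^sup>+y. indicator (hyp u) y * (\<integral>\<^sup>+s. indicator ?X (y + s *\<^sub>R u) \<partial>lborel) \<partial>hausdorff_measure (DIM(real^'n) - 1))"
    using X by (subst nn_integral_density) auto
  also have "\<dots> = (\<integral>\<^sup>+y. indicator T y \<partial>hausdorff_measure (DIM(real^'n) - 1))"
  proof (rule nn_integral_cong)
    fix y :: "real^'n"
    show "indicator (hyp u) y * (\<integral>\<^sup>+s. indicator ?X (y + s *\<^sub>R u) \<partial>lborel) = indicator T y"
    proof (cases "y \<in> hyp u")
      case True
      have "indicator ?X (y + s *\<^sub>R u) = (indicator T y * indicator {-1/2<..<1/2} s :: ennreal)" for s
        using True u
        by (auto simp: indicator_def slab_def proj_add_scale proj_hyp inner_add_right dot_square_norm hyp_def abs_less_iff)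
      then have "(\<integral>\<^sup>+s. indicator ?X (y + s *\<^sub>R u) \<partial>lborel) = (\<integral>\<^sup>+s. indicator T y * indicator {-1/2<..<1/2::real} s \<partial>lborel)"
        by simp
      also have "\<dots> = indicator T y"
        by (subst nn_integral_cmult) auto
      finally show ?thesis using True by simp
    next
      case False
      then have "y \<notin> T" using T by blast
      with False show ?thesis by simp
    qed
  qed
  also have "\<dots> = hausdorff_outer (DIM(real^'n) - 1) T"
    by (simp add: emeasure_hausdorff_measure)
  finally show ?thesis .
qed

text \<open>A cylinder of unit thickness over \<open>T\<close> has \<open>hyp_product\<close>
  measure equal to the Hausdorff measure of \<open>T\<close>, and \<open>hyp_product u\<close> is a
  multiple of Lebesgue measure by translation invariance. The quantifiers put \<open>c\<close>
  before \<open>u\<close>: one constant serves all directions.\<close>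

theorem hausdorff_outer_hyp_eq_lborel:
  "\<exists>c>0. \<forall>(u :: real^'n) T. norm u = 1 \<longrightarrow> T \<in> sets borel \<longrightarrow> T \<subseteq> hyp u \<longrightarrow>
     hausdorff_outer (DIM(real^'n) - 1) T = ennreal c * emeasure lborel (slab u \<inter> proj u -` T)"
proof -
  obtain i :: "real^'n" where i: "i \<in> Basis" using nonempty_Basis by blast
  have ni: "norm i = 1" using i by simp
  define w where "w = unit_ball_vol (real DIM(real^'n))"
  have w: "emeasure lborel (cball (0::real^'n) 1) = ennreal w"
    unfolding w_def by (subst emeasure_cball) auto
  have wpos: "0 < w" unfolding w_def by (rule unit_ball_vol_pos) simp
  define b where "b = measure (hyp_product i) (cball 0 1)"
  have b: "emeasure (hyp_product i) (cball 0 1) = ennreal b"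
    unfolding b_def using hyp_product_cball_finite[OF ni, of 1]
    by (intro emeasure_eq_ennreal_measure) auto
  define c where "c = b / w"
  have eq: "hausdorff_outer (DIM(real^'n) - 1) T = ennreal c * emeasure lborel (slab u \<inter> proj u -` T)"
    if u: "norm u = 1" and T[measurable]: "T \<in> sets borel" and sub: "T \<subseteq> hyp u" for u :: "real^'n" and T
  proof -
    obtain f where f: "orthogonal_transformation f" "f i = u"
      using orthogonal_transformation_exists_1[OF ni u] by blast
    have [measurable]: "f \<in> borel_measurable borel"
      using orthogonal_transformation_linear[OF f(1)] 
      by (intro borel_measurable_continuous_onI linear_continuous_on linear_conv_bounded_linear[THEN iffD1])
    \<comment> \<open>The proportionality factor is read off on the unit ball, which rotations
      preserve; so it does not depend on \<open>u\<close>.\<close>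
    have "emeasure (hyp_product u) (cball 0 1) = emeasure (distr (hyp_product i) borel f) (cball 0 1)"
      by (simp add: hyp_product_orthogonal[OF ni f])
    also have "\<dots> = emeasure (hyp_product i) (f -` cball 0 1 \<inter> space (hyp_product i))"
      by (rule emeasure_distr) auto
    also have "f -` cball 0 1 \<inter> space (hyp_product i) = cball 0 1"
      using orthogonal_transformation_norm[OF f(1)] by (auto simp: hyp_product_def)
    finally have bu: "emeasure (hyp_product u) (cball 0 1) = ennreal b" using b by simp
    have [measurable]: "proj u -` T \<in> sets borel"
      using measurable_sets[OF proj_measurable, of T u] by simp
    have "emeasure (hyp_product u) (slab u \<inter> proj u -` T) * ennreal w = ennreal b * emeasure lborel (slab u \<inter> proj u -` T)"
      using translation_invariant_lborel[OF sigma_finite_hyp_product[OF u] sets_hyp_product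
          hyp_product_translation[OF u], of "slab u \<inter> proj u -` T"] w bu by simp
    then have eq: "hausdorff_outer (DIM(real^'n) - 1) T * ennreal w
        = ennreal b * emeasure lborel (slab u \<inter> proj u -` T)"
      unfolding emeasure_hyp_product_cylinder[OF u T sub] .
    have w1: "ennreal w * ennreal (1 / w) = 1" "ennreal c = ennreal b * ennreal (1 / w)"
      using wpos by (simp_all add: ennreal_mult[symmetric] c_def b_def)
    have "hausdorff_outer (DIM(real^'n) - 1) T
        = hausdorff_outer (DIM(real^'n) - 1) T * ennreal w * ennreal (1 / w)"
      using w1(1) by (simp only: mult.assoc mult_1_right)
    also have "\<dots> = ennreal c * emeasure lborel (slab u \<inter> proj u -` T)"
      unfolding eq w1(2) by (simp only: mult_ac)
    finally show ?thesis .
  qed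
  \<comment> \<open>Otherwise the unit disc in \<open>hyp i\<close> would be a null set, although
    the cylinder over it contains a ball of radius 1/2.\<close>
  have "c \<noteq> 0"
  proof
    assume "c = 0"
    let ?T = "hyp i \<inter> cball 0 1"
    have "hausdorff_outer (DIM(real^'n) - 1) ?T = 0"
      using eq[OF ni, of ?T] \<open>c = 0\<close> by auto
    then have "emeasure lborel (slab i \<inter> proj i -` ?T) = 0"
      using emeasure_shadow_le_Basis[OF i, of ?T] by simp
    moreover have "ball 0 (1/2) \<subseteq> slab i \<inter> proj i -` ?T"
    proof
      fix x assume "x \<in> ball (0::real^'n) (1/2)"
      then show "x \<in> slab i \<inter> proj i -` ?T"
        using Cauchy_Schwarz_ineq2[of i x] norm_proj_le[OF ni, of x] proj_in_hyp[OF ni, of x] ni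
        by (auto simp: slab_def)
    qed
    moreover have "slab i \<inter> proj i -` ?T \<in> sets borel"
      using measurable_sets[OF proj_measurable, of ?T i] by auto
    ultimately have "emeasure lborel (ball (0::real^'n) (1/2)) = 0"
      by (metis emeasure_mono le_zero_eq sets_lborel)
    then show False
      using unit_ball_vol_pos[of "real DIM(real^'n)"] by (subst (asm) emeasure_ball) auto
  qed
  moreover have "0 \<le> c" using wpos by (simp add: c_def b_def)
  ultimately show ?thesis using eq by (intro exI[of _ c]) auto
qed

section \<open>Lines through a convex body\<close>

definition line_dom :: "'a::euclidean_space set \<Rightarrow> 'a \<Rightarrow> 'a set" where
  "line_dom L u = {x. \<exists>s. x + s *\<^sub>R u \<in> L}"

text \<open>Measured from \<open>x\<close> itself, with sign; the lower end of the section is then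
  at \<open>- height L (- u) x\<close>, so one function describes both ends. Lines that miss
  \<open>L\<close> get the value 0, which keeps the function Borel measurable.\<close>

definition height :: "'a::euclidean_space set \<Rightarrow> 'a \<Rightarrow> 'a \<Rightarrow> real" where
  "height L u x = (if x \<in> line_dom L u then Sup {s. x + s *\<^sub>R u \<in> L} else 0)"

definition top_point :: "'a::euclidean_space set \<Rightarrow> 'a \<Rightarrow> 'a \<Rightarrow> 'a" where
  "top_point L u x = x + height L u x *\<^sub>R u"

definition top_measure :: "'a::euclidean_space set \<Rightarrow> 'a \<Rightarrow> 'a measure" where
  "top_measure L u = distr (density lborel (indicator (slab u \<inter> line_dom L u))) borel (top_point L u)"

lemma slab_minus [simp]: "slab (- u) = slab u"
  by (simp add: slab_def)

lemma line_dom_minus [simp]: "line_dom L (- u) = line_dom L u"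
proof -
  have "(\<exists>s. x + s *\<^sub>R (- u) \<in> L) \<longleftrightarrow> (\<exists>s. x + s *\<^sub>R u \<in> L)" for x
    by (metis add.inverse_inverse scaleR_minus_left scaleR_minus_right)
  then show ?thesis by (simp add: line_dom_def)
qed

lemma line_dom_shift: "x + s *\<^sub>R u \<in> line_dom L u \<longleftrightarrow> x \<in> line_dom L u"
proof -
  have "(\<exists>r. x + s *\<^sub>R u + r *\<^sub>R u \<in> L) \<longleftrightarrow> (\<exists>r. x + r *\<^sub>R u \<in> L)"
    by (metis add.assoc add_diff_cancel_left' diff_add_cancel scaleR_add_left add.commute)
  then show ?thesis by (simp add: line_dom_def)
qed

lemma line_dom_proj: "proj u x \<in> line_dom L u \<longleftrightarrow> x \<in> line_dom L u"
  using line_dom_shift[of x "- (u \<bullet> x)" u L] by (simp add: proj_def)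

lemma sets_top_measure [simp, measurable_cong]: "sets (top_measure L u) = sets borel"
  by (simp add: top_measure_def)

lemma space_top_measure [simp]: "space (top_measure L u) = UNIV"
  by (simp add: top_measure_def)

text \<open>The set is the difference of the compact \<open>L\<close> and the closed image of
  \<open>S\<close> on the line through \<open>u\<close>. With \<open>S = UNIV\<close> it shows that
  \<open>line_dom\<close> is closed, with \<open>S = {r..}\<close> that \<open>height\<close> has
  Borel superlevel sets.\<close>

lemma closed_translates:
  fixes u :: "'a::euclidean_space"
  assumes "compact L" "closed S" "u \<noteq> 0"
  shows "closed {x. \<exists>s\<in>S. x + s *\<^sub>R u \<in> L}"
proof -
  have "closed ((\<lambda>s. s *\<^sub>R u) ` S)"
    using \<open>closed S\<close> \<open>u \<noteq> 0\<close>
    by (intro closed_injective_linear_image linear_scaleR_left) (auto simp: inj_on_def)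
  then have "closed (\<Union>x\<in>L. \<Union>y\<in>(\<lambda>s. s *\<^sub>R u) ` S. {x - y})"
    by (rule compact_closed_differences[OF \<open>compact L\<close>])
  also have "(\<Union>x\<in>L. \<Union>y\<in>(\<lambda>s. s *\<^sub>R u) ` S. {x - y}) = {x. \<exists>s\<in>S. x + s *\<^sub>R u \<in> L}"
  proof (intro set_eqI iffI)
    fix x assume "x \<in> (\<Union>x\<in>L. \<Union>y\<in>(\<lambda>s. s *\<^sub>R u) ` S. {x - y})"
    then obtain y s where "y \<in> L" "s \<in> S" "x = y - s *\<^sub>R u" by auto
    then have "x + s *\<^sub>R u \<in> L" by simp
    with \<open>s \<in> S\<close> show "x \<in> {x. \<exists>s\<in>S. x + s *\<^sub>R u \<in> L}" by blast
  next
    fix x assume "x \<in> {x. \<exists>s\<in>S. x + s *\<^sub>R u \<in> L}"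
    then obtain s where "s \<in> S" "x + s *\<^sub>R u \<in> L" by auto
    moreover have "x = (x + s *\<^sub>R u) - s *\<^sub>R u" by simp
    ultimately show "x \<in> (\<Union>x\<in>L. \<Union>y\<in>(\<lambda>s. s *\<^sub>R u) ` S. {x - y})" by blast
  qed
  finally show ?thesis .
qed

locale solid =
  fixes L :: "'a::euclidean_space set"
  assumes body: "convex_body L"
begin

lemma convex: "convex L" and compact: "compact L" and interior: "interior L \<noteq> {}"
  using body by (auto simp: convex_body_def)

lemma closed: "closed L"
  using compact by (rule compact_imp_closed)

lemma L_borel [measurable]: "L \<in> sets borel"
  using closed by (rule borel_closed)

lemma frontier_subset: "frontier L \<subseteq> L"
  using closed by (rule frontier_subset_closed)

lemma bound: obtains R where "0 < R" "\<And>x. x \<in> L \<Longrightarrow> norm x \<le> R"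
  using compact_imp_bounded[OF compact] by (auto simp: bounded_pos)

end

locale solid_dir = solid L for L :: "'a::euclidean_space set" +
  fixes u :: 'a
  assumes u: "norm u = 1"
begin

lemma u0: "u \<noteq> 0"
  using u by auto

lemma solid_dir_minus: "solid_dir L (- u)"
  by unfold_locales (simp add: u)

lemma line_dom_closed: "closed (line_dom L u)"
  using closed_translates[OF compact closed_UNIV u0] by (simp add: line_dom_def)

lemma line_dom_borel [measurable]: "line_dom L u \<in> sets borel"
  using line_dom_closed by (rule borel_closed)

lemma section_compact: "compact {s. x + s *\<^sub>R u \<in> L}"
proof -
  have "closed ((\<lambda>s. x + s *\<^sub>R u) -` L)"
    by (intro continuous_closed_vimage closed) (auto intro!: continuous_intros)
  moreover obtain R where R: "\<And>x. x \<in> L \<Longrightarrow> norm x \<le> R" by (metis bound)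
  have "\<bar>s\<bar> \<le> R + norm x" if "x + s *\<^sub>R u \<in> L" for s
  proof -
    have "\<bar>s\<bar> = norm ((x + s *\<^sub>R u) - x)" by (simp add: u)
    also have "\<dots> \<le> norm (x + s *\<^sub>R u) + norm x" by (rule norm_triangle_ineq4)
    finally show ?thesis using R[OF that] by simp
  qed
  then have "bounded {s. x + s *\<^sub>R u \<in> L}" by (auto simp: bounded_real)
  ultimately show ?thesis by (simp add: compact_eq_bounded_closed vimage_def)
qed

lemma
  assumes x: "x \<in> line_dom L u"
  shows top_point_in: "top_point L u x \<in> L"
    and le_height: "x + s *\<^sub>R u \<in> L \<Longrightarrow> s \<le> height L u x"
proof -
  let ?S = "{s. x + s *\<^sub>R u \<in> L}"
  have ne: "?S \<noteq> {}" and bdd: "bdd_above ?S"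
    using x section_compact[of x] by (auto simp: line_dom_def dest: compact_imp_bounded bounded_imp_bdd_above)
  have "Sup ?S \<in> ?S"
    using section_compact[of x] by (intro closed_contains_Sup ne bdd compact_imp_closed)
  then show "top_point L u x \<in> L"
    using x by (simp add: top_point_def height_def)
  show "s \<le> height L u x" if "x + s *\<^sub>R u \<in> L"
    using x bdd that by (simp add: height_def cSup_upper)
qed

lemma height_unique:
  assumes "x + s *\<^sub>R u \<in> L" and "\<And>t. x + t *\<^sub>R u \<in> L \<Longrightarrow> t \<le> s"
  shows "height L u x = s"
proof -
  have x: "x \<in> line_dom L u" using assms by (auto simp: line_dom_def)
  show ?thesis
    using le_height[OF x assms(1)] assms(2)[of "height L u x"] top_point_in[OF x]
    by (simp add: top_point_def)
qed

lemma height_shift: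
  assumes x: "x \<in> line_dom L u"
  shows "height L u (x + r *\<^sub>R u) = height L u x - r"
proof (rule height_unique)
  have eq: "x + r *\<^sub>R u + t *\<^sub>R u = x + (r + t) *\<^sub>R u" for t
    by (simp add: scaleR_add_left add.assoc)
  show "x + r *\<^sub>R u + (height L u x - r) *\<^sub>R u \<in> L"
    using top_point_in[OF x] unfolding eq by (simp add: top_point_def)
  show "t \<le> height L u x - r" if "x + r *\<^sub>R u + t *\<^sub>R u \<in> L" for t
    using le_height[OF x, of "r + t"] that unfolding eq by simp
qed

lemma top_point_shift: "x \<in> line_dom L u \<Longrightarrow> top_point L u (x + r *\<^sub>R u) = top_point L u x"
  by (simp add: top_point_def height_shift scaleR_diff_left)

lemma top_point_proj: "x \<in> line_dom L u \<Longrightarrow> top_point L u (proj u x) = top_point L u x"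
  using top_point_shift[of x "- (u \<bullet> x)"] by (simp add: proj_def)

lemma proj_top_point: "proj u (top_point L u x) = proj u x"
  unfolding top_point_def by (rule proj_add_scale[OF u])

lemma height_measurable [measurable]: "height L u \<in> borel_measurable borel"
proof (rule borel_measurable_iff_ge[THEN iffD2], rule allI)
  fix r :: real
  have cl: "{x. \<exists>s\<in>{r..}. x + s *\<^sub>R u \<in> L} \<in> sets borel"
    by (intro borel_closed closed_translates compact u0) simp
  \<comment> \<open>The second set accounts for the default value 0 on lines that miss
    \<open>L\<close>.\<close>
  have "{x \<in> space borel. r \<le> height L u x} =
    {x. \<exists>s\<in>{r..}. x + s *\<^sub>R u \<in> L} \<union> (if r \<le> 0 then - line_dom L u else {})"
  proof (intro set_eqI)
    fix x
    show "x \<in> {x \<in> space borel. r \<le> height L u x} \<longleftrightarrow>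
      x \<in> {x. \<exists>s\<in>{r..}. x + s *\<^sub>R u \<in> L} \<union> (if r \<le> 0 then - line_dom L u else {})"
    proof (cases "x \<in> line_dom L u")
      case True
      have "r \<le> height L u x \<longleftrightarrow> (\<exists>s\<in>{r..}. x + s *\<^sub>R u \<in> L)"
      proof
        show "\<exists>s\<in>{r..}. x + s *\<^sub>R u \<in> L" if "r \<le> height L u x"
          using that top_point_in[OF True] unfolding top_point_def
          by (intro bexI[of _ "height L u x"]) simp_all
        show "r \<le> height L u x" if "\<exists>s\<in>{r..}. x + s *\<^sub>R u \<in> L"
          using that le_height[OF True] by fastforce
      qed
      with True show ?thesis by simp
    next
      case False
      then have "height L u x = 0" "\<And>s. x + s *\<^sub>R u \<notin> L"
        by (auto simp: height_def line_dom_def)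
      with False show ?thesis by auto
    qed
  qed
  also have "\<dots> \<in> sets borel"
    using cl line_dom_borel by auto
  finally show "{x \<in> space borel. r \<le> height L u x} \<in> sets borel" .
qed

lemma top_point_measurable [measurable]: "top_point L u \<in> borel_measurable borel"
  unfolding top_point_def by measurable

lemma in_section_iff:
  assumes x: "x \<in> line_dom L u"
  shows "x + s *\<^sub>R u \<in> L \<longleftrightarrow> - height L (- u) x \<le> s \<and> s \<le> height L u x"
proof -
  interpret m: solid_dir L "- u" by (rule solid_dir_minus)
  have x': "x \<in> line_dom L (- u)" using x by simp
  show ?thesis
  proof
    assume "x + s *\<^sub>R u \<in> L"
    then show "- height L (- u) x \<le> s \<and> s \<le> height L u x"
      using le_height[OF x] m.le_height[OF x', of "- s"] by auto
  next
    assume s: "- height L (- u) x \<le> s \<and> s \<le> height L u x"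
    have cvx: "convex ((\<lambda>s. x + s *\<^sub>R u) -` L)"
    proof -
      have "convex ((\<lambda>s. s *\<^sub>R u) -` ((+) (- x) ` L))"
        by (intro convex_linear_vimage linear_scaleR_left convex_translation convex)
      also have "(\<lambda>s. s *\<^sub>R u) -` ((+) (- x) ` L) = (\<lambda>s. x + s *\<^sub>R u) -` L"
        by (auto simp: image_iff algebra_simps)
      finally show ?thesis .
    qed
    have "height L u x \<in> (\<lambda>s. x + s *\<^sub>R u) -` L" "- height L (- u) x \<in> (\<lambda>s. x + s *\<^sub>R u) -` L"
      using top_point_in[OF x] m.top_point_in[OF x'] by (auto simp: top_point_def)
    then have "s \<in> (\<lambda>s. x + s *\<^sub>R u) -` L"
      using cvx s unfolding is_interval_convex_1[symmetric] is_interval_1 by blast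
    then show "x + s *\<^sub>R u \<in> L" by simp
  qed
qed

lemma heights_le:
  assumes x: "x \<in> line_dom L u"
  shows "- height L (- u) x \<le> height L u x"
proof -
  obtain s where "x + s *\<^sub>R u \<in> L" using x by (auto simp: line_dom_def)
  then show ?thesis unfolding in_section_iff[OF x] by linarith
qed

lemma top_point_frontier:
  assumes x: "x \<in> line_dom L u"
  shows "top_point L u x \<in> frontier L"
proof -
  have "top_point L u x \<notin> interior L"
  proof
    assume "top_point L u x \<in> interior L"
    then obtain e where e: "0 < e" "ball (top_point L u x) e \<subseteq> L"
      unfolding mem_interior by blast
    have "top_point L u x + (e/2) *\<^sub>R u \<in> ball (top_point L u x) e"
      using e by (simp add: dist_norm u)
    then have "x + (height L u x + e/2) *\<^sub>R u \<in> L"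
      using e by (auto simp: top_point_def scaleR_add_left add.assoc)
    then show False using le_height[OF x] e by fastforce
  qed
  then show ?thesis
    using top_point_in[OF x] closed by (simp add: frontier_def closure_closed)
qed

lemma bounded_slab_dom: "bounded (slab u \<inter> line_dom L u)"
proof -
  obtain R where R: "\<And>x. x \<in> L \<Longrightarrow> norm x \<le> R" by (metis bound)
  have "norm x \<le> 2 * R + 1/2" if x: "x \<in> slab u \<inter> line_dom L u" for x
  proof -
    obtain s where s: "x + s *\<^sub>R u \<in> L" using x by (auto simp: line_dom_def)
    have "u \<bullet> (x + s *\<^sub>R u) = u \<bullet> x + s" using u by (simp add: inner_add_right dot_square_norm)
    moreover have "\<bar>u \<bullet> (x + s *\<^sub>R u)\<bar> \<le> norm (x + s *\<^sub>R u)"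
      using Cauchy_Schwarz_ineq2[of u "x + s *\<^sub>R u"] u by simp
    moreover have "\<bar>u \<bullet> x\<bar> < 1/2" using x by (simp add: slab_def)
    ultimately have "\<bar>s\<bar> \<le> R + 1/2" using R[OF s] by linarith
    moreover have "norm x \<le> norm (x + s *\<^sub>R u) + norm (s *\<^sub>R u)"
      using norm_triangle_ineq4[of "x + s *\<^sub>R u" "s *\<^sub>R u"] by simp
    ultimately show ?thesis using R[OF s] u by simp
  qed
  then show ?thesis by (auto simp: bounded_iff)
qed

lemma emeasure_slab_dom_finite: "emeasure lborel (slab u \<inter> line_dom L u) < \<infinity>"
  using emeasure_bounded_finite[OF bounded_slab_dom] by (simp add: less_top)

lemma emeasure_top_measure:
  assumes [measurable]: "S \<in> sets borel"
  shows "emeasure (top_measure L u) S = emeasure lborel {x \<in> slab u \<inter> line_dom L u. top_point L u x \<in> S}"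
proof -
  have "emeasure (top_measure L u) S
      = emeasure (density lborel (indicator (slab u \<inter> line_dom L u))) (top_point L u -` S)"
    unfolding top_measure_def by (subst emeasure_distr) auto
  also have "\<dots> = (\<integral>\<^sup>+x. indicator (slab u \<inter> line_dom L u) x * indicator (top_point L u -` S) x \<partial>lborel)"
    using measurable_sets[OF top_point_measurable, of S] by (intro emeasure_density) auto
  also have "\<dots> = (\<integral>\<^sup>+x. indicator {x \<in> slab u \<inter> line_dom L u. top_point L u x \<in> S} x \<partial>lborel)"
    by (intro nn_integral_cong) (auto split: split_indicator)
  also have "\<dots> = emeasure lborel {x \<in> slab u \<inter> line_dom L u. top_point L u x \<in> S}"
    by (rule nn_integral_indicator) measurable
  finally show ?thesis .
qed

lemma finite_top_measure: "finite_measure (top_measure L u)"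
proof
  have "{x \<in> slab u \<inter> line_dom L u. top_point L u x \<in> UNIV} = slab u \<inter> line_dom L u" by blast
  then have "emeasure (top_measure L u) UNIV = emeasure lborel (slab u \<inter> line_dom L u)"
    using emeasure_top_measure[of UNIV] by simp
  then show "emeasure (top_measure L u) (space (top_measure L u)) \<noteq> \<infinity>"
    using emeasure_slab_dom_finite by simp
qed

lemma top_measure_outside: "emeasure (top_measure L u) (- frontier L) = 0"
proof -
  have "{x \<in> slab u \<inter> line_dom L u. top_point L u x \<in> - frontier L} = {}"
    using top_point_frontier by auto
  then have "emeasure lborel {x \<in> slab u \<inter> line_dom L u. top_point L u x \<in> - frontier L} = 0"
    by (simp only: emeasure_empty)
  moreover have "- frontier L \<in> sets borel"
    by (intro borel_open open_Compl frontier_closed)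
  ultimately show ?thesis
    using emeasure_top_measure by metis
qed

lemma integral_top_measure:
  fixes f :: "'a \<Rightarrow> real"
  assumes [measurable]: "f \<in> borel_measurable borel"
  shows "(\<integral>x. f x \<partial>top_measure L u) = (\<integral>x. indicator (slab u \<inter> line_dom L u) x * f (top_point L u x) \<partial>lborel)"
proof -
  have "density lborel (indicator (slab u \<inter> line_dom L u)) = density lborel (\<lambda>x. ennreal (indicator (slab u \<inter> line_dom L u) x))"
    by (intro arg_cong2[where f=density] refl ext) (simp add: ennreal_indicator)
  then show ?thesis
    unfolding top_measure_def
    by (simp add: integral_distr integral_density)
qed

end

section \<open>Boundary pieces with almost constant normal\<close>

text \<open>One normal close to \<open>u\<close> is enough, even where there are several. This makes
  the caps closed and lets finitely many of them cover the whole frontier, corners included.\<close>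

definition normal_cap :: "'a::euclidean_space set \<Rightarrow> 'a \<Rightarrow> real \<Rightarrow> 'a set" where
  "normal_cap L u e = {x \<in> L. \<exists>n\<in>outer_unit_normals L x. norm (n - u) \<le> e}"

context solid begin

text \<open>Pairs of a point and a unit normal at it form a compact set, and this is the projection
  of a closed part of it. It yields both closedness of the caps and measurability of the normal
  field.\<close>

lemma normals_meet_compact:
  assumes "closed C"
  shows "compact {x \<in> L. outer_unit_normals L x \<inter> C \<noteq> {}}"
proof -
  let ?G = "(L \<times> (sphere 0 1 \<inter> C)) \<inter> (\<Inter>y\<in>L. {p. snd p \<bullet> (y - fst p) \<le> 0})"
  have "compact (L \<times> (sphere 0 1 \<inter> C))"
    using \<open>closed C\<close> by (intro compact_Times compact compact_Int_closed compact_sphere)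
  moreover have "closed (\<Inter>y\<in>L. {p. snd p \<bullet> (y - fst p) \<le> 0})"
    by (intro closed_INT ballI closed_Collect_le continuous_intros)
  ultimately have "compact ?G"
    by (rule compact_Int_closed)
  then have "compact (fst ` ?G)"
    by (intro compact_continuous_image continuous_intros)
  also have "fst ` ?G = {x \<in> L. outer_unit_normals L x \<inter> C \<noteq> {}}"
  proof (intro set_eqI iffI)
    fix x assume "x \<in> {x \<in> L. outer_unit_normals L x \<inter> C \<noteq> {}}"
    then obtain n where "x \<in> L" "n \<in> C" "n \<in> outer_unit_normals L x" by blast
    then have "(x, n) \<in> ?G" by (auto simp: outer_unit_normals_def)
    then show "x \<in> fst ` ?G" using image_eqI[of x fst "(x, n)" ?G] by simp
  qed (auto simp: outer_unit_normals_def)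
  finally show ?thesis .
qed

lemma normal_cap_closed: "closed (normal_cap L u e)"
proof -
  have "normal_cap L u e = {x \<in> L. outer_unit_normals L x \<inter> cball u e \<noteq> {}}"
    by (auto simp: normal_cap_def dist_norm norm_minus_commute)
  then show ?thesis
    using normals_meet_compact[OF closed_cball] compact_imp_closed by metis
qed

lemma normal_cap_borel [measurable]: "normal_cap L u e \<in> sets borel"
  using normal_cap_closed by (rule borel_closed)

lemma outer_unit_normals_nonempty:
  assumes x: "x \<in> frontier L"
  shows "outer_unit_normals L x \<noteq> {}"
proof -
  have "rel_interior L = interior L"
    using interior by (rule rel_interior_nonempty_interior)
  then have "x \<in> closure L" "x \<notin> rel_interior L"
    using x by (auto simp: frontier_def)
  then obtain a where a: "a \<noteq> 0" "\<And>y. y \<in> closure L \<Longrightarrow> a \<bullet> x \<le> a \<bullet> y"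
    using supporting_hyperplane_relative_frontier[OF convex] by metis
  have "- (a /\<^sub>R norm a) \<in> outer_unit_normals L x"
    using a closure_subset[of L]
    by (auto simp: outer_unit_normals_def inner_diff_right subset_iff divide_right_mono)
  then show ?thesis by blast
qed

lemma normal_imp_frontier:
  assumes x: "x \<in> L" and n: "n \<in> outer_unit_normals L x"
  shows "x \<in> frontier L"
proof -
  have "x \<notin> interior L"
  proof
    assume "x \<in> interior L"
    then obtain e where e: "0 < e" "ball x e \<subseteq> L"
      unfolding mem_interior by blast
    have nn: "n \<bullet> n = 1" using n by (simp add: outer_unit_normals_def dot_square_norm)
    have "x + (e/2) *\<^sub>R n \<in> ball x e"
      using e n by (simp add: dist_norm outer_unit_normals_def)
    then have "x + (e/2) *\<^sub>R n \<in> L" using e by blast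
    then have "n \<bullet> (x + (e/2) *\<^sub>R n - x) \<le> 0"
      using n unfolding outer_unit_normals_def by blast
    then show False using nn e by simp
  qed
  then show ?thesis using x closed by (simp add: frontier_def closure_closed)
qed

lemma normal_cap_frontier: "normal_cap L u e \<subseteq> frontier L"
  using normal_imp_frontier by (auto simp: normal_cap_def)

text \<open>A finite net of the unit sphere. The net property is part of the conclusion because two
  different normals at one point will have to be approximated from the same finite set.\<close>

lemma frontier_covered_by_caps:
  assumes "0 < e"
  obtains F where "finite F" "\<And>u. u \<in> F \<Longrightarrow> norm u = 1" "frontier L \<subseteq> (\<Union>u\<in>F. normal_cap L u e)"
    "\<And>n. norm n = 1 \<Longrightarrow> \<exists>u\<in>F. norm (n - u) \<le> e"
proof -
  have "seq_compact (sphere (0::'a) 1)"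
    by (intro compact_imp_seq_compact compact_sphere)
  then obtain F where F: "finite F" "F \<subseteq> sphere (0::'a) 1" "sphere (0::'a) 1 \<subseteq> (\<Union>x\<in>F. ball x e)"
    using seq_compact_imp_totally_bounded[of "sphere (0::'a) 1"] \<open>0 < e\<close> by metis
  have net: "\<exists>u\<in>F. norm (n - u) \<le> e" if "norm n = 1" for n
  proof -
    have "n \<in> sphere 0 1" by (simp add: that)
    then have "n \<in> (\<Union>x\<in>F. ball x e)" using F(3) by blast
    then show ?thesis by (auto simp: dist_norm norm_minus_commute intro: less_imp_le)
  qed
  show ?thesis
  proof (rule that[OF F(1)])
    show "norm u = 1" if "u \<in> F" for u using F(2) that by auto
    show "frontier L \<subseteq> (\<Union>u\<in>F. normal_cap L u e)"
    proof
      fix x assume x: "x \<in> frontier L"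
      then obtain n where n: "n \<in> outer_unit_normals L x" using outer_unit_normals_nonempty by blast
      then obtain u where "u \<in> F" "norm (n - u) \<le> e"
        using net[of n] by (auto simp: outer_unit_normals_def)
      then show "x \<in> (\<Union>u\<in>F. normal_cap L u e)"
        using n x frontier_subset by (auto simp: normal_cap_def)
    qed
  qed (rule net)
qed

lemma normal_cap_inner_le:
  assumes x: "x \<in> normal_cap L u e" and y: "y \<in> L"
  shows "u \<bullet> (y - x) \<le> e * norm (y - x)"
proof -
  obtain n where n: "n \<in> outer_unit_normals L x" "norm (n - u) \<le> e"
    using x by (auto simp: normal_cap_def)
  have "u \<bullet> (y - x) = n \<bullet> (y - x) - (n - u) \<bullet> (y - x)"
    by (simp add: inner_diff_left)
  also have "\<dots> \<le> norm (n - u) * norm (y - x)"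
  proof -
    have "n \<bullet> (y - x) \<le> 0" using n y by (simp add: outer_unit_normals_def)
    then show ?thesis using Cauchy_Schwarz_ineq2[of "n - u" "y - x"] by linarith
  qed
  also have "\<dots> \<le> e * norm (y - x)"
    using n by (simp add: mult_right_mono)
  finally show ?thesis .
qed

text \<open>Each of the two points lies in \<open>L\<close> and so satisfies the supporting
  inequality of the other; the two inequalities bound the \<open>u\<close>-component of
  \<open>x - y\<close> from both sides. Pythagoras then bounds the contraction of the
  projection.\<close>

lemma normal_cap_norm_proj:
  assumes u: "norm u = 1" and e: "0 < e" "e < 1"
    and x: "x \<in> normal_cap L u e" and y: "y \<in> normal_cap L u e"
  shows "sqrt (1 - e\<^sup>2) * norm (x - y) \<le> norm (proj u (x - y))"
proof (rule power2_le_imp_le)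
  have "u \<bullet> (y - x) \<le> e * norm (y - x)" "u \<bullet> (x - y) \<le> e * norm (x - y)"
    using normal_cap_inner_le x y by (auto simp: normal_cap_def)
  then have "\<bar>u \<bullet> (x - y)\<bar> \<le> e * norm (x - y)"
    by (simp add: inner_diff_right norm_minus_commute)
  then have "(u \<bullet> (x - y))\<^sup>2 \<le> (e * norm (x - y))\<^sup>2"
    by (rule abs_le_square_iff[THEN iffD1, OF order_trans]) simp
  moreover have "0 \<le> 1 - e\<^sup>2" using e by (simp add: power_le_one)
  ultimately show "(sqrt (1 - e\<^sup>2) * norm (x - y))\<^sup>2 \<le> (norm (proj u (x - y)))\<^sup>2"
    unfolding norm_proj[OF u] by (simp add: power_mult_distrib algebra_simps)
qed simp

text \<open>Unit vectors at distance at most 1 have inner product at least 1/2, so moving in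
  direction \<open>u\<close> leaves the supporting half-space at \<open>x\<close>. Points of a cap
  are therefore upper ends of their lines.\<close>

lemma normal_cap_normal_pos:
  assumes u: "norm u = 1" and e: "e \<le> 1" and x: "x \<in> normal_cap L u e" and s: "x + s *\<^sub>R u \<in> L"
  shows "s \<le> 0"
proof -
  obtain n where n: "n \<in> outer_unit_normals L x" "norm (n - u) \<le> e"
    using x by (auto simp: normal_cap_def)
  have nn: "norm n = 1" and "n \<bullet> (x + s *\<^sub>R u - x) \<le> 0"
    using n s unfolding outer_unit_normals_def by blast+
  then have "s * (n \<bullet> u) \<le> 0" by simp
  moreover have "0 < n \<bullet> u"
  proof -
    have "n \<bullet> n = 1" "u \<bullet> u = 1"
      using nn u by (simp_all add: dot_square_norm)
    then have "(norm (n - u))\<^sup>2 = 2 - 2 * (n \<bullet> u)"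
      by (simp add: power2_norm_eq_inner inner_diff_left inner_diff_right inner_commute)
    moreover have "(norm (n - u))\<^sup>2 \<le> 1"
      using n(2) e by (intro power_le_one) auto
    ultimately show ?thesis by simp
  qed
  ultimately show ?thesis by (simp add: mult_le_0_iff)
qed

end

context solid_dir begin

text \<open>Lines that touch \<open>L\<close> without entering its interior form the boundary of a convex cylinder.\<close>

lemma tangent_lines_null: "line_dom L u - line_dom (interior L) u \<in> null_sets lborel"
proof -
  let ?W = "line_dom (interior L) u"
  have W: "?W = (\<Union>s. (\<lambda>y. - s *\<^sub>R u + y) ` interior L)"
  proof -
    have "(\<lambda>y. - s *\<^sub>R u + y) ` interior L = {x. x + s *\<^sub>R u \<in> interior L}" for s
    proof (intro set_eqI iffI)
      fix x assume "x \<in> {x. x + s *\<^sub>R u \<in> interior L}"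
      then show "x \<in> (\<lambda>y. - s *\<^sub>R u + y) ` interior L"
        by (intro image_eqI[of _ _ "x + s *\<^sub>R u"]) auto
    qed auto
    then show ?thesis by (auto simp: line_dom_def)
  qed
  have opn: "open ?W"
    unfolding W by (intro open_UN ballI open_translation open_interior)
  have cvx: "convex ?W"
  proof (rule convexI)
    fix x y and a b :: real assume x: "x \<in> ?W" and y: "y \<in> ?W" and ab: "0 \<le> a" "0 \<le> b" "a + b = 1"
    obtain s t where "x + s *\<^sub>R u \<in> interior L" "y + t *\<^sub>R u \<in> interior L"
      using x y by (auto simp: line_dom_def)
    then have "a *\<^sub>R (x + s *\<^sub>R u) + b *\<^sub>R (y + t *\<^sub>R u) \<in> interior L"
      using ab convex_interior[OF convex] by (auto simp: convex_def)
    also have "a *\<^sub>R (x + s *\<^sub>R u) + b *\<^sub>R (y + t *\<^sub>R u) = a *\<^sub>R x + b *\<^sub>R y + (a * s + b * t) *\<^sub>R u"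
      by (simp add: algebra_simps)
    finally show "a *\<^sub>R x + b *\<^sub>R y \<in> ?W" by (auto simp: line_dom_def)
  qed
  have "x \<in> closure ?W" if x: "x \<in> line_dom L u" for x
  proof -
    obtain s where s: "x + s *\<^sub>R u \<in> L" using x by (auto simp: line_dom_def)
    then have "x + s *\<^sub>R u \<in> closure (interior L)"
      using convex_closure_interior[OF convex interior] closure_subset by blast
    moreover have x_eq: "- s *\<^sub>R u + (x + s *\<^sub>R u) = x" by simp
    ultimately have "- s *\<^sub>R u + (x + s *\<^sub>R u) \<in> (\<lambda>y. - s *\<^sub>R u + y) ` closure (interior L)" by blast
    then have "x \<in> closure ((\<lambda>y. - s *\<^sub>R u + y) ` interior L)"
      by (simp only: closure_translation x_eq)
    also have "\<dots> \<subseteq> closure ?W" unfolding W by (intro closure_mono) blast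
    finally show ?thesis .
  qed
  then have sub: "line_dom L u - ?W \<subseteq> frontier ?W"
    using opn by (auto simp: frontier_def interior_open)
  have "negligible (line_dom L u - ?W)"
    by (rule negligible_subset[OF negligible_convex_frontier[OF cvx] sub])
  moreover have "line_dom L u - ?W \<in> sets borel"
    using opn by (intro sets.Diff line_dom_borel borel_open)
  ultimately show ?thesis
    by (simp add: negligible_iff_null_sets null_sets_completion_iff)
qed

lemma proper_section:
  assumes "x \<in> line_dom (interior L) u"
  shows "- height L (- u) x < height L u x"
proof -
  obtain s where s: "x + s *\<^sub>R u \<in> interior L" using assms by (auto simp: line_dom_def)
  then obtain e where e: "0 < e" "ball (x + s *\<^sub>R u) e \<subseteq> L"
    unfolding mem_interior by blast
  have x: "x \<in> line_dom L u"
    using s interior_subset by (auto simp: line_dom_def)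
  have "x + s *\<^sub>R u \<in> L" using s interior_subset by blast
  moreover have "x + s *\<^sub>R u + (e/2) *\<^sub>R u \<in> L"
    using e by (intro subsetD[OF e(2)]) (simp add: dist_norm u)
  then have "x + (s + e/2) *\<^sub>R u \<in> L" by (simp add: scaleR_add_left add.assoc)
  ultimately show ?thesis
    using in_section_iff[OF x, of s] in_section_iff[OF x, of "s + e/2"] e by auto
qed

text \<open>A point of the cap is the upper end of its line. If it is also the lower end, the
  section is a single point and the line is tangent; such lines form a null set.\<close>

lemma top_measure_opposite_cap:
  assumes S: "S \<in> sets borel" "S \<subseteq> normal_cap L u e" and e: "e \<le> 1"
  shows "emeasure (top_measure L (- u)) S = 0"
proof -
  interpret m: solid_dir L "- u" by (rule solid_dir_minus)
  have "{x \<in> slab u \<inter> line_dom L u. top_point L (- u) x \<in> S} \<subseteq> line_dom L u - line_dom (interior L) u"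
  proof safe
    fix x assume x: "x \<in> line_dom L u" "top_point L (- u) x \<in> S" and W: "x \<in> line_dom (interior L) u"
    let ?p = "top_point L (- u) x"
    have "?p + (height L u x + height L (- u) x) *\<^sub>R u = top_point L u x"
      by (simp add: top_point_def scaleR_add_left)
    then have "height L u x + height L (- u) x \<le> 0"
      using x S top_point_in[OF x(1)] normal_cap_normal_pos[OF u e, of ?p] by auto
    then show False using proper_section[OF W] by simp
  qed
  then have "emeasure lborel {x \<in> slab u \<inter> line_dom L u. top_point L (- u) x \<in> S}
      \<le> emeasure lborel (line_dom L u - line_dom (interior L) u)"
    using tangent_lines_null by (intro emeasure_mono) auto
  also have "\<dots> = 0" using tangent_lines_null by (rule null_setsD1)
  finally show ?thesis
    using m.emeasure_top_measure[OF S(1)] by simp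
qed

end

section \<open>Upper-end measures compared with surface area\<close>

locale solid_area = solid L for L :: "(real^'n) set" +
  fixes c :: real
  assumes c0: "0 < c"
    and hausdorff_hyp: "\<And>(u :: real^'n) T. norm u = 1 \<Longrightarrow> T \<in> sets borel \<Longrightarrow> T \<subseteq> hyp u \<Longrightarrow>
      hausdorff_outer (CARD('n) - 1) T = ennreal c * emeasure lborel (slab u \<inter> proj u -` T)"
begin

text \<open>\<open>T\<close> is the shadow in \<open>hyp u\<close> of those points of
  \<open>S\<close> that are upper ends, and the cylinder over it in the slab is the set measured by
  \<open>top_measure\<close>.\<close>

lemma hausdorff_top_shadow:
  assumes u: "norm u = 1" and S[measurable]: "S \<in> sets borel"
  defines "T \<equiv> {y \<in> hyp u \<inter> line_dom L u. top_point L u y \<in> S}"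
  shows "hausdorff_outer (CARD('n) - 1) T = ennreal c * emeasure (top_measure L u) S"
proof -
  interpret d: solid_dir L u by unfold_locales (rule u)
  have [measurable]: "T \<in> sets borel"
    unfolding T_def by measurable
  have "proj u x \<in> T \<longleftrightarrow> x \<in> line_dom L u \<and> top_point L u x \<in> S" for x
    using line_dom_proj[of u x L] d.top_point_proj[of x] proj_in_hyp[OF u, of x] by (auto simp: T_def)
  then have "slab u \<inter> proj u -` T = {x \<in> slab u \<inter> line_dom L u. top_point L u x \<in> S}"
    by auto
  then show ?thesis
    using hausdorff_hyp[OF u, of T] d.emeasure_top_measure[OF S] by (auto simp: T_def)
qed

lemma top_measure_le_hausdorff:
  assumes u: "norm u = 1" and S: "S \<in> sets borel"
  shows "ennreal c * emeasure (top_measure L u) S \<le> hausdorff_outer (CARD('n) - 1) S"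
proof -
  interpret d: solid_dir L u by unfold_locales (rule u)
  let ?T = "{y \<in> hyp u \<inter> line_dom L u. top_point L u y \<in> S}"
  have "y \<in> proj u ` S" if "y \<in> ?T" for y
    using that d.proj_top_point[of y] proj_hyp[of y u] by (metis (mono_tags, lifting) IntD1 imageI mem_Collect_eq)
  then have "hausdorff_outer (CARD('n) - 1) ?T \<le> hausdorff_outer (CARD('n) - 1) (proj u ` S)"
    by (intro hausdorff_outer_mono) auto
  also have "\<dots> \<le> ennreal (1 ^ (CARD('n) - 1)) * hausdorff_outer (CARD('n) - 1) S"
    by (rule hausdorff_outer_lipschitz_image)
       (auto simp: dist_norm proj_diff[symmetric] intro: norm_proj_le[OF u])
  finally show ?thesis
    using hausdorff_top_shadow[OF u S] by simp
qed

text \<open>Every point of the cap is its own upper end, so \<open>top_point\<close> maps the shadow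
  back onto \<open>S\<close>, and on the shadow it has Lipschitz constant
  \<open>1 / sqrt (1 - e\<^sup>2)\<close>.\<close>

lemma hausdorff_cap_le_top_measure:
  assumes u: "norm u = 1" and S: "S \<in> sets borel" and cap: "S \<subseteq> normal_cap L u e" and e: "0 < e" "e < 1"
  shows "ennreal (sqrt (1 - e\<^sup>2) ^ (CARD('n) - 1)) * hausdorff_outer (CARD('n) - 1) S
    \<le> ennreal c * emeasure (top_measure L u) S"
proof -
  interpret d: solid_dir L u by unfold_locales (rule u)
  let ?T = "{y \<in> hyp u \<inter> line_dom L u. top_point L u y \<in> S}"
  let ?q = "sqrt (1 - e\<^sup>2)"
  have q: "0 < ?q" using e by (simp add: power_less_one_iff abs_square_less_1)
  have "x \<in> top_point L u ` ?T" if x: "x \<in> S" for x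
  proof -
    have xL: "x \<in> L" using x cap by (auto simp: normal_cap_def)
    then have dom: "x \<in> line_dom L u" by (auto simp: line_dom_def intro: exI[of _ 0])
    have "height L u x = 0"
    proof (rule d.height_unique)
      show "t \<le> 0" if "x + t *\<^sub>R u \<in> L" for t
        using e that by (intro normal_cap_normal_pos[OF u _ subsetD[OF cap x]]) auto
    qed (simp add: xL)
    then have "top_point L u (proj u x) = x"
      using d.top_point_proj[OF dom] by (simp add: top_point_def)
    moreover have "proj u x \<in> ?T"
      using calculation x dom by (simp add: proj_in_hyp[OF u] line_dom_proj)
    ultimately show ?thesis
      using image_eqI[of x "top_point L u" "proj u x" ?T] by simp
  qed
  then have "hausdorff_outer (CARD('n) - 1) S \<le> hausdorff_outer (CARD('n) - 1) (top_point L u ` ?T)"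
    by (intro hausdorff_outer_mono) auto
  also have "\<dots> \<le> ennreal ((1 / ?q) ^ (CARD('n) - 1)) * hausdorff_outer (CARD('n) - 1) ?T"
  proof (rule hausdorff_outer_lipschitz_image)
    show "0 < 1 / ?q" using q by simp
    fix x y assume x: "x \<in> ?T" and y: "y \<in> ?T"
    have "proj u (top_point L u x - top_point L u y) = x - y"
      using x y by (simp add: proj_diff d.proj_top_point proj_hyp)
    then have "?q * norm (top_point L u x - top_point L u y) \<le> norm (x - y)"
      using normal_cap_norm_proj[OF u e, of "top_point L u x" "top_point L u y"] x y cap by auto
    then show "dist (top_point L u x) (top_point L u y) \<le> 1 / ?q * dist x y"
      using q by (simp add: dist_norm field_simps)
  qed
  finally have "ennreal (?q ^ (CARD('n) - 1)) * hausdorff_outer (CARD('n) - 1) S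
    \<le> ennreal (?q ^ (CARD('n) - 1)) * (ennreal ((1 / ?q) ^ (CARD('n) - 1)) * hausdorff_outer (CARD('n) - 1) ?T)"
    by (rule mult_left_mono) simp
  also have "\<dots> = hausdorff_outer (CARD('n) - 1) ?T"
    using q by (simp add: mult.assoc[symmetric] ennreal_mult[symmetric] power_mult_distrib[symmetric])
  finally show ?thesis using hausdorff_top_shadow[OF u S] by simp
qed

text \<open>Finitely many caps of size 1/2 cover the frontier, and the area of each is bounded by a
  multiple of a finite upper-end measure.\<close>

lemma hausdorff_frontier_finite: "hausdorff_outer (CARD('n) - 1) (frontier L) < \<infinity>"
proof -
  obtain F where F: "finite F" "\<And>u. u \<in> F \<Longrightarrow> norm u = 1" "frontier L \<subseteq> (\<Union>u\<in>F. normal_cap L u (1/2))"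
    by (rule frontier_covered_by_caps[of "1/2"]) simp_all
  have cap: "hausdorff_outer (CARD('n) - 1) (normal_cap L u (1/2)) < \<infinity>" if "u \<in> F" for u
  proof -
    have u: "norm u = 1" using F(2) that .
    interpret d: solid_dir L u by unfold_locales (rule u)
    interpret fm: finite_measure "top_measure L u" by (rule d.finite_top_measure)
    define q where "q = sqrt (1 - (1/2)\<^sup>2) ^ (CARD('n) - 1)"
    have "0 < q" by (simp add: q_def power2_eq_square)
    moreover have "ennreal q * hausdorff_outer (CARD('n) - 1) (normal_cap L u (1/2)) < \<infinity>"
      unfolding q_def
    proof (rule le_less_trans[OF hausdorff_cap_le_top_measure[OF u normal_cap_borel order_refl]])
      show "ennreal c * emeasure (top_measure L u) (normal_cap L u (1/2)) < \<infinity>"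
        using fm.emeasure_finite[of "normal_cap L u (1/2)"]
        by (simp add: ennreal_mult_eq_top_iff less_top[symmetric])
    qed auto
    ultimately show ?thesis
      by (auto simp: ennreal_mult_less_top)
  qed
  have "hausdorff_outer (CARD('n) - 1) (\<Union>u\<in>G. normal_cap L u (1/2)) < \<infinity>" if "finite G" "G \<subseteq> F" for G
    using that
  proof (induction G)
    case (insert u G)
    have "hausdorff_outer (CARD('n) - 1) (\<Union>u\<in>insert u G. normal_cap L u (1/2))
      \<le> hausdorff_outer (CARD('n) - 1) (normal_cap L u (1/2)) + hausdorff_outer (CARD('n) - 1) (\<Union>u\<in>G. normal_cap L u (1/2))"
      using hausdorff_outer_Un_le by simp
    also have "\<dots> < \<infinity>" using insert cap[of u] by simp
    finally show ?case .
  qed simp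
  from this[OF F(1) order_refl] show ?thesis
    using hausdorff_outer_mono[OF F(3)] le_less_trans by blast
qed

end

section \<open>Signed combinations of measures\<close>

text \<open>A signed measure is represented by a finite family of finite measures with real
  coefficients. Stone-Weierstrass on the compact set carrying them all approximates \<open>f\<close>
  by polynomials, and \<open>C\<close> bounds the total variation.\<close>

lemma signed_measures_continuous_eq_0:
  fixes M :: "'i \<Rightarrow> 'a::euclidean_space measure" and a :: "'i \<Rightarrow> real"
  assumes M: "\<And>k. k \<in> I \<Longrightarrow> finite_measure (M k)" "\<And>k. k \<in> I \<Longrightarrow> sets (M k) = sets borel"
    and X: "compact X" "\<And>k. k \<in> I \<Longrightarrow> emeasure (M k) (- X) = 0"
    and poly: "\<And>p. real_polynomial_function p \<Longrightarrow> (\<Sum>k\<in>I. a k * (\<integral>x. p x \<partial>M k)) = 0"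
    and f: "continuous_on UNIV f" "\<And>x. \<bar>f x\<bar> \<le> B"
  shows "(\<Sum>k\<in>I. a k * (\<integral>x. f x \<partial>M k)) = 0"
proof -
  have AEX: "AE x in M k. x \<in> X" if "k \<in> I" for k
    using X(2)[OF that] compact_imp_closed[OF X(1)] M(2)[OF that]
    by (intro AE_I[of _ _ "- X"]) auto
  define C where "C = (\<Sum>k\<in>I. \<bar>a k\<bar> * measure (M k) (space (M k)))"
  have C0: "0 \<le> C" unfolding C_def by (intro sum_nonneg) auto
  have le: "\<bar>\<Sum>k\<in>I. a k * (\<integral>x. f x \<partial>M k)\<bar> \<le> e * C" if e: "0 < e" for e
  proof -
    obtain p where p: "real_polynomial_function p" "\<And>x. x \<in> X \<Longrightarrow> \<bar>f x - p x\<bar> < e"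
      using Stone_Weierstrass_real_polynomial_function[OF X(1) _ e, of f] f(1) continuous_on_subset
      by (metis subset_UNIV)
    have pc: "continuous_on UNIV p"
      using p(1) by (intro continuous_on_polymonial_function) (simp add: real_polynomial_function_eq)
    have "bounded (p ` X)"
      using pc X(1) by (intro compact_imp_bounded compact_continuous_image) (auto intro: continuous_on_subset)
    then obtain Q where Q: "\<And>x. x \<in> X \<Longrightarrow> \<bar>p x\<bar> \<le> Q" by (auto simp: bounded_real)
    have k: "\<bar>(\<integral>x. f x \<partial>M k) - (\<integral>x. p x \<partial>M k)\<bar> \<le> e * measure (M k) (space (M k))" if k: "k \<in> I" for k
    proof -
      interpret finite_measure "M k" using M(1)[OF k] .
      note [measurable_cong] = M(2)[OF k]
      have [measurable]: "f \<in> borel_measurable borel" "p \<in> borel_measurable borel"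
        using f(1) pc by (auto intro: borel_measurable_continuous_onI)
      have fi: "integrable (M k) f" by (rule integrable_const_bound[of _ B]) (auto simp: f)
      have pi: "integrable (M k) p"
        using AEX[OF k] by (intro integrable_const_bound[of _ Q]) (auto elim!: eventually_mono simp: Q)
      have "\<bar>(\<integral>x. f x \<partial>M k) - (\<integral>x. p x \<partial>M k)\<bar> = \<bar>\<integral>x. f x - p x \<partial>M k\<bar>"
        using fi pi by simp
      also have "\<dots> \<le> (\<integral>x. \<bar>f x - p x\<bar> \<partial>M k)"
        by (rule integral_abs_bound)
      also have "\<dots> \<le> (\<integral>x. e \<partial>M k)"
        using AEX[OF k] fi pi
        by (intro integral_mono_AE) (auto elim!: eventually_mono dest!: p(2))
      also have "\<dots> = e * measure (M k) (space (M k))" by simp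
      finally show ?thesis .
    qed
    have "\<bar>\<Sum>k\<in>I. a k * (\<integral>x. f x \<partial>M k)\<bar>
        = \<bar>(\<Sum>k\<in>I. a k * (\<integral>x. f x \<partial>M k)) - (\<Sum>k\<in>I. a k * (\<integral>x. p x \<partial>M k))\<bar>"
      using poly[OF p(1)] by simp
    also have "\<dots> = \<bar>\<Sum>k\<in>I. a k * ((\<integral>x. f x \<partial>M k) - (\<integral>x. p x \<partial>M k))\<bar>"
      by (simp add: sum_subtractf right_diff_distrib)
    also have "\<dots> \<le> (\<Sum>k\<in>I. \<bar>a k * ((\<integral>x. f x \<partial>M k) - (\<integral>x. p x \<partial>M k))\<bar>)"
      by (rule sum_abs)
    also have "\<dots> \<le> (\<Sum>k\<in>I. \<bar>a k\<bar> * (e * measure (M k) (space (M k))))"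
      by (intro sum_mono) (auto simp: abs_mult intro!: mult_left_mono k)
    also have "\<dots> = e * C"
      by (simp add: C_def sum_distrib_left mult_ac)
    finally show ?thesis .
  qed
  have "\<bar>\<Sum>k\<in>I. a k * (\<integral>x. f x \<partial>M k)\<bar> \<le> 0"
  proof (rule field_le_epsilon)
    fix e :: real assume e: "0 < e"
    have "\<bar>\<Sum>k\<in>I. a k * (\<integral>x. f x \<partial>M k)\<bar> \<le> e / (C + 1) * C"
      by (rule le) (use e C0 in simp)
    also have "\<dots> \<le> 0 + e" using e C0 by (simp add: field_simps)
    finally show "\<bar>\<Sum>k\<in>I. a k * (\<integral>x. f x \<partial>M k)\<bar> \<le> 0 + e" .
  qed
  then show ?thesis by simp
qed

text \<open>The indicator of a closed set is the limit of continuous cutoffs of the distance to it.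
  Closed sets are stable under intersection, and the sets on which the combination vanishes are
  closed under complements and disjoint unions, so they include all Borel sets.\<close>

lemma signed_measures_sets_eq_0:
  fixes M :: "'i \<Rightarrow> 'a::euclidean_space measure" and a :: "'i \<Rightarrow> real"
  assumes M: "\<And>k. k \<in> I \<Longrightarrow> finite_measure (M k)" "\<And>k. k \<in> I \<Longrightarrow> sets (M k) = sets borel"
    and cont: "\<And>f. continuous_on UNIV f \<Longrightarrow> (\<And>x. \<bar>f x\<bar> \<le> 1) \<Longrightarrow> (\<Sum>k\<in>I. a k * (\<integral>x. f x \<partial>M k)) = 0"
    and S: "S \<in> sets borel"
  shows "(\<Sum>k\<in>I. a k * measure (M k) S) = 0"
proof -
  have closed: "(\<Sum>k\<in>I. a k * measure (M k) C) = 0" if C: "closed C" for C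
  proof (cases "C = {}")
    case False
    define f where "f = (\<lambda>n x. max 0 (1 - real n * infdist x C))"
    have fc: "continuous_on UNIV (f n)" for n
      unfolding f_def by (intro continuous_intros)
    have fb: "0 \<le> f n x" "f n x \<le> 1" for n x
      by (auto simp: f_def infdist_nonneg)
    have lim: "(\<lambda>n. f n x) \<longlonglongrightarrow> indicator C x" for x
    proof (cases "x \<in> C")
      case True then show ?thesis by (simp add: f_def)
    next
      case x: False
      then have pos: "0 < infdist x C"
        using in_closed_iff_infdist_zero[OF C False, of x] infdist_nonneg[of x C] by simp
      obtain N where N: "1 / infdist x C < real N" using reals_Archimedean2 by blast
      have "f n x = 0" if "N \<le> n" for n
      proof -
        have "1 < real N * infdist x C" using N pos by (simp add: field_simps)
        also have "\<dots> \<le> real n * infdist x C" using that pos by (intro mult_right_mono) auto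
        finally show ?thesis by (simp add: f_def)
      qed
      then show ?thesis using x
        by (intro tendsto_eventually) (auto simp: eventually_sequentially)
    qed
    have "(\<lambda>n. \<integral>x. f n x \<partial>M k) \<longlonglongrightarrow> measure (M k) C" if k: "k \<in> I" for k
    proof -
      interpret finite_measure "M k" using M(1)[OF k] .
      note [measurable_cong] = M(2)[OF k]
      have [measurable]: "f n \<in> borel_measurable borel" for n
        using fc by (rule borel_measurable_continuous_onI)
      have [measurable]: "C \<in> sets borel" using C by (rule borel_closed)
      have "(\<lambda>n. \<integral>x. f n x \<partial>M k) \<longlonglongrightarrow> (\<integral>x. indicator C x \<partial>M k)"
        using fb lim by (intro integral_dominated_convergence[where w="\<lambda>_. 1"]) auto
      also have "(\<integral>x. indicator C x \<partial>M k) = measure (M k) C"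
        using M(2)[OF k] sets_eq_imp_space_eq[OF M(2)[OF k]] by simp
      finally show ?thesis .
    qed
    then have "(\<lambda>n. \<Sum>k\<in>I. a k * (\<integral>x. f n x \<partial>M k)) \<longlonglongrightarrow> (\<Sum>k\<in>I. a k * measure (M k) C)"
      by (intro tendsto_sum tendsto_mult tendsto_const)
    moreover have "(\<Sum>k\<in>I. a k * (\<integral>x. f n x \<partial>M k)) = 0" for n
      using fb by (intro cont fc) (simp add: abs_le_iff order_trans[of _ 0])
    ultimately show ?thesis using LIMSEQ_unique by (simp add: LIMSEQ_const_iff)
  qed simp
  have S': "S \<in> sigma_sets UNIV (Collect closed)"
    using S by (simp add: borel_eq_closed)
  have sig: "A \<in> sets borel" if "A \<in> sigma_sets UNIV (Collect closed)" for A :: "'a set"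
    using that by (simp add: borel_eq_closed)
  have "Int_stable (Collect closed :: 'a set set)" "Collect closed \<subseteq> Pow (UNIV :: 'a set)"
    by (auto simp: Int_stable_def)
  from this S' show ?thesis
  proof (induction rule: sigma_sets_induct_disjoint)
    case (basic A) then show ?case using closed by simp
  next
    case (compl A)
    have "measure (M k) (UNIV - A) = measure (M k) UNIV - measure (M k) A" if k: "k \<in> I" for k
    proof -
      interpret finite_measure "M k" using M(1)[OF k] .
      have "space (M k) = UNIV" using sets_eq_imp_space_eq[OF M(2)[OF k]] by simp
      then show ?thesis
        using finite_measure_compl[of A] M(2)[OF k] sig[OF compl(1)] by simp
    qed
    then have "(\<Sum>k\<in>I. a k * measure (M k) (UNIV - A))
        = (\<Sum>k\<in>I. a k * measure (M k) UNIV) - (\<Sum>k\<in>I. a k * measure (M k) A)"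
      by (simp add: sum_subtractf right_diff_distrib)
    then show ?case using compl closed[OF closed_UNIV] by simp
  next
    case (union A)
    have "(\<lambda>i. measure (M k) (A i)) sums measure (M k) (\<Union>i. A i)" if k: "k \<in> I" for k
    proof -
      interpret finite_measure "M k" using M(1)[OF k] .
      show ?thesis
        using union(1,2) sig M(2)[OF k] by (intro finite_measure_UNION) auto
    qed
    then have "(\<lambda>i. \<Sum>k\<in>I. a k * measure (M k) (A i)) sums (\<Sum>k\<in>I. a k * measure (M k) (\<Union>i. A i))"
      by (intro sums_sum sums_mult)
    then show ?case using union(3) by (simp add: sums_iff)
  qed auto
qed

text \<open>Induction over nonnegative measurable functions. The upper bound is carried along as an
  implication, so that every function occurring in the induction is integrable for each of the
  measures.\<close>

lemma signed_measures_integral_eq_0: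
  fixes M :: "'i \<Rightarrow> 'a::topological_space measure" and a :: "'i \<Rightarrow> real"
  assumes M: "\<And>k. k \<in> I \<Longrightarrow> finite_measure (M k)" "\<And>k. k \<in> I \<Longrightarrow> sets (M k) = sets borel"
    and S: "\<And>S. S \<in> sets borel \<Longrightarrow> (\<Sum>k\<in>I. a k * measure (M k) S) = 0"
    and f: "f \<in> borel_measurable borel" "\<And>x. \<bar>f x\<bar> \<le> B"
  shows "(\<Sum>k\<in>I. a k * (\<integral>x. f x \<partial>M k)) = 0"
proof -
  have int: "integrable (M k) g"
    if k: "k \<in> I" and g: "g \<in> borel_measurable borel" "\<And>x. \<bar>g x\<bar> \<le> b" for k g and b :: real
  proof -
    interpret finite_measure "M k" using M(1)[OF k] .
    note [measurable_cong] = M(2)[OF k]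
    note [measurable] = g(1)
    show ?thesis by (rule integrable_const_bound[of _ b]) (auto simp: g)
  qed
  have nonneg: "(\<forall>x. g x \<le> b) \<longrightarrow> (\<Sum>k\<in>I. a k * (\<integral>x. g x \<partial>M k)) = 0"
    if "g \<in> borel_measurable borel" "\<And>x. 0 \<le> g x" for g b
    using that
  proof (induction arbitrary: b rule: borel_measurable_induct_real)
    case (set A)
    have "(\<integral>x. indicator A x \<partial>M k) = measure (M k) A" if "k \<in> I" for k
      using M(2)[OF that] sets_eq_imp_space_eq[OF M(2)[OF that]] by simp
    then show ?case using S[OF set] by simp
  next
    case (mult g r)
    show ?case
    \<comment> \<open>For \<open>r = 0\<close> a bound on \<open>r * g\<close> says nothing about
      \<open>g\<close>, and the induction hypothesis cannot be applied.\<close>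
    proof (cases "r = 0")
      case False
      show ?thesis
      proof
        assume le: "\<forall>x. r * g x \<le> b"
        then have "\<forall>x. g x \<le> b / r"
          using False mult(1) by (simp add: pos_le_divide_eq mult.commute)
        then have "(\<Sum>k\<in>I. a k * (\<integral>x. g x \<partial>M k)) = 0" using mult.IH by blast
        then have "r * (\<Sum>k\<in>I. a k * (\<integral>x. g x \<partial>M k)) = 0" by simp
        then show "(\<Sum>k\<in>I. a k * (\<integral>x. r * g x \<partial>M k)) = 0"
          by (simp add: sum_distrib_left mult_ac)
      qed
    qed simp
  next
    case (add g h)
    show ?case
    proof
      assume le: "\<forall>x. h x + g x \<le> b"
      have gb: "g x \<le> b" and hb: "h x \<le> b" for x
        using spec[OF le, of x] add.hyps(2)[of x] add.hyps(4)[of x] by linarith+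
      have "(\<integral>x. h x + g x \<partial>M k) = (\<integral>x. h x \<partial>M k) + (\<integral>x. g x \<partial>M k)" if "k \<in> I" for k
        using add gb hb by (intro Bochner_Integration.integral_add int[OF that, where b=b]) auto
      then have "(\<Sum>k\<in>I. a k * (\<integral>x. h x + g x \<partial>M k))
          = (\<Sum>k\<in>I. a k * (\<integral>x. h x \<partial>M k)) + (\<Sum>k\<in>I. a k * (\<integral>x. g x \<partial>M k))"
        by (simp add: distrib_left sum.distrib)
      then show "(\<Sum>k\<in>I. a k * (\<integral>x. h x + g x \<partial>M k)) = 0"
        using add.IH gb hb by fastforce
    qed
  next
    case (seq U)
    show ?case
    proof
      assume le: "\<forall>x. g x \<le> b"
      have lim: "(\<lambda>i. U i x) \<longlonglongrightarrow> g x" for x using seq.hyps(4)[of x] by simp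
      have Ule: "U i x \<le> b" for i x
      proof -
        have "incseq (\<lambda>i. U i x)" using seq.hyps(3) by (auto simp: incseq_def le_fun_def)
        then have "U i x \<le> g x" using lim by (rule incseq_le)
        then show ?thesis using le by (meson order_trans)
      qed
      have "(\<lambda>i. \<integral>x. U i x \<partial>M k) \<longlonglongrightarrow> (\<integral>x. g x \<partial>M k)" if k: "k \<in> I" for k
      proof -
        interpret finite_measure "M k" using M(1)[OF k] .
        note [measurable_cong] = M(2)[OF k]
        note [measurable] = seq.hyps(1)
        have [measurable]: "g \<in> borel_measurable borel"
          using lim by (rule borel_measurable_LIMSEQ_real) measurable
        show ?thesis
          using seq.hyps(2) Ule lim by (intro integral_dominated_convergence[where w="\<lambda>_. b"]) auto
      qed
      then have "(\<lambda>i. \<Sum>k\<in>I. a k * (\<integral>x. U i x \<partial>M k)) \<longlonglongrightarrow> (\<Sum>k\<in>I. a k * (\<integral>x. g x \<partial>M k))"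
        by (intro tendsto_sum tendsto_mult tendsto_const)
      moreover have "(\<Sum>k\<in>I. a k * (\<integral>x. U i x \<partial>M k)) = 0" for i
        using seq.IH Ule by blast
      ultimately show "(\<Sum>k\<in>I. a k * (\<integral>x. g x \<partial>M k)) = 0" by (simp add: LIMSEQ_const_iff)
    qed
  qed
  \<comment> \<open>Adding the constant \<open>B\<close> makes \<open>f\<close> nonnegative; the
    constant itself integrates to 0 against the combination.\<close>
  have "(\<Sum>k\<in>I. a k * (\<integral>x. f x + B \<partial>M k)) = 0"
  proof (rule nonneg[of "\<lambda>x. f x + B" "2 * B", THEN mp])
    show "(\<lambda>x. f x + B) \<in> borel_measurable borel" using f(1) by measurable
    show "0 \<le> f x + B" for x using f(2)[of x] by linarith
    show "\<forall>x. f x + B \<le> 2 * B"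
    proof
      fix x show "f x + B \<le> 2 * B" using f(2)[of x] by linarith
    qed
  qed
  moreover have "(\<Sum>k\<in>I. a k * (\<integral>x. B \<partial>M k)) = 0"
  proof -
    have sp: "space (M k) = UNIV" if "k \<in> I" for k
      using sets_eq_imp_space_eq[OF M(2)[OF that]] by simp
    have "(\<Sum>k\<in>I. a k * (\<integral>x. B \<partial>M k)) = (\<Sum>k\<in>I. B * (a k * measure (M k) UNIV))"
      by (intro sum.cong refl) (simp add: sp)
    also have "\<dots> = 0"
      using S[of UNIV] by (simp flip: sum_distrib_left)
    finally show ?thesis .
  qed
  moreover have "(\<integral>x. f x + B \<partial>M k) = (\<integral>x. f x \<partial>M k) + (\<integral>x. B \<partial>M k)" if k: "k \<in> I" for k
    using f by (intro Bochner_Integration.integral_add int[OF k, where b="\<bar>B\<bar>"])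
      (auto intro: order_trans[OF _ abs_ge_self])
  ultimately show ?thesis by (simp add: distrib_left sum.distrib)
qed

text \<open>Continuity in \<open>x\<close> for each fixed direction is what the fundamental theorem
  on lines and integrability over the body require.\<close>

lemma real_polynomial_function_derivative:
  fixes p :: "'a::euclidean_space \<Rightarrow> real"
  assumes "real_polynomial_function p"
  shows "\<exists>D. (\<forall>x. (p has_derivative D x) (at x)) \<and> (\<forall>v. continuous_on UNIV (\<lambda>x. D x v))"
  using assms
proof induction
  case (linear f)
  then show ?case
    by (intro exI[of _ "\<lambda>_. f"]) (auto intro: bounded_linear_imp_has_derivative)
next
  case (const c)
  then show ?case by (intro exI[of _ "\<lambda>_ _. 0"]) auto
next
  case (add f g)
  then obtain D E where D: "\<And>x. (f has_derivative D x) (at x)" "\<And>v. continuous_on UNIV (\<lambda>x. D x v)"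
    and E: "\<And>x. (g has_derivative E x) (at x)" "\<And>v. continuous_on UNIV (\<lambda>x. E x v)" by blast
  show ?case
    by (intro exI[of _ "\<lambda>x v. D x v + E x v"] conjI allI has_derivative_add continuous_on_add D E)
next
  case (mult f g)
  then obtain D E where D: "\<And>x. (f has_derivative D x) (at x)" "\<And>v. continuous_on UNIV (\<lambda>x. D x v)"
    and E: "\<And>x. (g has_derivative E x) (at x)" "\<And>v. continuous_on UNIV (\<lambda>x. E x v)" by blast
  have c: "continuous_on UNIV f" "continuous_on UNIV g"
    using has_derivative_continuous[OF D(1)] has_derivative_continuous[OF E(1)]
    by (auto simp: continuous_on_eq_continuous_at)
  show ?case
    by (intro exI[of _ "\<lambda>x v. f x * E x v + D x v * g x"] conjI allI has_derivative_mult
        continuous_on_add continuous_on_mult c D E)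
qed

section \<open>The divergence theorem on a convex body\<close>

text \<open>Fubini along lines as an identity of measures, from which the formula for integrable
  functions with signs follows.\<close>

lemma lines_distr:
  fixes u :: "'a::euclidean_space"
  assumes u: "norm u = 1"
  shows "distr (density lborel (indicator (slab u)) \<Otimes>\<^sub>M lborel) borel (\<lambda>(x, s). x + s *\<^sub>R u) = lborel"
proof (rule measure_eqI)
  let ?N = "density lborel (indicator (slab u) :: 'a \<Rightarrow> ennreal)"
  fix A assume "A \<in> sets (distr (?N \<Otimes>\<^sub>M lborel) borel (\<lambda>(x, s). x + s *\<^sub>R u))"
  then have A[measurable]: "A \<in> sets borel" by simp
  let ?D = "distr (?N \<Otimes>\<^sub>M lborel) borel (\<lambda>(x, s). x + s *\<^sub>R u)"
  have "emeasure ?D A = (\<integral>\<^sup>+x. indicator A x \<partial>?D)" by simp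
  also have "\<dots> = (\<integral>\<^sup>+p. indicator A (fst p + snd p *\<^sub>R u) \<partial>(?N \<Otimes>\<^sub>M lborel))"
    by (subst nn_integral_distr) (auto simp: split_beta)
  also have "\<dots> = (\<integral>\<^sup>+x. \<integral>\<^sup>+s. indicator A (x + s *\<^sub>R u) \<partial>lborel \<partial>?N)"
    by (subst lborel.nn_integral_fst[symmetric]) auto
  also have "\<dots> = (\<integral>\<^sup>+x. indicator (slab u) x * (\<integral>\<^sup>+s. indicator A (x + s *\<^sub>R u) \<partial>lborel) \<partial>lborel)"
    by (subst nn_integral_density) auto
  also have "\<dots> = emeasure lborel A"
    using nn_integral_lborel_lines[of "indicator A" u] u by simp
  finally show "emeasure ?D A = emeasure lborel A" .
qed simp

lemma integral_lborel_lines: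
  fixes u :: "'a::euclidean_space" and f :: "'a \<Rightarrow> real"
  assumes u: "norm u = 1" and f: "integrable lborel f"
  shows "(\<integral>x. f x \<partial>lborel) = (\<integral>x. indicator (slab u) x * (\<integral>s. f (x + s *\<^sub>R u) \<partial>lborel) \<partial>lborel)"
proof -
  let ?N = "density lborel (indicator (slab u) :: 'a \<Rightarrow> ennreal)"
  have [measurable]: "f \<in> borel_measurable borel"
    using borel_measurable_integrable[OF f] by simp
  have N: "?N = density lborel (\<lambda>x. ennreal (indicator (slab u) x))"
    by (intro arg_cong2[where f=density] refl ext) (simp add: ennreal_indicator)
  have "sigma_finite_measure ?N"
    by (subst sigma_finite_measure.sigma_finite_iff_density_finite[OF sigma_finite_lborel])
       (auto intro!: AE_I2 split: split_indicator)
  then interpret N: sigma_finite_measure ?N .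
  interpret pair_sigma_finite ?N "lborel :: real measure" ..
  let ?D = "distr (?N \<Otimes>\<^sub>M lborel) borel (\<lambda>(x, s). x + s *\<^sub>R u)"
  have "integrable ?D f" using f by (simp add: lines_distr[OF u])
  then have int: "integrable (?N \<Otimes>\<^sub>M lborel) (\<lambda>(x, s). f (x + s *\<^sub>R u))"
    by (subst (asm) integrable_distr_eq) (auto simp: case_prod_unfold)
  have "(\<integral>x. f x \<partial>lborel) = (\<integral>x. f x \<partial>?D)" by (simp add: lines_distr[OF u])
  also have "\<dots> = (\<integral>p. (case p of (x, s) \<Rightarrow> f (x + s *\<^sub>R u)) \<partial>(?N \<Otimes>\<^sub>M lborel))"
    by (subst integral_distr) (auto simp: case_prod_unfold)
  also have "\<dots> = (\<integral>x. \<integral>s. f (x + s *\<^sub>R u) \<partial>lborel \<partial>?N)"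
    using integral_fst[OF int] by simp
  also have "\<dots> = (\<integral>x. indicator (slab u) x * (\<integral>s. f (x + s *\<^sub>R u) \<partial>lborel) \<partial>lborel)"
    unfolding N by (subst integral_density) auto
  finally show ?thesis .
qed

context solid begin

lemma integrable_indicator_mult:
  fixes g :: "'a \<Rightarrow> real"
  assumes "continuous_on UNIV g"
  shows "integrable lborel (\<lambda>x. indicator L x * g x)"
proof -
  have "continuous_on L g"
    using assms by (rule continuous_on_subset) simp
  from borel_integrable_compact[OF compact this] show ?thesis by simp
qed

end

context solid_dir begin

lemma integrable_top_measure:
  fixes f :: "'a \<Rightarrow> real"
  assumes f: "continuous_on UNIV f"
  shows "integrable lborel (\<lambda>x. indicator (slab u \<inter> line_dom L u) x * f (top_point L u x))"
proof -
  have [measurable]: "f \<in> borel_measurable borel"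
    using f by (rule borel_measurable_continuous_onI)
  have "bounded (f ` L)"
    using f compact by (intro compact_imp_bounded compact_continuous_image) (auto intro: continuous_on_subset)
  then obtain Q where Q: "\<And>x. x \<in> L \<Longrightarrow> \<bar>f x\<bar> \<le> Q" by (auto simp: bounded_real)
  show ?thesis
  proof (rule Bochner_Integration.integrable_bound)
    show "integrable lborel (\<lambda>x. indicator (slab u \<inter> line_dom L u) x * Q)"
      using emeasure_slab_dom_finite by (intro integrable_mult_left integrable_real_indicator) auto
    show "AE x in lborel. norm (indicator (slab u \<inter> line_dom L u) x * f (top_point L u x))
        \<le> norm (indicator (slab u \<inter> line_dom L u) x * Q)"
      using Q top_point_in
      by (intro AE_I2) (auto split: split_indicator intro: order_trans[OF _ abs_ge_self])
  qed measurable
qed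

text \<open>The divergence theorem for \<open>p u\<close>, by the fundamental theorem of calculus on the lines
  in direction \<open>u\<close>.\<close>

lemma divergence_top_measure:
  fixes p :: "'a \<Rightarrow> real"
  assumes p: "\<And>x. (p has_derivative D x) (at x)" and D: "continuous_on UNIV (\<lambda>x. D x u)"
  shows "(\<integral>x. p x \<partial>top_measure L u) - (\<integral>x. p x \<partial>top_measure L (- u))
    = (\<integral>x. indicator L x * D x u \<partial>lborel)"
proof -
  interpret m: solid_dir L "- u" by (rule solid_dir_minus)
  have pc: "continuous_on UNIV p"
    using has_derivative_continuous[OF p] by (auto simp: continuous_on_eq_continuous_at)
  have [measurable]: "p \<in> borel_measurable borel"
    using pc by (rule borel_measurable_continuous_onI)
  have line: "(\<integral>s. indicator L (x + s *\<^sub>R u) * D (x + s *\<^sub>R u) u \<partial>lborel)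
      = indicator (line_dom L u) x * (p (top_point L u x) - p (top_point L (- u) x))" for x
  proof (cases "x \<in> line_dom L u")
    case True
    let ?a = "- height L (- u) x" and ?b = "height L u x"
    have "(\<integral>s. indicator L (x + s *\<^sub>R u) * D (x + s *\<^sub>R u) u \<partial>lborel)
        = (\<integral>s. D (x + s *\<^sub>R u) u * indicator {?a..?b} s \<partial>lborel)"
      by (intro Bochner_Integration.integral_cong refl)
         (auto simp: indicator_def in_section_iff[OF True])
    also have "\<dots> = p (x + ?b *\<^sub>R u) - p (x + ?a *\<^sub>R u)"
    proof (rule integral_FTC_Icc_real[OF heights_le[OF True]])
      fix s
      have "((\<lambda>s. p (x + s *\<^sub>R u)) has_derivative (\<lambda>r. D (x + s *\<^sub>R u) (r *\<^sub>R u))) (at s)"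
        by (rule has_derivative_compose[OF _ p, of "\<lambda>s. x + s *\<^sub>R u"]) (auto intro!: derivative_eq_intros)
      moreover have "D (x + s *\<^sub>R u) (r *\<^sub>R u) = D (x + s *\<^sub>R u) u * r" for r
        using linear_scale[OF has_derivative_linear[OF p]] by simp
      ultimately show "((\<lambda>s. p (x + s *\<^sub>R u)) has_real_derivative D (x + s *\<^sub>R u) u) (at s)"
        by (simp add: has_field_derivative_def)
      show "isCont (\<lambda>s. D (x + s *\<^sub>R u) u) s"
      proof -
        have "continuous_on UNIV (\<lambda>s. D (x + s *\<^sub>R u) u)"
          by (rule continuous_on_compose2[OF D]) (auto intro!: continuous_intros)
        then show ?thesis by (simp add: continuous_on_eq_continuous_at)
      qed
    qed
    finally show ?thesis using True by (simp add: top_point_def)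
  next
    case False
    then show ?thesis by (auto simp: line_dom_def)
  qed
  have "(\<integral>x. indicator L x * D x u \<partial>lborel)
      = (\<integral>x. indicator (slab u) x * (\<integral>s. indicator L (x + s *\<^sub>R u) * D (x + s *\<^sub>R u) u \<partial>lborel) \<partial>lborel)"
    by (rule integral_lborel_lines[OF u integrable_indicator_mult[OF D]])
  also have "\<dots> = (\<integral>x. indicator (slab u \<inter> line_dom L u) x * p (top_point L u x)
      - indicator (slab u \<inter> line_dom L u) x * p (top_point L (- u) x) \<partial>lborel)"
    unfolding line
    by (intro Bochner_Integration.integral_cong refl) (auto split: split_indicator)
  also have "\<dots> = (\<integral>x. p x \<partial>top_measure L u) - (\<integral>x. p x \<partial>top_measure L (- u))"
    using integrable_top_measure[OF pc] m.integrable_top_measure[OF pc]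
    by (simp add: integral_top_measure m.integral_top_measure)
  finally show ?thesis ..
qed

end

context solid begin

text \<open>For polynomials the divergence formula reduces the claim to linearity of the derivative
  in its direction. Moving everything to one side gives a signed family of measures carried by the
  compact frontier that annihilates polynomials, hence also Borel sets.\<close>

lemma top_measure_linear:
  assumes u: "norm u = 1" and S: "S \<in> sets borel"
  shows "measure (top_measure L u) S - measure (top_measure L (- u)) S
    = (\<Sum>i\<in>Basis. (u \<bullet> i) * (measure (top_measure L i) S - measure (top_measure L (- i)) S))"
proof -
  \<comment> \<open>The disjoint sum keeps \<open>u\<close> apart from the basis vectors, one of
    which it may equal; the Boolean selects the direction or its opposite.\<close>
  define I where "I = (UNIV :: bool set) \<times> ({u} <+> (Basis :: 'a set))"
  define v :: "'a + 'a \<Rightarrow> 'a" where "v = case_sum id id"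
  define M where "M = (\<lambda>(b, k). top_measure L (if b then v k else - v k))"
  define a :: "bool \<times> ('a + 'a) \<Rightarrow> real" where "a = (\<lambda>(b, k). (if b then 1 else - 1) * (case k of Inl _ \<Rightarrow> - 1 | Inr i \<Rightarrow> u \<bullet> i))"
  have expand: "(\<Sum>k\<in>I. a k * F (M k))
      = (\<Sum>i\<in>Basis. (u \<bullet> i) * (F (top_measure L i) - F (top_measure L (- i))))
        - (F (top_measure L u) - F (top_measure L (- u)))" for F :: "'a measure \<Rightarrow> real"
    unfolding I_def sum.cartesian_product'
    by (simp add: UNIV_bool sum.Plus a_def M_def v_def sum_subtractf sum_negf right_diff_distrib)
  have nv: "norm (if fst k then v (snd k) else - v (snd k)) = 1" if "k \<in> I" for k
    using that u by (auto simp: I_def v_def)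
  have dir: "solid_dir L (if fst k then v (snd k) else - v (snd k))" if "k \<in> I" for k
    by unfold_locales (rule nv[OF that])
  have M: "finite_measure (M k)" "sets (M k) = sets borel" "emeasure (M k) (- frontier L) = 0" if "k \<in> I" for k
    using solid_dir.finite_top_measure[OF dir[OF that]] solid_dir.top_measure_outside[OF dir[OF that]]
    by (simp_all add: M_def split_beta)
  have "(\<Sum>k\<in>I. a k * measure (M k) S) = 0"
  proof (rule signed_measures_sets_eq_0[OF M(1,2) _ S])
    fix f :: "'a \<Rightarrow> real" assume f: "continuous_on UNIV f" "\<And>x. \<bar>f x\<bar> \<le> 1"
    show "(\<Sum>k\<in>I. a k * (\<integral>x. f x \<partial>M k)) = 0"
    proof (rule signed_measures_continuous_eq_0[OF M(1,2) compact_frontier[OF compact] M(3) _ f])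
      fix p :: "'a \<Rightarrow> real" assume "real_polynomial_function p"
      then obtain D where D: "\<And>x. (p has_derivative D x) (at x)" "\<And>v. continuous_on UNIV (\<lambda>x. D x v)"
        using real_polynomial_function_derivative by blast
      have dv: "(\<integral>x. p x \<partial>top_measure L w) - (\<integral>x. p x \<partial>top_measure L (- w)) = (\<integral>x. indicator L x * D x w \<partial>lborel)"
        if "norm w = 1" for w
      proof -
        interpret solid_dir L w by unfold_locales (rule that)
        show ?thesis by (rule divergence_top_measure[OF D])
      qed
      have "D x u = (\<Sum>i\<in>Basis. (u \<bullet> i) * D x i)" for x
      proof -
        have lin: "linear (D x)" using D(1) by (rule has_derivative_linear)
        have "D x u = D x (\<Sum>i\<in>Basis. (u \<bullet> i) *\<^sub>R i)" by (simp add: euclidean_representation)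
        then show ?thesis by (simp add: linear_sum[OF lin] linear_scale[OF lin])
      qed
      then have "(\<integral>x. indicator L x * D x u \<partial>lborel)
          = (\<integral>x. (\<Sum>i\<in>Basis. (u \<bullet> i) * (indicator L x * D x i)) \<partial>lborel)"
        by (simp add: sum_distrib_left mult_ac)
      also have "\<dots> = (\<Sum>i\<in>Basis. (u \<bullet> i) * (\<integral>x. indicator L x * D x i \<partial>lborel))"
        using integrable_indicator_mult[OF D(2)] by (subst Bochner_Integration.integral_sum) auto
      finally show "(\<Sum>k\<in>I. a k * (\<integral>x. p x \<partial>M k)) = 0"
        unfolding expand[of "\<lambda>M. \<integral>x. p x \<partial>M"] using u by (simp add: dv)
    qed
  qed
  then show ?thesis
    unfolding expand[of "\<lambda>M. measure M S"] by simp
qed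

end

section \<open>The surface measure in terms of normals\<close>

lemma borel_measurableI_closed:
  fixes f :: "'a::topological_space \<Rightarrow> 'b::topological_space"
  assumes "\<And>C. closed C \<Longrightarrow> f -` C \<in> sets borel"
  shows "f \<in> borel_measurable borel"
proof (rule borel_measurableI)
  fix S :: "'b set" assume "open S"
  then have "- (f -` (- S)) \<in> sets borel"
    using assms[of "- S"] by (auto simp: closed_def)
  then show "f -` S \<inter> space borel \<in> sets borel"
    by (simp add: vimage_Compl)
qed

context solid begin

text \<open>Cut off outside the frontier, because a point outside \<open>L\<close> also has unit
  vectors that satisfy the inequalities of \<open>outer_unit_normals\<close>. The cutoff bounds the
  field by the indicator of the frontier and so makes it integrable.\<close>

definition normal_field :: "'a \<Rightarrow> 'a" where
  "normal_field x = (if x \<in> frontier L then outer_unit_normal L x else 0)"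

definition multiple_normals :: "'a set" where
  "multiple_normals = {x \<in> frontier L. \<not> (\<exists>!n. n \<in> outer_unit_normals L x)}"

lemma normal_field_eq:
  assumes "x \<in> L" "x \<notin> multiple_normals" "n \<in> outer_unit_normals L x"
  shows "normal_field x = n"
proof -
  have x: "x \<in> frontier L" using assms normal_imp_frontier by blast
  then have "\<exists>!n. n \<in> outer_unit_normals L x" using assms by (simp add: multiple_normals_def)
  then show ?thesis
    using x assms(3) by (auto simp: normal_field_def outer_unit_normal_def intro: the1_equality)
qed

lemma normal_field_zero: "x \<in> multiple_normals \<or> x \<notin> frontier L \<Longrightarrow> normal_field x = 0"
  by (auto simp: normal_field_def multiple_normals_def outer_unit_normal_def)

lemma norm_normal_field: "norm (normal_field x) \<le> indicator (frontier L) x"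
proof (cases "x \<in> multiple_normals \<or> x \<notin> frontier L")
  case True
  then show ?thesis by (simp add: normal_field_zero)
next
  case False
  then obtain n where n: "n \<in> outer_unit_normals L x"
    using outer_unit_normals_nonempty by blast
  then have "normal_field x = n"
    using False frontier_subset by (intro normal_field_eq) auto
  then show ?thesis using n False by (simp add: outer_unit_normals_def)
qed

text \<open>At a point with a unique normal, the field lies in \<open>C\<close> exactly if some
  normal does, and that is a compact condition. All other points carry the value 0.\<close>

lemma normal_field_measurable:
  assumes B: "multiple_normals \<in> sets borel"
  shows "normal_field \<in> borel_measurable borel"
proof (rule borel_measurableI_closed)
  fix C :: "'a set" assume C: "closed C"
  let ?A = "{x \<in> L. outer_unit_normals L x \<inter> C \<noteq> {}}"
  have "x \<in> normal_field -` C \<longleftrightarrow>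
      x \<in> (?A - multiple_normals) \<union> (if 0 \<in> C then (- frontier L) \<union> multiple_normals else {})" for x
  proof (cases "x \<in> multiple_normals \<or> x \<notin> frontier L")
    case True
    then show ?thesis using normal_imp_frontier by (auto simp: normal_field_zero)
  next
    case False
    then have un: "\<exists>!n. n \<in> outer_unit_normals L x" and x: "x \<in> L"
      using frontier_subset by (auto simp: multiple_normals_def)
    then obtain n where n: "n \<in> outer_unit_normals L x" by blast
    then have "normal_field x = n" using False x by (intro normal_field_eq) auto
    moreover have "outer_unit_normals L x = {n}" using un n by blast
    ultimately show ?thesis using False x by auto
  qed
  then have "normal_field -` C = (?A - multiple_normals) \<union> (if 0 \<in> C then (- frontier L) \<union> multiple_normals else {})"
    by blast
  moreover have "?A \<in> sets borel"
    using normals_meet_compact[OF C] by (intro borel_closed compact_imp_closed)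
  moreover have "- frontier L \<in> sets borel"
    by (intro borel_open open_Compl frontier_closed)
  ultimately show "normal_field -` C \<in> sets borel"
    using B by auto
qed

section \<open>The flux through boundary pieces as a vector measure\<close>

definition flux :: "'a set \<Rightarrow> 'a" where
  "flux S = (\<Sum>i\<in>Basis. (measure (top_measure L i) S - measure (top_measure L (- i)) S) *\<^sub>R i)"

lemma flux_inner:
  assumes "norm u = 1" "S \<in> sets borel"
  shows "flux S \<bullet> u = measure (top_measure L u) S - measure (top_measure L (- u)) S"
  unfolding top_measure_linear[OF assms] flux_def inner_sum_left
  by (intro sum.cong refl) (simp add: inner_commute[of u] mult.commute)

lemma flux_Un:
  assumes "A \<in> sets borel" "B \<in> sets borel" "A \<inter> B = {}"
  shows "flux (A \<union> B) = flux A + flux B"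
proof -
  have add: "measure (top_measure L u) (A \<union> B) = measure (top_measure L u) A + measure (top_measure L u) B"
    if "norm u = 1" for u
  proof -
    interpret d: solid_dir L u by unfold_locales fact
    interpret finite_measure "top_measure L u" by (rule d.finite_top_measure)
    show ?thesis using assms by (intro finite_measure_Union) auto
  qed
  show ?thesis
    unfolding flux_def sum.distrib[symmetric]
    by (intro sum.cong refl) (simp add: add algebra_simps)
qed

end

text \<open>If a vector has norm at most \<open>h\<close> and inner product at least
  \<open>q * h\<close> with the unit vector \<open>u\<close>, then its squared distance from
  \<open>h *\<^sub>R u\<close> is at most \<open>2 * (1 - q) * h\<^sup>2\<close>. Here
  \<open>q\<close> is the factor by which projection can shrink the area of a cap.\<close>

definition cap_error :: "nat \<Rightarrow> real \<Rightarrow> real" where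
  "cap_error d e = sqrt (2 * (1 - sqrt (1 - e\<^sup>2) ^ d))"

lemma cap_error_radicand:
  assumes "0 < e" "e < 1"
  shows "sqrt (1 - e\<^sup>2) ^ d \<le> 1"
proof -
  have "0 \<le> 1 - e\<^sup>2" using assms by (simp add: power_le_one)
  then show ?thesis by (intro power_le_one) (auto simp: real_sqrt_le_1_iff)
qed

lemma cap_error_nonneg: "0 < e \<Longrightarrow> e < 1 \<Longrightarrow> 0 \<le> cap_error d e"
  using cap_error_radicand[of e d] by (simp add: cap_error_def)

text \<open>The sum is the total error on a cap: \<open>cap_error\<close> for the flux, and
  \<open>e\<close> for replacing the normal by \<open>u\<close>. It is continuous and vanishes at
  0.\<close>

lemma cap_error_small:
  assumes "0 < \<delta>"
  obtains e where "0 < e" "e < 1" "cap_error d e + e < \<delta>"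
proof -
  have "isCont (\<lambda>e. cap_error d e + e) 0"
    unfolding cap_error_def by (intro continuous_intros)
  then have "((\<lambda>e. cap_error d e + e) \<longlongrightarrow> 0) (at 0)"
    by (simp add: isCont_def cap_error_def)
  then have "((\<lambda>e. cap_error d e + e) \<longlongrightarrow> 0) (at_right 0)"
    by (rule tendsto_within_subset) simp
  then have "\<forall>\<^sub>F e in at_right 0. cap_error d e + e < \<delta>"
    using \<open>0 < \<delta>\<close> by (rule order_tendstoD)
  moreover have "\<forall>\<^sub>F e::real in at_right 0. 0 < e \<and> e < 1"
    using eventually_at_right_real[of 0 "1::real"] by (auto elim!: eventually_mono)
  ultimately have "\<forall>\<^sub>F e in at_right 0. 0 < e \<and> e < 1 \<and> cap_error d e + e < \<delta>"
    by eventually_elim auto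
  then obtain e where "0 < e \<and> e < 1 \<and> cap_error d e + e < \<delta>"
    using eventually_happens'[of "at_right (0::real)"] by fastforce
  then show thesis using that by blast
qed

context solid_area begin

abbreviation area :: "(real^'n) set \<Rightarrow> real" where
  "area S \<equiv> measure surface_measure S"

lemma area_emeasure:
  assumes "S \<in> sets borel" "S \<subseteq> frontier L"
  shows "emeasure surface_measure S = ennreal (area S)" "hausdorff_outer (CARD('n) - 1) S = ennreal (area S)"
proof -
  have eq: "emeasure surface_measure S = hausdorff_outer (CARD('n) - 1) S"
    using assms(1) by (rule emeasure_hausdorff_measure)
  also have "\<dots> < \<infinity>"
    using hausdorff_outer_mono[OF assms(2)] hausdorff_frontier_finite le_less_trans by blast
  finally show 1: "emeasure surface_measure S = ennreal (area S)"
    by (intro emeasure_eq_ennreal_measure) auto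
  then show "hausdorff_outer (CARD('n) - 1) S = ennreal (area S)"
    using eq by simp
qed

lemma area_top_measure:
  assumes u: "norm u = 1" and S: "S \<in> sets borel" "S \<subseteq> frontier L"
  shows "c * measure (top_measure L u) S \<le> area S"
    and "\<And>e. 0 < e \<Longrightarrow> e < 1 \<Longrightarrow> S \<subseteq> normal_cap L u e \<Longrightarrow>
      sqrt (1 - e\<^sup>2) ^ (CARD('n) - 1) * area S \<le> c * measure (top_measure L u) S"
proof -
  interpret d: solid_dir L u by unfold_locales fact
  interpret finite_measure "top_measure L u" by (rule d.finite_top_measure)
  have eq: "ennreal c * emeasure (top_measure L u) S = ennreal (c * measure (top_measure L u) S)"
    using c0 by (simp add: emeasure_eq_measure ennreal_mult)
  show "c * measure (top_measure L u) S \<le> area S"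
    using top_measure_le_hausdorff[OF u S(1)] unfolding eq area_emeasure(2)[OF S]
    by (simp add: ennreal_le_iff)
  fix e :: real assume e: "0 < e" "e < 1" and cap: "S \<subseteq> normal_cap L u e"
  have q: "0 \<le> sqrt (1 - e\<^sup>2) ^ (CARD('n) - 1)"
    using e by (simp add: power_le_one)
  have "ennreal (sqrt (1 - e\<^sup>2) ^ (CARD('n) - 1) * area S) \<le> ennreal (c * measure (top_measure L u) S)"
    using hausdorff_cap_le_top_measure[OF u S(1) cap e] q unfolding eq area_emeasure(2)[OF S]
    by (simp add: ennreal_mult)
  then show "sqrt (1 - e\<^sup>2) ^ (CARD('n) - 1) * area S \<le> c * measure (top_measure L u) S"
    using c0 by (subst (asm) ennreal_le_iff) auto
qed

text \<open>Testing the flux against its own direction reduces the norm to a single upper-end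
  measure, which surface area dominates.\<close>

lemma norm_flux_le:
  assumes S: "S \<in> sets borel" "S \<subseteq> frontier L"
  shows "norm (c *\<^sub>R flux S) \<le> area S"
proof (cases "flux S = 0")
  case False
  define v where "v = flux S /\<^sub>R norm (flux S)"
  have v: "norm v = 1" using False by (simp add: v_def)
  have "flux S \<bullet> v = norm (flux S)"
    using False by (simp add: v_def dot_square_norm power2_eq_square)
  then have "norm (flux S) \<le> measure (top_measure L v) S"
    using flux_inner[OF v S(1)] measure_nonneg[of "top_measure L (- v)" S] by linarith
  then have "c * norm (flux S) \<le> c * measure (top_measure L v) S"
    using c0 by simp
  then show ?thesis
    using area_top_measure(1)[OF v S] c0 by (simp add: order_trans[of _ "c * measure (top_measure L v) S"])
qed simp

text \<open>The vector \<open>c *\<^sub>R flux S\<close> has norm at most \<open>area S\<close>, and its component along \<open>u\<close> almost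
  attains this bound, so it is close to \<open>area S *\<^sub>R u\<close>.\<close>

lemma flux_cap:
  assumes u: "norm u = 1" and S: "S \<in> sets borel" and cap: "S \<subseteq> normal_cap L u e" and e: "0 < e" "e < 1"
  shows "norm (c *\<^sub>R flux S - area S *\<^sub>R u) \<le> cap_error (CARD('n) - 1) e * area S"
proof (rule power2_le_imp_le)
  let ?q = "sqrt (1 - e\<^sup>2) ^ (CARD('n) - 1)" and ?h = "area S"
  have SF: "S \<subseteq> frontier L" using cap normal_cap_frontier by blast
  have "measure (top_measure L (- u)) S = 0"
    using solid_dir.top_measure_opposite_cap[of L u S e] S cap e u
    by (simp add: measure_def solid_dir_def solid_dir_axioms_def solid_axioms)
  then have "?q * ?h \<le> c * (flux S \<bullet> u)"
    using area_top_measure(2)[OF u S SF e cap] flux_inner[OF u S] by simp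
  then have inner: "?h * (?q * ?h) \<le> ?h * (c * (flux S \<bullet> u))"
    by (intro mult_left_mono) auto
  have n: "(norm (c *\<^sub>R flux S))\<^sup>2 \<le> ?h\<^sup>2"
    by (intro power_mono norm_flux_le S SF) simp
  have uu: "u \<bullet> u = 1" using u by (simp add: dot_square_norm)
  have "(norm (c *\<^sub>R flux S - ?h *\<^sub>R u))\<^sup>2 = (norm (c *\<^sub>R flux S))\<^sup>2 + ?h\<^sup>2 - 2 * (?h * (c * (flux S \<bullet> u)))"
    unfolding power2_norm_eq_inner
    by (simp add: inner_diff_left inner_diff_right uu inner_commute power2_eq_square algebra_simps)
  also have "\<dots> \<le> 2 * (1 - ?q) * ?h\<^sup>2"
    using n inner by (simp add: power2_eq_square algebra_simps)
  also have "\<dots> = (cap_error (CARD('n) - 1) e * ?h)\<^sup>2"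
    using cap_error_radicand[OF e, of "CARD('n) - 1"] by (simp add: cap_error_def power_mult_distrib)
  finally show "(norm (c *\<^sub>R flux S - ?h *\<^sub>R u))\<^sup>2 \<le> (cap_error (CARD('n) - 1) e * ?h)\<^sup>2" .
  show "0 \<le> cap_error (CARD('n) - 1) e * ?h" using cap_error_nonneg[OF e] by simp
qed

text \<open>The flux through the common part is close to its area times \<open>u\<close> and also to
  its area times \<open>v\<close>. If \<open>u\<close> and \<open>v\<close> are far apart, the area
  must vanish.\<close>

lemma caps_meet_null:
  assumes u: "norm u = 1" and v: "norm v = 1" and e: "0 < e" "e < 1"
    and far: "2 * cap_error (CARD('n) - 1) e < norm (u - v)"
  shows "normal_cap L u e \<inter> normal_cap L v e \<in> null_sets surface_measure"
proof -
  let ?S = "normal_cap L u e \<inter> normal_cap L v e"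
  have S: "?S \<in> sets borel" by measurable
  have SF: "?S \<subseteq> frontier L" using normal_cap_frontier by blast
  have "norm (c *\<^sub>R flux ?S - area ?S *\<^sub>R u) \<le> cap_error (CARD('n) - 1) e * area ?S"
    by (rule flux_cap[OF u S _ e]) blast
  moreover have "norm (c *\<^sub>R flux ?S - area ?S *\<^sub>R v) \<le> cap_error (CARD('n) - 1) e * area ?S"
    by (rule flux_cap[OF v S _ e]) blast
  ultimately have "norm ((c *\<^sub>R flux ?S - area ?S *\<^sub>R v) - (c *\<^sub>R flux ?S - area ?S *\<^sub>R u))
      \<le> 2 * cap_error (CARD('n) - 1) e * area ?S"
    using norm_triangle_ineq4[of "c *\<^sub>R flux ?S - area ?S *\<^sub>R v" "c *\<^sub>R flux ?S - area ?S *\<^sub>R u"] by linarith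
  also have "(c *\<^sub>R flux ?S - area ?S *\<^sub>R v) - (c *\<^sub>R flux ?S - area ?S *\<^sub>R u) = area ?S *\<^sub>R (u - v)"
    by (simp add: scaleR_diff_right)
  finally have "area ?S * norm (u - v) \<le> area ?S * (2 * cap_error (CARD('n) - 1) e)"
    by (simp add: mult.commute)
  then have "area ?S = 0"
    using far measure_nonneg[of surface_measure ?S] by (simp add: mult_le_cancel_left less_le)
  then show ?thesis
    using area_emeasure(1)[OF S SF] S by (auto simp: null_sets_def)
qed

text \<open>The set is shown to equal a countable union of intersections of caps, rather than to lie
  in one. The equality makes it a Borel set, which measurability of the normal field needs.\<close>

lemma multiple_normals_null: "multiple_normals \<in> null_sets surface_measure"
proof -
  have "\<exists>e. 0 < e \<and> e < 1 \<and> cap_error (CARD('n) - 1) e + e < 1 / real (Suc k)" for k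
    by (rule cap_error_small[of "1 / real (Suc k)" "CARD('n) - 1"]) auto
  then obtain e where e: "\<And>k. 0 < e k" "\<And>k. e k < 1" "\<And>k. cap_error (CARD('n) - 1) (e k) + e k < 1 / real (Suc k)"
    by metis
  define E where "E = (\<lambda>k. cap_error (CARD('n) - 1) (e k))"
  have eE: "E k + e k < 1 / real (Suc k)" for k using e(3)[of k] by (simp add: E_def)
  have "\<exists>F. finite F \<and> (\<forall>u\<in>F. norm (u :: real^'n) = 1) \<and> (\<forall>n. norm n = 1 \<longrightarrow> (\<exists>u\<in>F. norm (n - u) \<le> e k))" for k
    by (rule frontier_covered_by_caps[OF e(1)[of k]]) blast
  then obtain F where F: "\<And>k. finite (F k)" "\<And>k u. u \<in> F k \<Longrightarrow> norm (u :: real^'n) = 1"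
    "\<And>k n. norm n = 1 \<Longrightarrow> \<exists>u\<in>F k. norm (n - u) \<le> e k"
    by metis
  \<comment> \<open>Two demands in one threshold: more than \<open>2 * E k\<close> makes the
    intersection of the caps null, and more than \<open>2 * e k\<close> forces different normals at
    every common point.\<close>
  define far where "far = (\<lambda>k (u :: real^'n) v. 2 * (E k + e k) < norm (u - v))"
  define Z where "Z = (\<lambda>k. \<Union>p\<in>{p \<in> F k \<times> F k. far k (fst p) (snd p)}. normal_cap L (fst p) (e k) \<inter> normal_cap L (snd p) (e k))"
  have "Z k \<in> null_sets surface_measure" for k
    unfolding Z_def
  proof (intro null_sets_UN')
    show "countable {p \<in> F k \<times> F k. far k (fst p) (snd p)}"
      using F(1) by (intro countable_finite) auto
    fix p assume p: "p \<in> {p \<in> F k \<times> F k. far k (fst p) (snd p)}"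
    then have "2 * cap_error (CARD('n) - 1) (e k) < norm (fst p - snd p)"
      using e(1)[of k] by (auto simp: far_def E_def)
    then show "normal_cap L (fst p) (e k) \<inter> normal_cap L (snd p) (e k) \<in> null_sets surface_measure"
      using p e F(2) by (intro caps_meet_null) auto
  qed
  then have null: "(\<Union>k. Z k) \<in> null_sets surface_measure"
    by (rule null_sets_UN)
  have err0: "0 \<le> E k" for k
    unfolding E_def by (rule cap_error_nonneg[OF e(1,2)])
  have "multiple_normals = (\<Union>k. Z k)"
  proof (intro set_eqI iffI)
    fix x assume "x \<in> multiple_normals"
    then have x: "x \<in> frontier L" "\<not> (\<exists>!n. n \<in> outer_unit_normals L x)"
      by (auto simp: multiple_normals_def)
    then obtain n m where nm: "n \<in> outer_unit_normals L x" "m \<in> outer_unit_normals L x" "n \<noteq> m"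
      using outer_unit_normals_nonempty by blast
    have "0 < norm (n - m) / 4" using nm by simp
    \<comment> \<open>Rounding both normals to the net costs at most \<open>2 * e k\<close>; as
      their distance exceeds \<open>4 * (E k + e k)\<close>, the distance of the net points still
      exceeds the threshold of \<open>far\<close>.\<close>
    then obtain k where k: "1 / real (Suc k) < norm (n - m) / 4"
      using reals_Archimedean by (metis inverse_eq_divide)
    have "norm n = 1" "norm m = 1" using nm by (auto simp: outer_unit_normals_def)
    then obtain u v where uv: "u \<in> F k" "norm (n - u) \<le> e k" "v \<in> F k" "norm (m - v) \<le> e k"
      using F(3) by meson
    have "norm (n - m) = norm ((n - u) + (u - v) - (m - v))" by simp
    also have "\<dots> \<le> norm (n - u) + norm (u - v) + norm (m - v)"
      using norm_triangle_ineq4[of "(n - u) + (u - v)" "m - v"] norm_triangle_ineq[of "n - u" "u - v"] by linarith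
    finally have tri: "norm (n - m) \<le> norm (n - u) + norm (u - v) + norm (m - v)" .
    have key: "2 * (r + s) < w" if "N \<le> a + w + b" "a \<le> s" "b \<le> s" "r + s < N / 4" "0 < s" "0 \<le> r"
      for N a b w r s :: real using that by simp
    have "far k u v"
      unfolding far_def by (rule key[OF tri uv(2) uv(4) less_trans[OF eE k] e(1) err0])
    moreover have "x \<in> normal_cap L u (e k) \<inter> normal_cap L v (e k)"
      using nm uv x frontier_subset by (auto simp: normal_cap_def)
    ultimately have "x \<in> Z k" using uv unfolding Z_def by force
    then show "x \<in> (\<Union>k. Z k)" by blast
  next
    fix x assume "x \<in> (\<Union>k. Z k)"
    then obtain k u v where far: "far k u v" and x: "x \<in> normal_cap L u (e k)" "x \<in> normal_cap L v (e k)"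
      by (auto simp: Z_def)
    then obtain n m where nm: "n \<in> outer_unit_normals L x" "norm (n - u) \<le> e k"
      "m \<in> outer_unit_normals L x" "norm (m - v) \<le> e k"
      by (auto simp: normal_cap_def)
    have "n \<noteq> m"
    proof
      assume "n = m"
      have "norm (u - v) = norm ((m - v) - (n - u))" using \<open>n = m\<close> by simp
      also have "\<dots> \<le> norm (m - v) + norm (n - u)" by (rule norm_triangle_ineq4)
      finally have tri: "norm (u - v) \<le> norm (m - v) + norm (n - u)" .
      have key: "\<not> 2 * (r + s) < w" if "w \<le> b + a" "a \<le> s" "b \<le> s" "0 \<le> r" for a b w r s :: real
        using that by simp
      show False
        using key[OF tri nm(2) nm(4) err0] far unfolding far_def by blast
    qed
    then have "\<not> (\<exists>!n. n \<in> outer_unit_normals L x)" using nm by blast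
    then show "x \<in> multiple_normals"
      using x(1) normal_cap_frontier by (auto simp: multiple_normals_def)
  qed
  then show ?thesis using null by simp
qed

lemma normal_field_borel [measurable]: "normal_field \<in> borel_measurable borel"
  using multiple_normals_null by (intro normal_field_measurable) auto

lemma AE_unique_normal:
  "AE x in surface_measure. x \<in> frontier L \<longrightarrow> (\<exists>!n. n \<in> outer_unit_normals L x)"
  by (rule AE_I'[OF multiple_normals_null]) (auto simp: multiple_normals_def)

lemma frontier_borel [measurable]: "frontier L \<in> sets borel"
  by (intro borel_closed frontier_closed)

lemma integrable_indicator_frontier: "integrable surface_measure (indicator (frontier L) :: _ \<Rightarrow> real)"
  using hausdorff_frontier_finite
  by (intro integrable_real_indicator) (auto simp: emeasure_hausdorff_measure)

lemma integrable_bounded_on_frontier: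
  fixes f :: "real^'n \<Rightarrow> 'b::{banach, second_countable_topology}"
  assumes "f \<in> borel_measurable borel" "\<And>x. norm (f x) \<le> b * indicator (frontier L) x"
  shows "integrable surface_measure f"
proof (rule Bochner_Integration.integrable_bound)
  show "integrable surface_measure (\<lambda>x. b * indicator (frontier L) x)"
    by (intro integrable_mult_right integrable_indicator_frontier)
  show "f \<in> borel_measurable surface_measure" using assms(1) by measurable
  show "AE x in surface_measure. norm (f x) \<le> norm (b * indicator (frontier L) x)"
    using assms(2) by (intro AE_I2) (auto intro: order_trans[OF _ abs_ge_self])
qed

lemma integrable_normal_on:
  assumes [measurable]: "S \<in> sets borel"
  shows "integrable surface_measure (\<lambda>x. indicator S x *\<^sub>R normal_field x)"
proof (rule integrable_bounded_on_frontier[where b=1])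
  show "norm (indicator S x *\<^sub>R normal_field x) \<le> 1 * indicator (frontier L) x" for x
    using norm_normal_field[of x] by (auto split: split_indicator)
qed measurable

text \<open>Outside the null set \<open>multiple_normals\<close>, the normal field at a point of the
  cap is the normal within \<open>e\<close> of \<open>u\<close>.\<close>

lemma normal_integral_cap:
  assumes u: "norm u = 1" and S[measurable]: "S \<in> sets borel" and cap: "S \<subseteq> normal_cap L u e" and e: "0 < e"
  shows "norm ((\<integral>x. indicator S x *\<^sub>R normal_field x \<partial>surface_measure) - area S *\<^sub>R u) \<le> e * area S"
proof -
  have SF: "S \<subseteq> frontier L" using cap normal_cap_frontier by blast
  have fin: "emeasure surface_measure S < \<infinity>" using area_emeasure(1)[OF S SF] by simp
  have intS: "integrable surface_measure (indicator S :: _ \<Rightarrow> real)"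
    using fin by (intro integrable_real_indicator) auto
  have intu: "integrable surface_measure (\<lambda>x. indicator S x *\<^sub>R u)"
    using fin by (intro integrable_indicator) auto
  have "(\<integral>x. indicator S x *\<^sub>R u \<partial>surface_measure) = area S *\<^sub>R u"
    using intS by simp
  then have "(\<integral>x. indicator S x *\<^sub>R normal_field x \<partial>surface_measure) - area S *\<^sub>R u
      = (\<integral>x. indicator S x *\<^sub>R normal_field x - indicator S x *\<^sub>R u \<partial>surface_measure)"
    using integrable_normal_on[OF S] intu by simp
  also have "norm \<dots> \<le> (\<integral>x. norm (indicator S x *\<^sub>R normal_field x - indicator S x *\<^sub>R u) \<partial>surface_measure)"
    by (rule integral_norm_bound)
  also have "\<dots> \<le> (\<integral>x. e * indicator S x \<partial>surface_measure)"
  proof (rule integral_mono_AE)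
    show "integrable surface_measure (\<lambda>x. norm (indicator S x *\<^sub>R normal_field x - indicator S x *\<^sub>R u))"
      using integrable_normal_on[OF S] intu by (intro integrable_norm Bochner_Integration.integrable_diff)
    show "integrable surface_measure (\<lambda>x. e * indicator S x)"
      using intS by simp
    show "AE x in surface_measure. norm (indicator S x *\<^sub>R normal_field x - indicator S x *\<^sub>R u) \<le> e * indicator S x"
    proof (rule AE_I'[OF multiple_normals_null], rule subsetI, rule ccontr)
      fix x assume x: "x \<in> {x \<in> space surface_measure. \<not> norm (indicator S x *\<^sub>R normal_field x - indicator S x *\<^sub>R u) \<le> e * indicator S x}"
        and B: "x \<notin> multiple_normals"
      show False
      proof (cases "x \<in> S")
        case True
        then obtain n where n: "x \<in> L" "n \<in> outer_unit_normals L x" "norm (n - u) \<le> e"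
          using cap by (auto simp: normal_cap_def)
        then show False using x True normal_field_eq[OF n(1) B n(2)] by simp
      qed (use x in simp)
    qed
  qed
  also have "\<dots> = e * area S" by simp
  finally show ?thesis .
qed

text \<open>On a piece of a cap around \<open>u\<close> both sides are close to area times
  \<open>u\<close>, with an error proportional to the area. Over disjoint pieces the errors add up
  to \<open>\<delta> * area S\<close>, and \<open>\<delta>\<close> is arbitrary because the area is
  finite.\<close>

lemma flux_eq_normal_integral:
  assumes S: "S \<in> sets borel" "S \<subseteq> frontier L"
  shows "c *\<^sub>R flux S = (\<integral>x. indicator S x *\<^sub>R normal_field x \<partial>surface_measure)"
proof -
  let ?N = "\<lambda>S. \<integral>x. indicator S x *\<^sub>R normal_field x \<partial>surface_measure"
  have est: "norm (c *\<^sub>R flux S - ?N S) \<le> \<delta> * area S" if \<delta>: "0 < \<delta>" for \<delta>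
  proof -
    obtain e where e: "0 < e" "e < 1" "cap_error (CARD('n) - 1) e + e < \<delta>"
      using cap_error_small[OF \<delta>] by blast
    obtain F where F: "finite F" "\<And>u. u \<in> F \<Longrightarrow> norm u = 1" "frontier L \<subseteq> (\<Union>u\<in>F. normal_cap L u e)"
      by (rule frontier_covered_by_caps[OF e(1)]) simp_all
    \<comment> \<open>The caps overlap, so one cap at a time is removed from \<open>T\<close>; the
      induction must therefore range over all sets \<open>T\<close>.\<close>
    have "norm (c *\<^sub>R flux T - ?N T) \<le> \<delta> * area T"
      if "finite G" "G \<subseteq> F" "T \<in> sets borel" "T \<subseteq> (\<Union>u\<in>G. normal_cap L u e)" for G T
      using that
    proof (induction G arbitrary: T)
      case empty
      then show ?case by (simp add: flux_def)
    next
      case (insert u G)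
      note [measurable] = insert.prems(2)
      define A where "A = T \<inter> normal_cap L u e"
      define B where "B = T - normal_cap L u e"
      have AB: "A \<in> sets borel" "B \<in> sets borel" "A \<inter> B = {}" "T = A \<union> B"
        "A \<subseteq> normal_cap L u e" "B \<subseteq> (\<Union>u\<in>G. normal_cap L u e)"
        using insert.prems by (auto simp: A_def B_def)
      have u: "norm u = 1" using insert.prems(1) F(2) by auto
      have fr: "A \<subseteq> frontier L" "B \<subseteq> frontier L"
        using AB(5,6) normal_cap_frontier by blast+
      have "norm (c *\<^sub>R flux A - ?N A) \<le> norm (c *\<^sub>R flux A - area A *\<^sub>R u) + norm (?N A - area A *\<^sub>R u)"
        using norm_triangle_ineq4[of "c *\<^sub>R flux A - area A *\<^sub>R u" "?N A - area A *\<^sub>R u"] by simp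
      also have "\<dots> \<le> cap_error (CARD('n) - 1) e * area A + e * area A"
        by (intro add_mono flux_cap normal_integral_cap u AB e)
      also have "\<dots> \<le> \<delta> * area A"
        using mult_right_mono[of "cap_error (CARD('n) - 1) e + e" \<delta> "area A"] e(3) by (simp add: distrib_right)
      finally have A: "norm (c *\<^sub>R flux A - ?N A) \<le> \<delta> * area A" .
      have B: "norm (c *\<^sub>R flux B - ?N B) \<le> \<delta> * area B"
        using insert AB by auto
      have "?N T = ?N A + ?N B"
      proof -
        have "?N T = (\<integral>x. indicator A x *\<^sub>R normal_field x + indicator B x *\<^sub>R normal_field x \<partial>surface_measure)"
          using AB(3) by (intro Bochner_Integration.integral_cong refl) (auto simp: AB(4) split: split_indicator)
        then show ?thesis using AB(1,2) integrable_normal_on by simp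
      qed
      moreover have "flux T = flux A + flux B" using AB flux_Un by simp
      moreover have "area T = area A + area B"
        using AB area_emeasure(1)[OF AB(1) fr(1)] area_emeasure(1)[OF AB(2) fr(2)]
        by (auto intro!: measure_Union)
      ultimately show ?case
        using A B norm_triangle_ineq[of "c *\<^sub>R flux A - ?N A" "c *\<^sub>R flux B - ?N B"]
        by (simp add: algebra_simps)
    qed
    from this[OF F(1) order_refl S(1)] show ?thesis using S(2) F(3) by blast
  qed
  have "norm (c *\<^sub>R flux S - ?N S) \<le> 0"
  proof (rule field_le_epsilon)
    fix \<delta> :: real assume \<delta>: "0 < \<delta>"
    have "norm (c *\<^sub>R flux S - ?N S) \<le> \<delta> / (area S + 1) * area S"
      by (rule est) (use \<delta> in \<open>auto intro!: divide_pos_pos add_nonneg_pos\<close>)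
    also have "\<dots> \<le> 0 + \<delta>"
    proof -
      have "\<delta> / (y + 1) * y \<le> 0 + \<delta>" if "0 \<le> y" for y
        using that \<delta> by (simp add: field_simps)
      then show ?thesis using measure_nonneg by blast
    qed
    finally show "norm (c *\<^sub>R flux S - ?N S) \<le> 0 + \<delta>" .
  qed
  then show ?thesis by simp
qed

text \<open>The passage from sets to bounded functions uses a signed family of four measures: the
  two upper-end measures, and the surface densities given by the positive and the negative part of
  the normal component.\<close>

theorem top_measure_eq_normal_integral:
  fixes f :: "real^'n \<Rightarrow> real"
  assumes u: "norm u = 1" and f[measurable]: "f \<in> borel_measurable borel" and B: "\<And>x. \<bar>f x\<bar> \<le> B"
  shows "c * ((\<integral>x. f x \<partial>top_measure L u) - (\<integral>x. f x \<partial>top_measure L (- u)))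
    = (\<integral>x. f x * (normal_field x \<bullet> u) \<partial>surface_measure)"
proof -
  interpret d: solid_dir L u by unfold_locales fact
  interpret m: solid_dir L "- u" by (rule d.solid_dir_minus)
  define g where "g = (\<lambda>x. normal_field x \<bullet> u)"
  have gm[measurable]: "g \<in> borel_measurable borel" unfolding g_def by measurable
  have gb: "\<bar>g x\<bar> \<le> indicator (frontier L) x" for x
    unfolding g_def using Cauchy_Schwarz_ineq2[of "normal_field x" u] norm_normal_field[of x] u by simp
  have gint: "integrable surface_measure (\<lambda>x. h x * k (g x))"
    if "h \<in> borel_measurable borel" "\<And>x. \<bar>h x\<bar> \<le> b" "k \<in> borel_measurable borel" "\<And>y. \<bar>k y\<bar> \<le> \<bar>y\<bar>" for h k b
  proof (rule integrable_bounded_on_frontier[where b=b])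
    show "(\<lambda>x. h x * k (g x)) \<in> borel_measurable borel" using that by measurable
    show "norm (h x * k (g x)) \<le> b * indicator (frontier L) x" for x
      using mult_mono[OF that(2)[of x] order_trans[OF that(4) gb[of x]]] that(2)[of x] by (simp add: abs_mult)
  qed
  define M where "M = (\<lambda>k::nat. if k = 0 then top_measure L u else if k = 1 then top_measure L (- u)
    else if k = 2 then density surface_measure (\<lambda>x. ennreal (max 0 (g x)))
    else density surface_measure (\<lambda>x. ennreal (max 0 (- g x))))"
  define a where "a = (\<lambda>k::nat. if k = 0 then c else if k = 1 then - c else if k = 2 then - 1 else 1)"
  have sums: "(\<Sum>k\<in>{0,1,2,3}. a k * F (M k)) = c * (F (top_measure L u) - F (top_measure L (- u)))
      - (F (density surface_measure (\<lambda>x. ennreal (max 0 (g x)))) - F (density surface_measure (\<lambda>x. ennreal (max 0 (- g x)))))"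
    for F by (simp add: a_def M_def algebra_simps)
  have int: "(\<integral>x. h x \<partial>density surface_measure (\<lambda>x. ennreal (max 0 (g x))))
      - (\<integral>x. h x \<partial>density surface_measure (\<lambda>x. ennreal (max 0 (- g x))))
      = (\<integral>x. h x * g x \<partial>surface_measure)"
    if h[measurable]: "h \<in> borel_measurable borel" and b: "\<And>x. \<bar>h x\<bar> \<le> b" for h b
  proof -
    have "(\<integral>x. h x \<partial>density surface_measure (\<lambda>x. ennreal (max 0 (g x))))
      - (\<integral>x. h x \<partial>density surface_measure (\<lambda>x. ennreal (max 0 (- g x))))
      = (\<integral>x. h x * max 0 (g x) \<partial>surface_measure) - (\<integral>x. h x * max 0 (- g x) \<partial>surface_measure)"
      by (simp add: integral_density mult.commute)
    also have "\<dots> = (\<integral>x. h x * max 0 (g x) - h x * max 0 (- g x) \<partial>surface_measure)"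
      using gint[OF h b, of "\<lambda>y. max 0 y"] gint[OF h b, of "\<lambda>y. max 0 (- y)"] by simp
    also have "\<dots> = (\<integral>x. h x * g x \<partial>surface_measure)"
      by (intro Bochner_Integration.integral_cong refl) (auto simp: max_def)
    finally show ?thesis .
  qed
  have fin: "finite_measure (density surface_measure (\<lambda>x. ennreal (k (g x))))"
    if k[measurable]: "k \<in> borel_measurable borel" and k0: "\<And>y. 0 \<le> k y" "\<And>y. \<bar>k y\<bar> \<le> \<bar>y\<bar>" for k
  proof
    have "integrable surface_measure (\<lambda>x. 1 * k (g x))"
      by (rule gint[of "\<lambda>_. 1" 1, OF _ _ k k0(2)]) auto
    then have "(\<integral>\<^sup>+x. ennreal (k (g x)) \<partial>surface_measure) < \<infinity>"
      using k0(1) by (simp add: integrable_iff_bounded)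
    then show "emeasure (density surface_measure (\<lambda>x. ennreal (k (g x)))) (space (density surface_measure (\<lambda>x. ennreal (k (g x))))) \<noteq> \<infinity>"
      by (simp add: emeasure_density)
  qed
  have M: "finite_measure (M k)" "sets (M k) = sets borel" if "k \<in> {0,1,2,3}" for k
    using d.finite_top_measure m.finite_top_measure fin[of "\<lambda>y. max 0 y"] fin[of "\<lambda>y. max 0 (- y)"]
    by (auto simp: M_def)
  have zero: "(\<Sum>k\<in>{0,1,2,3}. a k * measure (M k) S) = 0" if S[measurable]: "S \<in> sets borel" for S
  proof -
    \<comment> \<open>The flux formula holds for subsets of the frontier; since both sides live
      there, an arbitrary Borel set may be intersected with it.\<close>
    have top: "measure (top_measure L v) S = measure (top_measure L v) (S \<inter> frontier L)" if "norm v = 1" for v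
    proof -
      interpret v: solid_dir L v by unfold_locales fact
      have "AE x in top_measure L v. x \<in> frontier L"
        using v.top_measure_outside by (intro AE_I[of _ _ "- frontier L"]) auto
      then show ?thesis by (intro measure_eq_AE) (auto elim!: eventually_mono)
    qed
    have dens: "measure (density surface_measure (\<lambda>x. ennreal (k (g x)))) S
        = (\<integral>x. indicator S x \<partial>density surface_measure (\<lambda>x. ennreal (k (g x))))" for k
      by simp
    have SF: "S \<inter> frontier L \<in> sets borel" by measurable
    have "c * (measure (top_measure L u) S - measure (top_measure L (- u)) S) = (c *\<^sub>R flux (S \<inter> frontier L)) \<bullet> u"
      using u by (simp add: flux_inner[OF u SF] top)
    also have "\<dots> = (\<integral>x. (indicator (S \<inter> frontier L) x *\<^sub>R normal_field x) \<bullet> u \<partial>surface_measure)"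
      by (simp only: flux_eq_normal_integral[OF SF Int_lower2] integral_inner_left[OF integrable_normal_on[OF SF]])
    also have "\<dots> = (\<integral>x. indicator S x * g x \<partial>surface_measure)"
      using normal_field_zero by (intro Bochner_Integration.integral_cong refl) (auto simp: g_def split: split_indicator)
    finally show ?thesis
      unfolding sums[of "\<lambda>M. measure M S"] dens
      using int[of "indicator S" 1] by (simp add: dens split: split_indicator)
  qed
  have "(\<Sum>k\<in>{0,1,2,3}. a k * (\<integral>x. f x \<partial>M k)) = 0"
    by (rule signed_measures_integral_eq_0[OF M zero f B])
  then show ?thesis
    unfolding sums[of "\<lambda>M. \<integral>x. f x \<partial>M"] using int[OF f B] by (simp add: g_def)
qed

end

section \<open>First variation under shears\<close>

text \<open>The length of the intersection of \<open>{a..b}\<close> with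
  \<open>{p + t..q + t}\<close>.\<close>

definition overlap :: "real \<Rightarrow> real \<Rightarrow> real \<Rightarrow> real \<Rightarrow> real \<Rightarrow> real" where
  "overlap a b p q t = max 0 (min b (q + t) - max a (p + t))"

lemma overlap_swap: "overlap a b p q t = overlap p q a b (- t)"
  by (auto simp: overlap_def max_def min_def)

lemma overlap_lipschitz:
  assumes "a \<le> b" "p \<le> q"
  shows "\<bar>overlap a b p q t - overlap a b p q 0\<bar> \<le> \<bar>t\<bar>"
  using assms unfolding overlap_def by (auto simp: max_def min_def abs_if)

text \<open>While no end of the moving interval passes an end of the fixed one, the order of the
  four points is unchanged. An upper end inside \<open>{a..b}\<close> then contributes
  \<open>t\<close>, a lower end inside it \<open>- t\<close>.\<close>

lemma overlap_linear:
  assumes "a \<le> b" "p \<le> q" and t: "\<bar>t\<bar> < \<bar>p - a\<bar>" "\<bar>t\<bar> < \<bar>p - b\<bar>" "\<bar>t\<bar> < \<bar>q - a\<bar>" "\<bar>t\<bar> < \<bar>q - b\<bar>"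
  shows "overlap a b p q t - overlap a b p q 0 = t * (indicator {a..b} q - indicator {a..b} p)"
proof -
  have 1: "min b (q + t) = (if q < b then q + t else b)" "min b q = (if q < b then q else b)"
    using t(4) by (auto simp: min_def abs_if split: if_splits)
  have 2: "max a (p + t) = (if a < p then p + t else a)" "max a p = (if a < p then p else a)"
    using t(1) by (auto simp: max_def abs_if split: if_splits)
  have "p \<noteq> a" "p \<noteq> b" "q \<noteq> a" "q \<noteq> b" using t by auto
  then consider "q < a" | "a < q" "q < b" "p < a" | "a < q" "q < b" "a < p" | "b < q" "p < a" | "b < q" "a < p" "p < b" | "b < p"
    using assms(1,2) by fastforce
  then show ?thesis
    unfolding overlap_def add_0_right 1 2 using assms
    by cases (auto simp: indicator_def max_def abs_if split: if_splits)
qed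

context solid begin

lemma compact_shear_image:
  "compact ((\<lambda>x. x + (b \<bullet> x + s) *\<^sub>R u) ` L)"
  by (intro compact_continuous_image continuous_intros compact)

end

text \<open>As \<open>b\<close> is orthogonal to \<open>u\<close>, the displacement
  \<open>b \<bullet> x + s\<close> is constant on each line in direction \<open>u\<close>. The shear
  thus translates each section of \<open>L\<close> rigidly, and subtracting the same displacement
  inverts it.\<close>

lemma measure_shear_overlap:
  fixes K L :: "'a::euclidean_space set"
  assumes K: "solid_dir K u" and L: "solid_dir L u" and b: "b \<bullet> u = 0"
  shows "measure lborel (K \<inter> (\<lambda>x. x + (b \<bullet> x + s) *\<^sub>R u) ` L)
    = (\<integral>x. indicator (slab u \<inter> line_dom K u \<inter> line_dom L u) x *
        overlap (- height K (- u) x) (height K u x) (- height L (- u) x) (height L u x) (b \<bullet> x + s) \<partial>lborel)"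
proof -
  interpret K: solid_dir K u by fact
  interpret L: solid_dir L u by fact
  let ?\<phi> = "\<lambda>x. b \<bullet> x + s"
  let ?T = "K \<inter> (\<lambda>x. x + ?\<phi> x *\<^sub>R u) ` L"
  have T: "compact ?T"
    by (intro compact_Int K.compact L.compact_shear_image)
  then have Tm: "?T \<in> sets borel" by (intro borel_closed compact_imp_closed)
  have fin: "emeasure lborel ?T < \<infinity>"
    using T emeasure_bounded_finite[OF compact_imp_bounded] by (simp add: less_top)
  have img: "y \<in> (\<lambda>x. x + ?\<phi> x *\<^sub>R u) ` L \<longleftrightarrow> y - ?\<phi> y *\<^sub>R u \<in> L" for y
  proof
    assume "y \<in> (\<lambda>x. x + ?\<phi> x *\<^sub>R u) ` L"
    then show "y - ?\<phi> y *\<^sub>R u \<in> L" by (auto simp: inner_add_right b)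
  next
    assume "y - ?\<phi> y *\<^sub>R u \<in> L"
    then show "y \<in> (\<lambda>x. x + ?\<phi> x *\<^sub>R u) ` L"
      by (intro image_eqI[of _ _ "y - ?\<phi> y *\<^sub>R u"]) (auto simp: inner_diff_right b)
  qed
  have "measure lborel ?T = (\<integral>x. indicator ?T x \<partial>lborel)" by simp
  also have "\<dots> = (\<integral>x. indicator (slab u) x * (\<integral>r. indicator ?T (x + r *\<^sub>R u) \<partial>lborel) \<partial>lborel)"
    using Tm fin by (intro integral_lborel_lines K.u integrable_real_indicator) auto
  also have "\<dots> = (\<integral>x. indicator (slab u \<inter> line_dom K u \<inter> line_dom L u) x *
        overlap (- height K (- u) x) (height K u x) (- height L (- u) x) (height L u x) (?\<phi> x) \<partial>lborel)"
  proof (intro Bochner_Integration.integral_cong refl)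
    fix x
    have sec: "x + r *\<^sub>R u \<in> ?T \<longleftrightarrow> x + r *\<^sub>R u \<in> K \<and> x + (r - ?\<phi> x) *\<^sub>R u \<in> L" for r
      unfolding Int_iff img by (simp add: inner_add_right b algebra_simps)
    show "indicator (slab u) x * (\<integral>r. indicator ?T (x + r *\<^sub>R u) \<partial>lborel)
      = indicator (slab u \<inter> line_dom K u \<inter> line_dom L u) x *
        overlap (- height K (- u) x) (height K u x) (- height L (- u) x) (height L u x) (?\<phi> x)"
    proof (cases "x \<in> line_dom K u \<and> x \<in> line_dom L u")
      case True
      let ?l = "max (- height K (- u) x) (- height L (- u) x + ?\<phi> x)" and ?h = "min (height K u x) (height L u x + ?\<phi> x)"
      have "x + r *\<^sub>R u \<in> ?T \<longleftrightarrow> r \<in> {?l..?h}" for r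
        unfolding sec using True K.in_section_iff[of x] L.in_section_iff[of x] by auto
      then have "(\<integral>r. indicator ?T (x + r *\<^sub>R u) \<partial>lborel) = (\<integral>r. indicator {?l..?h} r \<partial>lborel)"
        by (intro Bochner_Integration.integral_cong refl) (simp add: indicator_def)
      also have "\<dots> = max 0 (?h - ?l)"
        by (cases "?l \<le> ?h") auto
      finally show ?thesis using True by (simp add: overlap_def split: split_indicator)
    next
      case False
      then have "x + r *\<^sub>R u \<notin> ?T" for r
        unfolding sec by (auto simp: line_dom_def)
      then show ?thesis using False by (auto split: split_indicator)
    qed
  qed
  finally show ?thesis .
qed

text \<open>On every line, shifting one interval by \<open>t\<close> or the other by
  \<open>- t\<close> gives the same overlap.\<close>

lemma measure_shear_swap:
  fixes K L :: "'a::euclidean_space set"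
  assumes K: "solid_dir K u" and L: "solid_dir L u" and b: "b \<bullet> u = 0"
  shows "measure lborel (L \<inter> (\<lambda>x. x + (b \<bullet> x + s) *\<^sub>R u) ` K)
    = measure lborel (K \<inter> (\<lambda>x. x + (- b \<bullet> x + - s) *\<^sub>R u) ` L)"
proof -
  have b': "- b \<bullet> u = 0" using b by simp
  show ?thesis
    unfolding measure_shear_overlap[OF L K b] measure_shear_overlap[OF K L b']
    by (intro Bochner_Integration.integral_cong refl arg_cong2[where f="(*)"])
       (auto simp: overlap_swap[of "- height L (- u) _"] indicator_def)
qed

text \<open>The consequence of maximal position from which the variation is computed. The roles of
  the bodies are interchanged at this level, where inverting a shear means changing the signs of
  \<open>b\<close> and \<open>s\<close>.\<close>

definition shear_maximal :: "'a::euclidean_space set \<Rightarrow> 'a set \<Rightarrow> bool" where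
  "shear_maximal K L \<longleftrightarrow> (\<forall>u b s. norm u = 1 \<longrightarrow> b \<bullet> u = 0 \<longrightarrow>
     measure lborel (K \<inter> (\<lambda>x. x + (b \<bullet> x + s) *\<^sub>R u) ` L) \<le> measure lborel (K \<inter> L))"

lemma shear_maximal_swap:
  assumes "solid K" "solid L" "shear_maximal K L"
  shows "shear_maximal L K"
  unfolding shear_maximal_def
proof (intro allI impI)
  fix u b :: 'a and s assume u: "norm u = 1" and b: "b \<bullet> u = 0"
  have "measure lborel (K \<inter> (\<lambda>x. x + (- b \<bullet> x + - s) *\<^sub>R u) ` L) \<le> measure lborel (K \<inter> L)"
    using assms(3) u b unfolding shear_maximal_def by (metis inner_minus_left neg_equal_0_iff_equal)
  then show "measure lborel (L \<inter> (\<lambda>x. x + (b \<bullet> x + s) *\<^sub>R u) ` K) \<le> measure lborel (L \<inter> K)"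
    using measure_shear_swap[of K u L b s] assms u b
    by (simp add: solid_dir_def solid_dir_axioms_def Int_commute)
qed

context solid_area begin

text \<open>Projection does not increase Hausdorff measure, so almost no line in direction
  \<open>u\<close> meets \<open>S\<close>. Applied to the common frontier, it removes the lines on
  which the overlap may fail to be differentiable.\<close>

lemma null_shadow:
  fixes S :: "(real^'n) set"
  assumes u: "norm u = 1" and S: "compact S" "emeasure surface_measure S = 0"
  shows "slab u \<inter> proj u -` (proj u ` S) \<in> null_sets lborel"
proof -
  have "continuous_on S (proj u)"
    unfolding proj_def by (intro continuous_intros)
  then have "compact (proj u ` S)" using S(1) by (rule compact_continuous_image)
  then have T[measurable]: "proj u ` S \<in> sets borel" by (intro borel_closed compact_imp_closed)
  have SB: "S \<in> sets borel" using S(1) by (intro borel_closed compact_imp_closed)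
  have "hausdorff_outer (CARD('n) - 1) (proj u ` S) \<le> ennreal (1 ^ (CARD('n) - 1)) * hausdorff_outer (CARD('n) - 1) S"
    by (rule hausdorff_outer_lipschitz_image)
       (auto simp: dist_norm proj_diff[symmetric] intro: norm_proj_le[OF u])
  also have "\<dots> = 0" using S(2) emeasure_hausdorff_measure[OF SB, of "CARD('n) - 1"] by simp
  finally have "ennreal c * emeasure lborel (slab u \<inter> proj u -` (proj u ` S)) = 0"
    using hausdorff_hyp[OF u T] proj_in_hyp[OF u] by auto
  then have "emeasure lborel (slab u \<inter> proj u -` (proj u ` S)) = 0"
    using c0 by simp
  moreover have "slab u \<inter> proj u -` (proj u ` S) \<in> sets borel"
    using measurable_sets[OF proj_measurable T, of u] by (intro sets.Int) auto
  ultimately show ?thesis by (auto simp: null_sets_def)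
qed

text \<open>The shears with parameters \<open>b / (n + 1)\<close> and \<open>s / (n + 1)\<close>
  cannot increase the volume, so the difference quotients have nonpositive integrals. They are
  dominated because overlaps are Lipschitz, and their limit \<open>D\<close> is an integral over the
  ends of the sections of \<open>L\<close>, that is, over the two upper-end measures.\<close>

lemma maximal_flux_le:
  assumes K: "solid K" and max: "shear_maximal K L"
    and null: "emeasure surface_measure (frontier K \<inter> frontier L) = 0"
    and u: "norm u = 1" and b: "b \<bullet> u = 0"
  shows "(\<integral>x. (indicator (K \<inter> frontier L) x * (b \<bullet> x + s)) * (normal_field x \<bullet> u) \<partial>surface_measure) \<le> 0"
proof -
  interpret K: solid K by fact
  interpret K: solid_dir K u by unfold_locales fact
  interpret L: solid_dir L u by unfold_locales fact
  interpret Km: solid_dir K "- u" by (rule K.solid_dir_minus)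
  interpret Lm: solid_dir L "- u" by (rule L.solid_dir_minus)
  let ?\<phi> = "\<lambda>x. b \<bullet> x + s"
  let ?W = "slab u \<inter> line_dom K u \<inter> line_dom L u"
  let ?k1 = "\<lambda>x. - height K (- u) x" and ?k2 = "height K u"
  let ?l1 = "\<lambda>x. - height L (- u) x" and ?l2 = "height L u"
  let ?G = "\<lambda>x. overlap (?k1 x) (?k2 x) (?l1 x) (?l2 x)"
  let ?t = "\<lambda>n. 1 / real (Suc n)"
  define q where "q = (\<lambda>n x. indicator ?W x * ((?G x (?t n * ?\<phi> x) - ?G x 0) * real (Suc n)))"
  define D where "D = (\<lambda>x. indicator ?W x * (?\<phi> x * (indicator {?k1 x..?k2 x} (?l2 x) - indicator {?k1 x..?k2 x} (?l1 x))))"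
  have Wm[measurable]: "?W \<in> sets borel" by measurable
  have [measurable]: "(\<lambda>x. height K (- u) x) \<in> borel_measurable borel" "(\<lambda>x. height L (- u) x) \<in> borel_measurable borel"
    by (rule Km.height_measurable Lm.height_measurable)+
  have Gm[measurable]: "(\<lambda>x. indicator ?W x * ?G x (r * ?\<phi> x)) \<in> borel_measurable borel" for r
    unfolding overlap_def by measurable
  have bdW: "bounded ?W" using L.bounded_slab_dom by (rule bounded_subset) auto
  then obtain R where R: "\<And>x. x \<in> ?W \<Longrightarrow> norm x \<le> R" by (auto simp: bounded_iff)
  define C where "C = norm b * R + \<bar>s\<bar>"
  have C: "\<bar>?\<phi> x\<bar> \<le> C" if "x \<in> ?W" for x
  proof -
    have "\<bar>?\<phi> x\<bar> \<le> \<bar>b \<bullet> x\<bar> + \<bar>s\<bar>" by (rule abs_triangle_ineq)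
    also have "\<bar>b \<bullet> x\<bar> \<le> norm b * norm x" by (rule Cauchy_Schwarz_ineq2)
    also have "norm b * norm x \<le> norm b * R" using R[OF that] by (intro mult_left_mono) auto
    finally show ?thesis by (simp add: C_def)
  qed
  have finW: "emeasure lborel ?W < \<infinity>"
    using emeasure_bounded_finite[OF bdW] by (simp add: less_top)
  have intC: "integrable lborel (\<lambda>x. indicator ?W x * C)"
    using finW by (intro integrable_mult_left integrable_real_indicator) auto
  have qm[measurable]: "q n \<in> borel_measurable borel" for n
  proof -
    have "q n = (\<lambda>x. (indicator ?W x * ?G x (?t n * ?\<phi> x) - indicator ?W x * ?G x (0 * ?\<phi> x)) * real (Suc n))"
      by (auto simp: q_def fun_eq_iff algebra_simps)
    then show ?thesis by (simp only:) measurable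
  qed
  have qC: "\<bar>q n x\<bar> \<le> indicator ?W x * C" for n x
  proof (cases "x \<in> ?W")
    case True
    then have "\<bar>?G x (?t n * ?\<phi> x) - ?G x 0\<bar> \<le> \<bar>?t n * ?\<phi> x\<bar>"
      by (intro overlap_lipschitz K.heights_le L.heights_le) auto
    then have "\<bar>?G x (?t n * ?\<phi> x) - ?G x 0\<bar> * real (Suc n) \<le> \<bar>?t n * ?\<phi> x\<bar> * real (Suc n)"
      by (rule mult_right_mono) simp
    also have "\<dots> = \<bar>?\<phi> x\<bar>" by (simp add: abs_mult)
    finally show ?thesis using True C[OF True] by (simp add: q_def abs_mult)
  qed (simp add: q_def)
  have qint: "integrable lborel (q n)" for n
    using qC by (intro Bochner_Integration.integrable_bound[OF intC]) (auto intro: order_trans[OF _ abs_ge_self])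
  have q0: "(\<integral>x. q n x \<partial>lborel) \<le> 0" for n
  proof -
    \<comment> \<open>An overlap is at most the length of the section of \<open>K\<close>, which is
      at most \<open>2 * R\<close>.\<close>
    have Gint: "integrable lborel (\<lambda>x. indicator ?W x * ?G x (r * ?\<phi> x))" for r
    proof -
      obtain R where R: "\<And>x. x \<in> K \<Longrightarrow> norm x \<le> R" by (metis K.bound)
      have bnd: "\<bar>indicator ?W x * ?G x (r * ?\<phi> x)\<bar> \<le> indicator ?W x * (2 * R)" for x
      proof (cases "x \<in> ?W")
        case True
        then have dom: "x \<in> line_dom K u" by simp
        have "top_point K u x \<in> K" "top_point K (- u) x \<in> K"
          using K.top_point_in Km.top_point_in dom by auto
        then have "norm (top_point K u x) \<le> R" "norm (top_point K (- u) x) \<le> R" using R by auto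
        then have "norm (top_point K u x - top_point K (- u) x) \<le> 2 * R"
          using norm_triangle_ineq4[of "top_point K u x" "top_point K (- u) x"] by linarith
        also have "top_point K u x - top_point K (- u) x = (?k2 x - ?k1 x) *\<^sub>R u"
          by (simp add: top_point_def algebra_simps)
        finally have "\<bar>?k2 x - ?k1 x\<bar> \<le> 2 * R" using u by simp
        then have "\<bar>?G x (r * ?\<phi> x)\<bar> \<le> 2 * R"
          unfolding overlap_def by (auto simp: max_def min_def abs_if split: if_splits)
        then show ?thesis using True by simp
      qed simp
      have "integrable lborel (\<lambda>x. indicator ?W x * (2 * R))"
        using finW by (intro integrable_mult_left integrable_real_indicator) auto
      then show ?thesis
      proof (rule Bochner_Integration.integrable_bound)
        show "(\<lambda>x. indicator ?W x * ?G x (r * ?\<phi> x)) \<in> borel_measurable lborel"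
          using Gm by simp
        show "AE x in lborel. norm (indicator ?W x * ?G x (r * ?\<phi> x)) \<le> norm (indicator ?W x * (2 * R))"
        proof (rule AE_I2)
          fix x
          show "norm (indicator ?W x * ?G x (r * ?\<phi> x)) \<le> norm (indicator ?W x * (2 * R))"
            using order_trans[OF bnd[of x] abs_ge_self] unfolding real_norm_def .
        qed
      qed
    qed
    have vol: "measure lborel (K \<inter> (\<lambda>x. x + ((r *\<^sub>R b) \<bullet> x + r * s) *\<^sub>R u) ` L)
        = (\<integral>x. indicator ?W x * ?G x (r * ?\<phi> x) \<partial>lborel)" for r
      using measure_shear_overlap[OF K.solid_dir_axioms L.solid_dir_axioms, of "r *\<^sub>R b" "r * s"] b
      by (simp add: distrib_left)
    have "(\<integral>x. q n x \<partial>lborel) = (\<integral>x. (indicator ?W x * ?G x (?t n * ?\<phi> x) - indicator ?W x * ?G x (0 * ?\<phi> x)) * real (Suc n) \<partial>lborel)"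
      by (intro Bochner_Integration.integral_cong refl) (simp add: q_def algebra_simps)
    also have "\<dots> = ((\<integral>x. indicator ?W x * ?G x (?t n * ?\<phi> x) \<partial>lborel) - (\<integral>x. indicator ?W x * ?G x (0 * ?\<phi> x) \<partial>lborel)) * real (Suc n)"
      by (simp only: integral_mult_left_zero Bochner_Integration.integral_diff[OF Gint Gint])
    also have "\<dots> = (measure lborel (K \<inter> (\<lambda>x. x + ((?t n *\<^sub>R b) \<bullet> x + ?t n * s) *\<^sub>R u) ` L)
        - measure lborel (K \<inter> L)) * real (Suc n)"
      unfolding vol[symmetric] by simp
    also have "\<dots> \<le> 0"
    proof -
      have "(?t n *\<^sub>R b) \<bullet> u = 0" using b by simp
      then have "measure lborel (K \<inter> (\<lambda>x. x + ((?t n *\<^sub>R b) \<bullet> x + ?t n * s) *\<^sub>R u) ` L) \<le> measure lborel (K \<inter> L)"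
        using max u unfolding shear_maximal_def by blast
      then show ?thesis by (simp add: mult_nonpos_nonneg)
    qed
    finally show ?thesis .
  qed
  let ?S = "frontier K \<inter> frontier L"
  let ?Z = "slab u \<inter> proj u -` (proj u ` ?S)"
  have Z: "?Z \<in> null_sets lborel"
    by (intro null_shadow u null compact_Int compact_frontier K.compact compact)
  have lim: "(\<lambda>n. q n x) \<longlonglongrightarrow> D x" if x: "x \<notin> ?Z" for x
  proof (cases "x \<in> ?W")
    case True
    then have dK: "x \<in> line_dom K u" and dL: "x \<in> line_dom L u" and sl: "x \<in> slab u" by auto
    \<comment> \<open>Coinciding ends give a point of both frontiers on the line through
      \<open>x\<close>, which puts \<open>x\<close> into the excluded null set.\<close>
    have ne: "p \<noteq> r" if p: "p \<in> {?l1 x, ?l2 x}" and r: "r \<in> {?k1 x, ?k2 x}" for p r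
    proof
      assume eq: "p = r"
      have "x + p *\<^sub>R u \<in> frontier L"
        using p L.top_point_frontier[OF dL] Lm.top_point_frontier[of x] dL by (auto simp: top_point_def)
      moreover have "x + p *\<^sub>R u \<in> frontier K"
        using r K.top_point_frontier[OF dK] Km.top_point_frontier[of x] dK by (auto simp: top_point_def eq)
      ultimately have "proj u (x + p *\<^sub>R u) \<in> proj u ` ?S" by blast
      then show False using x sl by (simp add: proj_add_scale[OF u])
    qed
    \<comment> \<open>The smallest of the four gaps between the ends: for shifts below it the
      overlap is exactly linear, so the quotients are eventually constant.\<close>
    define \<eta> where "\<eta> = Min {\<bar>?l1 x - ?k1 x\<bar>, \<bar>?l1 x - ?k2 x\<bar>, \<bar>?l2 x - ?k1 x\<bar>, \<bar>?l2 x - ?k2 x\<bar>}"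
    have \<eta>: "0 < \<eta>"
      using ne[of "?l1 x" "?k1 x"] ne[of "?l1 x" "?k2 x"] ne[of "?l2 x" "?k1 x"] ne[of "?l2 x" "?k2 x"]
      by (simp add: \<eta>_def)
    have "(\<lambda>n. ?t n * ?\<phi> x) \<longlonglongrightarrow> 0 * ?\<phi> x"
      by (intro tendsto_mult tendsto_const LIMSEQ_inverse_real_of_nat[unfolded inverse_eq_divide])
    then have "\<forall>\<^sub>F n in sequentially. \<bar>?t n * ?\<phi> x\<bar> < \<eta>"
      using \<eta> by (auto dest!: tendstoD[of _ _ _ \<eta>] simp: dist_real_def)
    then have "\<forall>\<^sub>F n in sequentially. q n x = D x"
    proof eventually_elim
      case (elim n)
      have "?G x (?t n * ?\<phi> x) - ?G x 0 = (?t n * ?\<phi> x) * (indicator {?k1 x..?k2 x} (?l2 x) - indicator {?k1 x..?k2 x} (?l1 x))"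
        using elim by (intro overlap_linear K.heights_le L.heights_le dK dL) (auto simp: \<eta>_def)
      then show ?case by (simp add: q_def D_def)
    qed
    then show ?thesis by (rule tendsto_eventually)
  next
    case False
    then show ?thesis by (simp add: q_def D_def)
  qed
  \<comment> \<open>Indicators of intervals with moving ends are replaced by membership of the end
    points in \<open>K\<close>, a composition of measurable maps.\<close>
  have Dm: "D \<in> borel_measurable borel"
  proof -
    have "D = (\<lambda>x. indicator ?W x * (?\<phi> x * (indicator K (x + ?l2 x *\<^sub>R u) - indicator K (x + ?l1 x *\<^sub>R u))))"
    proof
      fix x
      show "D x = indicator ?W x * (?\<phi> x * (indicator K (x + ?l2 x *\<^sub>R u) - indicator K (x + ?l1 x *\<^sub>R u)))"
      proof (cases "x \<in> ?W")
        case True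
        then have "indicator K (x + r *\<^sub>R u) = (indicator {?k1 x..?k2 x} r :: real)" for r
          by (simp add: indicator_def K.in_section_iff)
        then show ?thesis by (simp only: D_def)
      qed (simp add: D_def)
    qed
    then show ?thesis by (simp only:) measurable
  qed
  have "(\<lambda>n. \<integral>x. q n x \<partial>lborel) \<longlonglongrightarrow> (\<integral>x. D x \<partial>lborel)"
  proof (rule integral_dominated_convergence[where w="\<lambda>x. indicator ?W x * C"])
    show "AE x in lborel. (\<lambda>n. q n x) \<longlonglongrightarrow> D x"
    proof (rule AE_I'[OF Z], rule subsetI, rule ccontr)
      fix x assume "x \<in> {x \<in> space lborel. \<not> (\<lambda>n. q n x) \<longlonglongrightarrow> D x}" "x \<notin> ?Z"
      then show False using lim[of x] by blast
    qed
  qed (use Dm qm intC qC in auto)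
  then have D0: "(\<integral>x. D x \<partial>lborel) \<le> 0"
    by (rule LIMSEQ_le_const2) (use q0 in auto)
  define f where "f = (\<lambda>x. indicator (K \<inter> frontier L) x * ?\<phi> x)"
  have fm[measurable]: "f \<in> borel_measurable borel"
    unfolding f_def by measurable
  obtain Q where Q: "0 < Q" "\<And>x. x \<in> L \<Longrightarrow> norm x \<le> Q" by (metis bound)
  have fb: "\<bar>f x\<bar> \<le> norm b * Q + \<bar>s\<bar>" for x
  proof (cases "x \<in> frontier L")
    case True
    then have "x \<in> L" using frontier_subset by blast
    have "\<bar>?\<phi> x\<bar> \<le> \<bar>b \<bullet> x\<bar> + \<bar>s\<bar>" by (rule abs_triangle_ineq)
    also have "\<bar>b \<bullet> x\<bar> \<le> norm b * norm x" by (rule Cauchy_Schwarz_ineq2)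
    also have "norm b * norm x \<le> norm b * Q" using Q(2)[OF \<open>x \<in> L\<close>] by (intro mult_left_mono) auto
    finally have "\<bar>?\<phi> x\<bar> \<le> norm b * Q + \<bar>s\<bar>" by simp
    moreover have "\<bar>f x\<bar> \<le> \<bar>?\<phi> x\<bar>" by (simp add: f_def split: split_indicator)
    ultimately show ?thesis by simp
  qed (use Q in \<open>simp add: f_def\<close>)
  \<comment> \<open>The displacement is constant along the line, so its value at either end of the
    section equals its value at \<open>x\<close>; membership of that end in \<open>K\<close> gives
    the indicator in \<open>D\<close>.\<close>
  have mid: "(\<integral>x. indicator (slab u \<inter> line_dom L u) x * f (top_point L u x) \<partial>lborel)
      - (\<integral>x. indicator (slab u \<inter> line_dom L u) x * f (top_point L (- u) x) \<partial>lborel) = (\<integral>x. D x \<partial>lborel)"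
  proof -
    have int: "integrable lborel (\<lambda>x. indicator (slab u \<inter> line_dom L u) x * f (top_point L v x))" if v: "v = u \<or> v = - u" for v
    proof (rule Bochner_Integration.integrable_bound)
      show "integrable lborel (\<lambda>x. indicator (slab u \<inter> line_dom L u) x * (norm b * Q + \<bar>s\<bar>))"
        using L.emeasure_slab_dom_finite by (intro integrable_mult_left integrable_real_indicator) auto
      have "top_point L v \<in> borel_measurable borel" using v L.top_point_measurable Lm.top_point_measurable by auto
      then show "(\<lambda>x. indicator (slab u \<inter> line_dom L u) x * f (top_point L v x)) \<in> borel_measurable lborel"
        by measurable
      show "AE x in lborel. norm (indicator (slab u \<inter> line_dom L u) x * f (top_point L v x))
          \<le> norm (indicator (slab u \<inter> line_dom L u) x * (norm b * Q + \<bar>s\<bar>))"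
        using fb by (intro AE_I2) (auto split: split_indicator intro: order_trans[OF _ abs_ge_self])
    qed
    have "(\<integral>x. indicator (slab u \<inter> line_dom L u) x * f (top_point L u x)
        - indicator (slab u \<inter> line_dom L u) x * f (top_point L (- u) x) \<partial>lborel) = (\<integral>x. D x \<partial>lborel)"
    proof (intro Bochner_Integration.integral_cong refl)
      fix x
      show "indicator (slab u \<inter> line_dom L u) x * f (top_point L u x)
        - indicator (slab u \<inter> line_dom L u) x * f (top_point L (- u) x) = D x"
      proof (cases "x \<in> slab u \<inter> line_dom L u")
        case True
        then have dL: "x \<in> line_dom L u" by simp
        have fr: "top_point L u x \<in> frontier L" "top_point L (- u) x \<in> frontier L"
          using L.top_point_frontier[OF dL] Lm.top_point_frontier[of x] dL by auto
        have \<phi>: "?\<phi> (x + r *\<^sub>R u) = ?\<phi> x" for r by (simp add: inner_add_right b)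
        have f1: "f (top_point L u x) = indicator K (x + ?l2 x *\<^sub>R u) * ?\<phi> x"
          using fr(1) \<phi>[of "?l2 x"] by (simp add: f_def top_point_def split: split_indicator)
        have f2: "f (top_point L (- u) x) = indicator K (x + ?l1 x *\<^sub>R u) * ?\<phi> x"
          using fr(2) \<phi>[of "?l1 x"] by (simp add: f_def top_point_def split: split_indicator)
        show ?thesis
        proof (cases "x \<in> line_dom K u")
          case dK: True
          have ind: "indicator K (x + r *\<^sub>R u) = (indicator {?k1 x..?k2 x} r :: real)" for r
            by (simp add: indicator_def K.in_section_iff[OF dK])
          show ?thesis unfolding f1 f2 D_def ind using True dK by (simp add: algebra_simps)
        next
          case False
          then have ind: "indicator K (x + r *\<^sub>R u) = (0 :: real)" for r
            by (auto simp: line_dom_def indicator_def)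
          show ?thesis unfolding f1 f2 D_def ind using False by simp
        qed
      next
        case False
        then show ?thesis by (auto simp: D_def)
      qed
    qed
    then show ?thesis using int[of u] int[of "- u"] by simp
  qed
  have "(\<integral>x. f x * (normal_field x \<bullet> u) \<partial>surface_measure)
      = c * ((\<integral>x. f x \<partial>top_measure L u) - (\<integral>x. f x \<partial>top_measure L (- u)))"
    by (rule top_measure_eq_normal_integral[OF u fm fb, symmetric])
  also have "\<dots> = c * (\<integral>x. D x \<partial>lborel)"
    using mid by (simp add: L.integral_top_measure Lm.integral_top_measure)
  also have "\<dots> \<le> 0" using c0 D0 by (simp add: mult_le_0_iff)
  finally show ?thesis by (simp add: f_def)
qed

text \<open>The integrand is linear in \<open>(b, s)\<close>, and the inequality also holds for
  \<open>(- b, - s)\<close>.\<close>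

lemma maximal_flux_zero:
  assumes K: "solid K" and max: "shear_maximal K L"
    and null: "emeasure surface_measure (frontier K \<inter> frontier L) = 0"
    and u: "norm u = 1" and b: "b \<bullet> u = 0"
  shows "(\<integral>x. (indicator (K \<inter> frontier L) x * (b \<bullet> x + s)) * (normal_field x \<bullet> u) \<partial>surface_measure) = 0"
proof (rule antisym)
  show "(\<integral>x. (indicator (K \<inter> frontier L) x * (b \<bullet> x + s)) * (normal_field x \<bullet> u) \<partial>surface_measure) \<le> 0"
    by (rule maximal_flux_le[OF assms])
  have b': "- b \<bullet> u = 0" using b by simp
  have "(\<integral>x. (indicator (K \<inter> frontier L) x * (- b \<bullet> x + - s)) * (normal_field x \<bullet> u) \<partial>surface_measure) \<le> 0"
    by (rule maximal_flux_le[OF K max null u b'])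
  also have "(\<integral>x. (indicator (K \<inter> frontier L) x * (- b \<bullet> x + - s)) * (normal_field x \<bullet> u) \<partial>surface_measure)
      = (\<integral>x. - ((indicator (K \<inter> frontier L) x * (b \<bullet> x + s)) * (normal_field x \<bullet> u)) \<partial>surface_measure)"
    by (intro Bochner_Integration.integral_cong refl) (simp add: algebra_simps)
  finally show "0 \<le> (\<integral>x. (indicator (K \<inter> frontier L) x * (b \<bullet> x + s)) * (normal_field x \<bullet> u) \<partial>surface_measure)"
    by simp
qed

end

section \<open>Consequences for maximal intersections\<close>

lemma outer_prod_mult_vec: "outer_prod u b *v x = (b \<bullet> x) *\<^sub>R u"
  by (simp add: vec_eq_iff outer_prod_def matrix_vector_mult_def inner_vec_def sum_distrib_left mult_ac)

text \<open>The matrix arises from the identity by adding to row \<open>k\<close> a combination of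
  the other rows, since the coefficient \<open>b $ k\<close> vanishes.\<close>

lemma det_mat_1_plus_axis_row:
  fixes b :: "real^'n"
  assumes "b $ k = 0"
  shows "det (mat 1 + outer_prod (axis k 1) b) = 1"
proof -
  let ?A = "mat 1 :: real^'n^'n"
  have row: "row j ?A = axis j 1" for j
    by (simp add: row_def mat_def axis_def vec_eq_iff)
  have "b = (\<Sum>j\<in>UNIV - {k}. b $ j *s axis j 1)"
  proof -
    have "b = (\<Sum>j\<in>UNIV. b $ j *s axis j 1)"
      by (rule basis_expansion[symmetric])
    also have "\<dots> = (\<Sum>j\<in>UNIV - {k}. b $ j *s axis j 1)"
      using assms by (subst sum.remove[of _ k]) auto
    finally show ?thesis .
  qed
  also have "\<dots> \<in> vec.span {row j ?A |j. j \<noteq> k}"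
    by (intro vec.span_sum vec.span_scale vec.span_base) (auto simp: row)
  finally have "det (\<chi> i. if i = k then row k ?A + b else row i ?A) = det ?A"
    by (rule det_row_span)
  also have "(\<chi> i. if i = k then row k ?A + b else row i ?A) = mat 1 + outer_prod (axis k 1) b"
    by (auto simp: vec_eq_iff row_def outer_prod_def axis_def mat_def)
  finally show ?thesis by simp
qed

text \<open>Conjugation by an orthogonal matrix that takes a coordinate vector to \<open>u\<close>
  leaves the determinant unchanged and reduces to a shear along an axis.\<close>

lemma det_shear:
  fixes u b :: "real^'n"
  assumes u: "norm u = 1" and b: "b \<bullet> u = 0"
  shows "det (mat 1 + outer_prod u b) = 1"
proof -
  obtain k :: 'n and Q where Q: "orthogonal_matrix Q" "Q *v axis k 1 = u"
    using orthogonal_matrix_exists_basis[OF u] by metis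
  have QQ: "transpose Q ** Q = mat 1" "Q ** transpose Q = mat 1"
    using Q(1) by (auto simp: orthogonal_matrix_def)
  let ?M = "mat 1 + outer_prod u b" and ?b = "transpose Q *v b"
  have tu: "transpose Q *v u = axis k 1"
    unfolding Q(2)[symmetric] matrix_vector_mul_assoc QQ by (rule matrix_vector_mul_lid)
  have dot: "b \<bullet> (Q *v x) = ?b \<bullet> x" for x
    by (metis dot_lmul_matrix transpose_matrix_vector transpose_transpose)
  have "transpose Q ** ?M ** Q = mat 1 + outer_prod (axis k 1) ?b"
  proof (rule matrix_eq[THEN iffD2], rule allI)
    fix x
    have "(transpose Q ** ?M ** Q) *v x = transpose Q *v (?M *v (Q *v x))"
      by (simp add: matrix_vector_mul_assoc matrix_mul_assoc)
    also have "?M *v (Q *v x) = Q *v x + (?b \<bullet> x) *\<^sub>R u"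
      by (simp add: matrix_vector_mult_add_rdistrib outer_prod_mult_vec dot)
    also have "transpose Q *v \<dots> = x + (?b \<bullet> x) *\<^sub>R axis k 1"
      unfolding matrix_vector_right_distrib matrix_vector_mult_scaleR tu matrix_vector_mul_assoc QQ
      by (simp only: matrix_vector_mul_lid)
    also have "\<dots> = (mat 1 + outer_prod (axis k 1) ?b) *v x"
      by (simp add: matrix_vector_mult_add_rdistrib outer_prod_mult_vec)
    finally show "(transpose Q ** ?M ** Q) *v x = (mat 1 + outer_prod (axis k 1) ?b) *v x" .
  qed
  moreover have "?b $ k = 0"
  proof -
    have "?b $ k = ?b \<bullet> axis k 1" by (simp add: inner_axis)
    also have "\<dots> = b \<bullet> u" using dot[of "axis k 1"] Q(2) by simp
    finally show ?thesis using b by simp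
  qed
  ultimately have "det (transpose Q ** ?M ** Q) = 1"
    using det_mat_1_plus_axis_row[of ?b k] by simp
  moreover have "det (transpose Q ** ?M ** Q) = det (Q ** transpose Q) * det ?M"
    by (simp add: det_mul)
  ultimately show ?thesis by (simp add: QQ)
qed

lemma maximal_intersection_imp_shear_maximal:
  fixes K L :: "(real^'n) set"
  assumes "maximal_intersection_position K L"
  shows "shear_maximal K L"
  unfolding shear_maximal_def
proof (intro allI impI)
  fix u b :: "real^'n" and s assume u: "norm u = 1" and b: "b \<bullet> u = 0"
  have "(\<lambda>x. (mat 1 + outer_prod u b) *v x + s *\<^sub>R u) = (\<lambda>x. x + (b \<bullet> x + s) *\<^sub>R u)"
    by (simp add: matrix_vector_mult_add_rdistrib outer_prod_mult_vec algebra_simps fun_eq_iff)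
  then show "measure lborel (K \<inter> (\<lambda>x. x + (b \<bullet> x + s) *\<^sub>R u) ` L) \<le> measure lborel (K \<inter> L)"
    using assms det_shear[OF u b] unfolding maximal_intersection_position_def by metis
qed

lemma outer_prod_measurable [measurable]:
  assumes [measurable]: "f \<in> borel_measurable M" "g \<in> borel_measurable M"
  shows "(\<lambda>x. outer_prod (f x) (g x :: real^'n)) \<in> borel_measurable M"
proof (rule borel_measurable_continuous_Pair[OF assms])
  show "continuous_on UNIV (\<lambda>x. outer_prod (fst x) (snd x :: real^'n))"
    unfolding outer_prod_def by (intro continuous_intros)
qed

lemma norm_outer_prod: "norm (outer_prod x (y :: real^'n)) = norm x * norm y"
proof -
  have row: "outer_prod x y $ i = (x $ i) *\<^sub>R y" for i
    by (simp add: outer_prod_def vec_eq_iff)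
  show ?thesis
    by (simp add: norm_vec_def[of "outer_prod x y"] row norm_vec_def[of x] L2_set_left_distrib)
qed

text \<open>Every vector is an eigenvector. Coordinate vectors for \<open>u\<close> and
  \<open>b\<close> show that off-diagonal entries vanish; the normalised sum of two coordinate
  vectors, tested against their difference, equates two diagonal entries.\<close>

lemma scalar_matrix_if_shear_orthogonal:
  fixes M :: "real^'n^'n"
  assumes M: "\<And>u b. norm u = 1 \<Longrightarrow> b \<bullet> u = 0 \<Longrightarrow> b \<bullet> (M *v u) = 0"
  shows "\<exists>c. M = c *\<^sub>R mat 1"
proof -
  have entry: "axis i 1 \<bullet> (M *v axis j 1) = M $ i $ j" for i j
    by (simp add: inner_axis' matrix_vector_mult_basis column_def)
  have off: "M $ i $ j = 0" if "i \<noteq> j" for i j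
    using M[of "axis j 1" "axis i 1"] that by (simp add: entry inner_axis_axis)
  have diag: "M $ i $ i = M $ j $ j" if "i \<noteq> j" for i j
  proof -
    let ?v = "axis i 1 + axis j 1 :: real^'n"
    have nv: "?v \<bullet> ?v = 2"
      using that by (simp add: inner_add_left inner_add_right inner_axis_axis)
    then have v: "norm ?v \<noteq> 0" by auto
    have "(axis i 1 - axis j 1) \<bullet> (?v /\<^sub>R norm ?v) = 0"
      using that by (simp add: inner_add_right inner_diff_left inner_axis_axis)
    then have "(axis i 1 - axis j 1) \<bullet> (M *v (?v /\<^sub>R norm ?v)) = 0"
      using v by (intro M) auto
    then have "(axis i 1 - axis j 1) \<bullet> (M *v ?v) = 0"
      using v by (simp add: matrix_vector_mult_scaleR)
    then have "M $ i $ i + M $ i $ j - (M $ j $ i + M $ j $ j) = 0"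
      unfolding inner_diff_left matrix_vector_right_distrib inner_add_right entry by linarith
    then show ?thesis using off that by simp
  qed
  have "M = (M $ k $ k) *\<^sub>R mat 1" for k
  proof -
    have entries: "M $ i $ j = (if i = j then M $ k $ k else 0)" for i j
      using off[of i j] diag[of i k] by metis
    show ?thesis
      unfolding vec_eq_iff
    proof (intro allI)
      fix i j
      show "M $ i $ j = (M $ k $ k *\<^sub>R mat 1) $ i $ j"
        by (subst entries[of i j]) (simp add: mat_def)
    qed
  qed
  then show ?thesis by blast
qed

context solid_area begin

text \<open>On the frontier \<open>outer_unit_normal\<close> and \<open>normal_field\<close> agree,
  so the vanishing of the first variation can be read off for the integrals of the theorem:
  translations give the vector, shears without translation part give the matrix.\<close>

lemma normal_field_integrals:
  assumes K: "solid K" and max: "shear_maximal K L"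
    and null: "emeasure surface_measure (frontier K \<inter> frontier L) = 0"
  shows "set_integrable surface_measure (K \<inter> frontier L) (outer_unit_normal L)"
    and "(LINT x : K \<inter> frontier L | surface_measure. outer_unit_normal L x) = 0"
    and "set_integrable surface_measure (K \<inter> frontier L) (\<lambda>x. outer_prod x (outer_unit_normal L x))"
    and "\<exists>c. (LINT x : K \<inter> frontier L | surface_measure. outer_prod x (outer_unit_normal L x)) = c *\<^sub>R mat 1"
proof -
  interpret K: solid K by fact
  let ?S = "K \<inter> frontier L"
  have S[measurable]: "?S \<in> sets borel" by measurable
  have eq1: "(\<lambda>x. indicator ?S x *\<^sub>R outer_unit_normal L x) = (\<lambda>x. indicator ?S x *\<^sub>R normal_field x)"
    by (auto simp: fun_eq_iff normal_field_def split: split_indicator)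
  have eq2: "(\<lambda>x. indicator ?S x *\<^sub>R outer_prod x (outer_unit_normal L x)) = (\<lambda>x. indicator ?S x *\<^sub>R outer_prod x (normal_field x))"
    by (auto simp: fun_eq_iff normal_field_def split: split_indicator)
  have int1: "integrable surface_measure (\<lambda>x. indicator ?S x *\<^sub>R normal_field x)"
    by (rule integrable_normal_on[OF S])
  obtain R where R: "0 < R" "\<And>x. x \<in> L \<Longrightarrow> norm x \<le> R" by (metis bound)
  have int2: "integrable surface_measure (\<lambda>x. indicator ?S x *\<^sub>R outer_prod x (normal_field x))"
  proof (rule integrable_bounded_on_frontier[where b=R])
    fix x
    show "norm (indicator ?S x *\<^sub>R outer_prod x (normal_field x)) \<le> R * indicator (frontier L) x"
    proof (cases "x \<in> ?S")
      case True
      then have "norm x \<le> R" using R frontier_subset by auto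
      moreover have "norm (normal_field x) \<le> 1" using norm_normal_field[of x] True by simp
      ultimately have "norm x * norm (normal_field x) \<le> R * 1"
        using R by (intro mult_mono) auto
      then show ?thesis using True by (simp add: norm_outer_prod)
    qed (use R in simp)
  qed measurable
  show "set_integrable surface_measure ?S (outer_unit_normal L)"
    unfolding set_integrable_def eq1 by (rule int1)
  show "set_integrable surface_measure ?S (\<lambda>x. outer_prod x (outer_unit_normal L x))"
    unfolding set_integrable_def eq2 by (rule int2)
  let ?N = "\<integral>x. indicator ?S x *\<^sub>R normal_field x \<partial>surface_measure"
  let ?M = "\<integral>x. indicator ?S x *\<^sub>R outer_prod x (normal_field x) \<partial>surface_measure"
  have orth: "?N \<bullet> u = 0" if u: "norm u = 1" for u
  proof -
    have "?N \<bullet> u = (\<integral>x. (indicator ?S x *\<^sub>R normal_field x) \<bullet> u \<partial>surface_measure)"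
      by (rule integral_inner_left[OF int1, symmetric])
    \<comment> \<open>With \<open>b = 0\<close> and \<open>s = 1\<close> the motion is the
      translation along \<open>u\<close>.\<close>
    also have "\<dots> = (\<integral>x. (indicator ?S x * (0 \<bullet> x + 1)) * (normal_field x \<bullet> u) \<partial>surface_measure)"
      by (intro Bochner_Integration.integral_cong refl) simp
    also have "\<dots> = 0" by (rule maximal_flux_zero[OF K max null u]) simp
    finally show ?thesis .
  qed
  have "?N = 0"
    by (rule euclidean_eqI) (simp only: inner_zero_left norm_Basis orth)
  then show "(LINT x : ?S | surface_measure. outer_unit_normal L x) = 0"
    unfolding set_lebesgue_integral_def eq1 .
  have "b \<bullet> (?M *v u) = 0" if u: "norm u = 1" and b: "b \<bullet> u = 0" for u b
  proof -
    have bl: "bounded_linear (\<lambda>A :: real^'n^'n. b \<bullet> (A *v u))"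
      by (intro linear_conv_bounded_linear[THEN iffD1] linearI)
         (simp_all add: matrix_vector_mult_add_rdistrib inner_add_right scaleR_matrix_vector_assoc[symmetric])
    have "b \<bullet> (?M *v u) = (\<integral>x. b \<bullet> ((indicator ?S x *\<^sub>R outer_prod x (normal_field x)) *v u) \<partial>surface_measure)"
      by (rule integral_bounded_linear[OF bl int2, symmetric])
    \<comment> \<open>Applying the outer product of \<open>x\<close> and the normal to
      \<open>u\<close> gives \<open>x\<close> scaled by the normal component, which leaves the
      factor \<open>b \<bullet> x\<close>: the case \<open>s = 0\<close>.\<close>
    also have "\<dots> = (\<integral>x. (indicator ?S x * (b \<bullet> x + 0)) * (normal_field x \<bullet> u) \<partial>surface_measure)"
      by (intro Bochner_Integration.integral_cong refl)
         (simp add: scaleR_matrix_vector_assoc[symmetric] outer_prod_mult_vec)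
    also have "\<dots> = 0" by (rule maximal_flux_zero[OF K max null u b])
    finally show ?thesis .
  qed
  then have "\<exists>c. ?M = c *\<^sub>R mat 1" by (rule scalar_matrix_if_shear_orthogonal)
  then show "\<exists>c. (LINT x : ?S | surface_measure. outer_prod x (outer_unit_normal L x)) = c *\<^sub>R mat 1"
    unfolding set_lebesgue_integral_def eq2 .
qed

end

theorem theorem1p4:
  fixes K L :: "(real^'n) set"
  assumes "convex_body K" and "convex_body L"
    and "maximal_intersection_position K L"
    and "emeasure surface_measure (frontier K \<inter> frontier L) = 0"
  shows
    "((AE x in surface_measure. x \<in> frontier L \<longrightarrow> (\<exists>!u. u \<in> outer_unit_normals L x)) \<and>
     set_integrable surface_measure (K \<inter> frontier L) (outer_unit_normal L) \<and>
     (LINT x : K \<inter> frontier L | surface_measure. outer_unit_normal L x) = 0 \<and>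
     set_integrable surface_measure (K \<inter> frontier L) (\<lambda>x. outer_prod x (outer_unit_normal L x)) \<and>
     (\<exists>c. (LINT x : K \<inter> frontier L | surface_measure. outer_prod x (outer_unit_normal L x)) = c *\<^sub>R mat 1))
     \<and>
     ((AE x in surface_measure. x \<in> frontier K \<longrightarrow> (\<exists>!u. u \<in> outer_unit_normals K x)) \<and>
     set_integrable surface_measure (L \<inter> frontier K) (outer_unit_normal K) \<and>
     (LINT x : L \<inter> frontier K | surface_measure. outer_unit_normal K x) = 0 \<and>
     set_integrable surface_measure (L \<inter> frontier K) (\<lambda>x. outer_prod x (outer_unit_normal K x)) \<and>
     (\<exists>c. (LINT x : L \<inter> frontier K | surface_measure. outer_prod x (outer_unit_normal K x)) = c *\<^sub>R mat 1))"
proof -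
  have dim: "DIM(real^'n) = CARD('n)" by simp
  obtain c where c: "0 < c" "\<forall>(u :: real^'n) T. norm u = 1 \<longrightarrow> T \<in> sets borel \<longrightarrow> T \<subseteq> hyp u \<longrightarrow>
      hausdorff_outer (CARD('n) - 1) T = ennreal c * emeasure lborel (slab u \<inter> proj u -` T)"
    using hausdorff_outer_hyp_eq_lborel[where 'n='n] unfolding dim by blast
  interpret K: solid_area K c by unfold_locales (use assms(1) c in auto)
  interpret L: solid_area L c by unfold_locales (use assms(2) c in auto)
  have KL: "shear_maximal K L"
    using assms(3) by (rule maximal_intersection_imp_shear_maximal)
  have LK: "shear_maximal L K"
    using K.solid_axioms L.solid_axioms KL by (rule shear_maximal_swap)
  have null: "emeasure surface_measure (frontier L \<inter> frontier K) = 0"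
    using assms(4) by (simp only: Int_commute)
  show ?thesis
    by (intro conjI K.AE_unique_normal L.AE_unique_normal
        L.normal_field_integrals[OF K.solid_axioms KL assms(4)]
        K.normal_field_integrals[OF L.solid_axioms LK null])
qed

end
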